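(* Let $A$ be a central simple division algebra of degree $d$ over a field $F$ of characteristic $0$ or greater than $d$. Let $K/F$ be a finite field extension (which need not be separable) of degree $n$ with $F$-basis $w_1,\dots,w_n$, put $\bar A=A\otimes_F K$, and let $\Delta=\sum_{i=1}^n\alpha_iw_i\in\bar A$ with $\alpha_i\in A$. Then $$N_{K/F}(N_{\bar A/K}(\Delta))=N_{A/F}(\det\rho(\Delta)).$$
   Context: $N_{A/F}$ and $N_{\bar A/K}$ denote the reduced norms of the central simple algebras $A$ over $F$ and $\bar A$ over $K$. The map $\rho_\Delta:\bar A\to\bar A$, $x\mapsto\Delta x$, is left multiplication by $\Delta$; it is linear for the right $A$-module structure on $\bar A$, which is free with basis $w_1,\dots,w_n$ (identified with $1\otimes w_i$), and $\rho(\Delta)\in M_n(A)$ is its matrix with respect to this basis, i.e. $\Delta w_j=\sum_k w_k\,\rho(\Delta)_{kj}$. Here $\det:\mathrm{GL}_n(A)\to A^\times/[A^\times,A^\times]$ is the Dieudonné determinant, with the convention that $\det$ of a non-invertible matrix is $0$. Since $N_{A/F}$ is trivial on commutators, it induces a well-defined map on $A^\times/[A^\times,A^\times]$, and $N_{A/F}(0)=0$. *)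

theory Defs
  imports
    "HOL-Library.Poly_Mapping"
    "HOL-Algebra.Algebraic_Closure_Type"
    "Jordan_Normal_Form.Determinant"
begin

text \<open>
  An algebra over a field \<open>'f\<close> is a ring \<open>'b\<close> together with its structure map
  \<open>s :: 'f \<Rightarrow> 'b\<close>, a unital ring homomorphism into the centre of \<open>'b\<close>.  A field extension
  \<open>K / F\<close> is the commutative instance of this.  Index ranges are \<open>{..<n}\<close>.
\<close>

definition algebra_map :: "('f::field \<Rightarrow> 'b::ring_1) \<Rightarrow> bool" where
  "algebra_map s \<longleftrightarrow> Ring_Hom.ring_hom s \<and> (\<forall>c x. s c * x = x * s c)"

definition algebra_basis :: "('f::field \<Rightarrow> 'b::ring_1) \<Rightarrow> nat \<Rightarrow> (nat \<Rightarrow> 'b) \<Rightarrow> bool" where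
  "algebra_basis s n w \<longleftrightarrow>
     inj_on w {..<n} \<and>
     \<not> module.dependent (\<lambda>c x. s c * x) (w ` {..<n}) \<and>
     module.span (\<lambda>c x. s c * x) (w ` {..<n}) = UNIV"

definition two_sided_ideal :: "'b::ring_1 set \<Rightarrow> bool" where
  "two_sided_ideal I \<longleftrightarrow>
     0 \<in> I \<and> (\<forall>x\<in>I. \<forall>y\<in>I. x + y \<in> I) \<and> (\<forall>x\<in>I. \<forall>r. r * x \<in> I \<and> x * r \<in> I)"

definition central_simple_algebra :: "('f::field \<Rightarrow> 'b::ring_1) \<Rightarrow> nat \<Rightarrow> bool" where
  "central_simple_algebra s d \<longleftrightarrow>
     algebra_map s \<and>
     {z. \<forall>x. z * x = x * z} = range s \<and>
     (\<forall>I :: 'b set. two_sided_ideal I \<longrightarrow> I = {0} \<or> I = UNIV) \<and>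
     (\<exists>b. algebra_basis s (d\<^sup>2) b)"


subsection \<open>Tensor products\<close>

text \<open>
  The tensor product of \<open>A\<close> and \<open>K\<close> over \<open>F\<close> is the free abelian group on \<open>A \<times> K\<close> modulo the
  subgroup generated by the biadditivity relators and the \<open>F\<close>-balancing relators.
\<close>

inductive_set tensor_relators ::
  "('f::field \<Rightarrow> 'a::ring_1) \<Rightarrow> ('f \<Rightarrow> 'k::ring_1) \<Rightarrow> ('a \<times> 'k \<Rightarrow>\<^sub>0 int) set"
  for sA :: "'f \<Rightarrow> 'a" and sK :: "'f \<Rightarrow> 'k" where
  add_left: "frag_of (a + b, x) - frag_of (a, x) - frag_of (b, x) \<in> tensor_relators sA sK"
| add_right: "frag_of (a, x + y) - frag_of (a, x) - frag_of (a, y) \<in> tensor_relators sA sK"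
| balanced: "frag_of (a * sA c, x) - frag_of (a, sK c * x) \<in> tensor_relators sA sK"
| zero: "0 \<in> tensor_relators sA sK"
| diff: "u \<in> tensor_relators sA sK \<Longrightarrow> v \<in> tensor_relators sA sK \<Longrightarrow>
    u - v \<in> tensor_relators sA sK"

definition tensor_eval ::
  "('a::ring_1 \<Rightarrow> 'b::ring_1) \<Rightarrow> ('k::ring_1 \<Rightarrow> 'b) \<Rightarrow> ('a \<times> 'k \<Rightarrow>\<^sub>0 int) \<Rightarrow> 'b" where
  "tensor_eval jA jK u =
     (\<Sum>p \<in> Poly_Mapping.keys u. of_int (Poly_Mapping.lookup u p) * (jA (fst p) * jK (snd p)))"

text \<open>
  The ring \<open>'b\<close>, with \<open>jA a = a \<otimes> 1\<close> and \<open>jK x = 1 \<otimes> x\<close>, is the tensor product of the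
  \<open>F\<close>-algebras \<open>A\<close> and \<open>K\<close>: the map \<open>a \<otimes> x \<mapsto> jA a * jK x\<close> is a well-defined bijection from
  the above quotient onto \<open>'b\<close>, and it is multiplicative because \<open>jA\<close> and \<open>jK\<close> are ring
  homomorphisms with commuting images.  The structure maps cannot be parameters of a quotient
  type, so the tensor product is specified up to its canonical isomorphism.
\<close>

definition is_tensor_product ::
  "('f::field \<Rightarrow> 'a::ring_1) \<Rightarrow> ('f \<Rightarrow> 'k::ring_1) \<Rightarrow>
   ('a \<Rightarrow> 'b::ring_1) \<Rightarrow> ('k \<Rightarrow> 'b) \<Rightarrow> bool" where
  "is_tensor_product sA sK jA jK \<longleftrightarrow>
     Ring_Hom.ring_hom jA \<and> Ring_Hom.ring_hom jK \<and>
     (\<forall>a x. jA a * jK x = jK x * jA a) \<and>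
     surj (tensor_eval jA jK) \<and>
     {u. tensor_eval jA jK u = 0} = tensor_relators sA sK"


subsection \<open>Matrices of left multiplications and the field norm\<close>

text \<open>
  The ring \<open>'b\<close> is a right module over \<open>'a\<close> through \<open>j\<close>; if it is free with basis
  \<open>w 0, \<dots>, w (n - 1)\<close>, then this is the matrix \<open>M\<close> of \<open>y \<mapsto> x * y\<close>, normalised by
  \<open>x w\<^sub>j = \<Sum>\<^sub>k w\<^sub>k M\<^sub>k\<^sub>j\<close>.
\<close>

definition left_mult_matrix ::
  "('a::ring_1 \<Rightarrow> 'b::ring_1) \<Rightarrow> nat \<Rightarrow> (nat \<Rightarrow> 'b) \<Rightarrow> 'b \<Rightarrow> 'a mat" where
  "left_mult_matrix j n w x =
     (THE M. M \<in> carrier_mat n n \<and>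
        (\<forall>l<n. x * w l = (\<Sum>k<n. w k * j (M $$ (k, l)))))"

definition field_norm :: "('f::field \<Rightarrow> 'k::field) \<Rightarrow> 'k \<Rightarrow> 'f" where
  "field_norm s x =
     (THE c. \<exists>n w. algebra_basis s n w \<and> c = det (left_mult_matrix s n w x))"


subsection \<open>Reduced norm\<close>

text \<open>
  A splitting \<open>B \<otimes>\<^sub>F L \<cong> M\<^sub>d(L)\<close> over the algebraic closure \<open>L\<close> of \<open>F\<close> is given by its
  restriction \<open>\<phi>\<close> to \<open>B\<close>, an \<open>F\<close>-algebra homomorphism.  As the basis elements
  \<open>b\<^sub>i \<otimes> 1\<close> form an \<open>L\<close>-basis of \<open>B \<otimes>\<^sub>F L\<close>, the induced \<open>L\<close>-algebra map is an isomorphism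
  iff every matrix is a unique \<open>L\<close>-linear combination of the \<open>\<phi> b\<^sub>i\<close>.
\<close>

definition splitting ::
  "('f::field \<Rightarrow> 'b::ring_1) \<Rightarrow> nat \<Rightarrow> ('b \<Rightarrow> 'f alg_closure mat) \<Rightarrow> bool" where
  "splitting s d \<phi> \<longleftrightarrow>
     (\<forall>x. \<phi> x \<in> carrier_mat d d) \<and>
     \<phi> 1 = 1\<^sub>m d \<and>
     (\<forall>x y. \<phi> (x + y) = \<phi> x + \<phi> y) \<and>
     (\<forall>x y. \<phi> (x * y) = \<phi> x * \<phi> y) \<and>
     (\<forall>c. \<phi> (s c) = to_ac c \<cdot>\<^sub>m 1\<^sub>m d) \<and>
     (\<exists>m b. algebra_basis s m b \<and>
        (\<forall>M \<in> carrier_mat d d. \<exists>!v. v \<in> carrier_vec m \<and>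
           (\<forall>p<d. \<forall>q<d. M $$ (p, q) = (\<Sum>i<m. v $ i * \<phi> (b i) $$ (p, q)))))"

definition reduced_norm :: "('f::field \<Rightarrow> 'b::ring_1) \<Rightarrow> 'b \<Rightarrow> 'f" where
  "reduced_norm s x = (THE c. \<exists>d \<phi>. splitting s d \<phi> \<and> det (\<phi> x) = to_ac c)"


subsection \<open>Dieudonne determinant\<close>

inductive_set unit_commutators :: "'a::division_ring set" where
  commutator: "a \<noteq> 0 \<Longrightarrow> b \<noteq> 0 \<Longrightarrow> a * b * inverse a * inverse b \<in> unit_commutators"
| one: "1 \<in> unit_commutators"
| mult: "x \<in> unit_commutators \<Longrightarrow> y \<in> unit_commutators \<Longrightarrow> x * y \<in> unit_commutators"
| inv: "x \<in> unit_commutators \<Longrightarrow> inverse x \<in> unit_commutators"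

inductive_set elementary_group :: "nat \<Rightarrow> 'a::division_ring mat set" for n :: nat where
  one: "1\<^sub>m n \<in> elementary_group n"
| transvection: "E \<in> elementary_group n \<Longrightarrow> k < n \<Longrightarrow> l < n \<Longrightarrow> k \<noteq> l \<Longrightarrow>
    addrow_mat n a k l * E \<in> elementary_group n"

text \<open>
  Values are elements of \<open>A\<^sup>\<times>/[A\<^sup>\<times>,A\<^sup>\<times>]\<close>, i.e. cosets as subsets of \<open>A\<close>, or \<open>{0}\<close> for
  matrices that are not invertible.  Gaussian elimination writes an invertible matrix as
  \<open>E diag(1, \<dots>, 1, a)\<close> with \<open>E\<close> a product of transvections, and its determinant is the coset
  of \<open>a\<close>.  By Dieudonne's theorem all such \<open>a\<close> lie in one coset, so the set below, the union
  of the cosets of all such \<open>a\<close>, is that single coset.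
\<close>

definition dieudonne_det :: "'a::division_ring mat \<Rightarrow> 'a set" where
  "dieudonne_det M =
     (if invertible_mat M
      then {a * c | a c. a \<noteq> 0 \<and> c \<in> unit_commutators \<and>
             (\<exists>E \<in> elementary_group (dim_row M).
                M = E * multrow_mat (dim_row M) (dim_row M - 1) a)}
      else {0})"

text \<open>The map induced on cosets by the reduced norm, which is constant on each coset.\<close>

definition reduced_norm_coset :: "('f::field \<Rightarrow> 'a::division_ring) \<Rightarrow> 'a set \<Rightarrow> 'f" where
  "reduced_norm_coset s C = the_elem (reduced_norm s ` C)"

end

theory Submission
  imports Defs "Jordan_Normal_Form.Char_Poly" "HOL-Library.Function_Algebras"
begin

text \<open>
  Let \<open>\<phi>\<close> be a splitting of \<open>A\<close> over the algebraic closure of \<open>F\<close> and \<open>\<phi>(M)\<close> its entrywise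
  application to a matrix \<open>M\<close>.  Row reduction over \<open>A\<close> identifies the right-hand side with
  \<open>det \<phi>(\<rho>(\<Delta>))\<close>.  The \<open>d\<close>-th powers of both sides agree: up to reordering a basis, both are
  the determinant of \<open>\<Delta>\<close> acting on the \<open>F\<close>-space \<open>A \<otimes> K\<close>, because the left regular
  representation of \<open>A\<close> becomes \<open>d\<close> copies of \<open>\<phi>\<close>, and determinants are transitive along \<open>K / F\<close>.
  To extract the \<open>d\<close>-th root, every element \<open>x\<close> is replaced by the pencil \<open>1 + T (x - 1)\<close>:
  as \<open>d \<noteq> 0\<close> in \<open>F\<close>, a polynomial with constant term \<open>1\<close> is determined by its \<open>d\<close>-th power, and
  its coefficients lie in \<open>F\<close> if those of the \<open>d\<close>-th power do.  The latter also shows that the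
  reduced norm has values in \<open>F\<close> and does not depend on the splitting.  At \<open>T = 1\<close> one obtains
  the identity.
\<close>

subsection \<open>Block matrices\<close>

text \<open>It is the determinant of multiplication, and its compatibility with block matrices
  (\<open>det_block_map\<close>) links the two sides. That statement is applied to pencils, hence
  over polynomial rings, so it is proved for domains, where pivots are cleared without division.
  Comparing d-th powers of the norms themselves would leave a d-th root of unity undetermined. The
  characteristic condition enters as d \<noteq> 0 in F, and thus in K. Splittings come from
  Burnside's theorem: A acts irreducibly on a minimal submodule of the F-linear maps from A to an
  algebraically closed field L, so its image spans all matrices over L; since A is a division ring
  with centre F, an F-basis of A stays independent over L. This is done for the closure of F and for
  that of K, and the latter splitting extends K-linearly to A \<otimes> K.\<close>

lemma index_mult_mat_sum:
  assumes "A \<in> carrier_mat a b" "B \<in> carrier_mat b c" "i < a" "j < c"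
  shows "(A * B) $$ (i, j) = (\<Sum>k<b. A $$ (i, k) * B $$ (k, j))"
  using assms by (auto simp: scalar_prod_def atLeast0LessThan)

lemma sum_lessThan_times:
  "(\<Sum>x<n * m. f x) = (\<Sum>i<n. \<Sum>p<m. f (i * m + p))" for f :: "nat \<Rightarrow> 'a::comm_monoid_add"
proof (induction n)
  case (Suc n)
  have "(\<Sum>x<k + m. f x) = (\<Sum>x<k. f x) + (\<Sum>p<m. f (k + p))" for k
    by (induction m) (simp_all add: add.assoc)
  from this[of "n * m"] show ?case using Suc by (simp add: add.commute)
qed simp

lemma block_index_less: "(i::nat) < n \<Longrightarrow> p < m \<Longrightarrow> i * m + p < n * m"
proof -
  assume "i < n" "p < m"
  then have "i * m + p < Suc i * m" by simp
  also have "\<dots> \<le> n * m" using \<open>i < n\<close> by (intro mult_le_mono1) simp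
  finally show ?thesis .
qed

lemma div_mod_block:
  assumes "(x::nat) < n * m"
  shows "x div m < n" "x mod m < m" "0 < m"
proof -
  show "0 < m" using assms by (intro gr0I) auto
  then show "x div m < n" "x mod m < m" using assms by (auto simp: less_mult_imp_div_less)
qed

lemma div_mod_eqI: "x div m = y div m \<Longrightarrow> x mod m = y mod m \<Longrightarrow> x = y" for x y m :: nat
  by (metis div_mult_mod_eq)

definition block_map :: "nat \<Rightarrow> ('c \<Rightarrow> 'r mat) \<Rightarrow> 'c mat \<Rightarrow> 'r mat" where
  "block_map m g M = mat (dim_row M * m) (dim_col M * m)
     (\<lambda>(x, y). g (M $$ (x div m, y div m)) $$ (x mod m, y mod m))"

lemma block_map_carrier [simp]:
  "M \<in> carrier_mat a b \<Longrightarrow> block_map m g M \<in> carrier_mat (a * m) (b * m)"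
  by (auto simp: block_map_def)

lemma block_map_carrierI:
  "M \<in> carrier_mat a b \<Longrightarrow> a * m = a' \<Longrightarrow> b * m = b' \<Longrightarrow> block_map m g M \<in> carrier_mat a' b'"
  by (auto simp: block_map_def)

lemma block_map_index:
  assumes "M \<in> carrier_mat a b" "x < a * m" "y < b * m"
  shows "block_map m g M $$ (x, y) = g (M $$ (x div m, y div m)) $$ (x mod m, y mod m)"
  using assms by (auto simp: block_map_def)

lemma block_map_four_block:
  assumes "A \<in> carrier_mat a a" "B \<in> carrier_mat a b" "C \<in> carrier_mat b a" "D \<in> carrier_mat b b"
  shows "block_map m g (four_block_mat A B C D) =
    four_block_mat (block_map m g A) (block_map m g B) (block_map m g C) (block_map m g D)"
proof (rule eq_matI)
  fix x y
  assume "x < dim_row (four_block_mat (block_map m g A) (block_map m g B) (block_map m g C) (block_map m g D))"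
    and "y < dim_col (four_block_mat (block_map m g A) (block_map m g B) (block_map m g C) (block_map m g D))"
  with assms have x: "x < (a + b) * m" and y: "y < (a + b) * m"
    by (auto simp: block_map_def algebra_simps)
  have m: "0 < m" using x by (intro gr0I) auto
  have split: "z < a * m \<longleftrightarrow> z div m < a" for z using m by (simp add: div_less_iff_less_mult)
  have sh: "(z - a * m) div m = z div m - a" "(z - a * m) mod m = z mod m" "z - a * m < b * m"
    if "\<not> z < a * m" "z < (a + b) * m" for z
    using that m
    by (auto simp: div_mult_self_is_m algebra_simps le_mod_geq not_less
        dest!: le_Suc_ex)
  have d: "z div m < a + b" if "z < (a + b) * m" for z
    using that by (simp add: less_mult_imp_div_less)
  show "block_map m g (four_block_mat A B C D) $$ (x, y) =
    four_block_mat (block_map m g A) (block_map m g B) (block_map m g C) (block_map m g D) $$ (x, y)"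
    using assms x y sh[of x] sh[of y] d[of x] d[of y]
    by (auto simp: block_map_def split[symmetric] algebra_simps)
qed (use assms in \<open>auto simp: block_map_def algebra_simps\<close>)

text \<open>Compatibility with scalars is left out: left multiplication matrices, splittings, scalar
  matrices and polynomial extensions of these are linear over different rings, and all of them are
  instances.\<close>

locale mat_rep =
  fixes g :: "'c::ring_1 \<Rightarrow> 'r::comm_ring_1 mat" and m :: nat
  assumes carrier: "g x \<in> carrier_mat m m"
    and one: "g 1 = 1\<^sub>m m"
    and add: "g (x + y) = g x + g y"
    and mult: "g (x * y) = g x * g y"
begin

lemma dim [simp]: "dim_row (g x) = m" "dim_col (g x) = m"
  using carrier[of x] by auto

lemma add_index: "p < m \<Longrightarrow> q < m \<Longrightarrow> g (x + y) $$ (p, q) = g x $$ (p, q) + g y $$ (p, q)"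
  by (simp add: add)

lemma mult_index:
  "p < m \<Longrightarrow> q < m \<Longrightarrow> g (x * y) $$ (p, q) = (\<Sum>k<m. g x $$ (p, k) * g y $$ (k, q))"
  using index_mult_mat_sum[OF carrier carrier] by (simp add: mult del: index_mult_mat)

lemma zero_index: "p < m \<Longrightarrow> q < m \<Longrightarrow> g 0 $$ (p, q) = 0"
  using add_index[of p q 0 0] by simp

lemma zero: "g 0 = 0\<^sub>m m m"
  by (rule eq_matI) (auto simp: zero_index)

lemma sum_index:
  "p < m \<Longrightarrow> q < m \<Longrightarrow> g (\<Sum>i\<in>I. f i) $$ (p, q) = (\<Sum>i\<in>I. g (f i) $$ (p, q))"
  by (induction I rule: infinite_finite_induct) (auto simp: zero_index add_index)

lemma block_map_mult:
  assumes M: "M \<in> carrier_mat a b" and N: "N \<in> carrier_mat b c"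
  shows "block_map m g (M * N) = block_map m g M * block_map m g N"
proof (rule eq_matI)
  fix x y
  assume "x < dim_row (block_map m g M * block_map m g N)" "y < dim_col (block_map m g M * block_map m g N)"
  with M N have x: "x < a * m" and y: "y < c * m" by (auto simp: block_map_def)
  note dx = div_mod_block[OF x] and dy = div_mod_block[OF y]
  have "(block_map m g M * block_map m g N) $$ (x, y) =
      (\<Sum>z<b * m. block_map m g M $$ (x, z) * block_map m g N $$ (z, y))"
    using M N x y by (intro index_mult_mat_sum) auto
  also have "\<dots> = (\<Sum>j<b. \<Sum>k<m. g (M $$ (x div m, j)) $$ (x mod m, k) * g (N $$ (j, y div m)) $$ (k, y mod m))"
    unfolding sum_lessThan_times using M N x y dx
    by (intro sum.cong refl) (simp add: block_map_index block_index_less)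
  also have "\<dots> = (\<Sum>j<b. g (M $$ (x div m, j) * N $$ (j, y div m)) $$ (x mod m, y mod m))"
    using dx dy by (simp add: mult_index)
  also have "\<dots> = g ((M * N) $$ (x div m, y div m)) $$ (x mod m, y mod m)"
    using dx dy M N by (subst index_mult_mat_sum[OF M N]) (auto simp: sum_index)
  also have "\<dots> = block_map m g (M * N) $$ (x, y)"
    using M N x y by (subst block_map_index[of _ a c]) auto
  finally show "block_map m g (M * N) $$ (x, y) = (block_map m g M * block_map m g N) $$ (x, y)" ..
qed (use M N in \<open>auto simp: block_map_def\<close>)

lemma block_map_one: "block_map m g (1\<^sub>m a) = 1\<^sub>m (a * m)"
proof (rule eq_matI)
  fix x y assume "x < dim_row (1\<^sub>m (a * m))" "y < dim_col (1\<^sub>m (a * m))"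
  then have x: "x < a * m" and y: "y < a * m" by auto
  note dx = div_mod_block[OF x] and dy = div_mod_block[OF y]
  show "block_map m g (1\<^sub>m a) $$ (x, y) = 1\<^sub>m (a * m) $$ (x, y)"
    using x y dx dy
    by (auto dest: div_mod_eqI simp: block_map_def one zero_index)
qed (auto simp: block_map_def)

lemma block_map_zero: "block_map m g (0\<^sub>m a b) = 0\<^sub>m (a * m) (b * m)"
proof (rule eq_matI)
  fix x y assume "x < dim_row (0\<^sub>m (a * m) (b * m))" "y < dim_col (0\<^sub>m (a * m) (b * m))"
  then have x: "x < a * m" and y: "y < b * m" by auto
  show "block_map m g (0\<^sub>m a b) $$ (x, y) = 0\<^sub>m (a * m) (b * m) $$ (x, y)"
    using x y div_mod_block[OF x] div_mod_block[OF y]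
    by (auto simp: block_map_def zero_index)
qed (auto simp: block_map_def)

lemma block_map_single: "M \<in> carrier_mat 1 1 \<Longrightarrow> block_map m g M = g (M $$ (0, 0))"
  by (rule eq_matI) (auto simp: block_map_def)

lemma det_block_map_mult:
  "M \<in> carrier_mat a a \<Longrightarrow> N \<in> carrier_mat a a \<Longrightarrow>
   det (block_map m g (M * N)) = det (block_map m g M) * det (block_map m g N)"
  by (simp add: block_map_mult[of M a a N a] det_mult[of _ "a * m"])

lemma det_mult_rep: "det (g (x * y)) = det (g x) * det (g y)"
  by (simp add: mult det_mult[OF carrier carrier])

text \<open>At most one block off the diagonal is nonzero, so the block matrix is unitriangular:
  upper if \<open>k < l\<close>, lower otherwise.\<close>

lemma det_block_map_addrow_mat:
  assumes "k < a" "l < a" "k \<noteq> l"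
  shows "det (block_map m g (addrow_mat a c k l)) = 1"
proof -
  let ?B = "block_map m g (addrow_mat a c k l)"
  have B: "?B \<in> carrier_mat (a * m) (a * m)" by simp
  have idx: "?B $$ (x, y) = (if x = y then 1 else if x div m = k \<and> y div m = l then g c $$ (x mod m, y mod m) else 0)"
    if x: "x < a * m" and y: "y < a * m" for x y
    using x y div_mod_block[OF x] div_mod_block[OF y] assms
    by (auto dest: div_mod_eqI simp: block_map_index[of _ a a] one zero_index)
  have diag: "prod_list (diag_mat ?B) = 1"
    using carrier_matD[OF B] by (auto simp: prod_list_diag_prod idx intro!: prod.neutral)
  show ?thesis
  proof (cases "k < l")
    case True
    have "upper_triangular ?B"
    proof (rule upper_triangularI)
      fix x y assume "y < x" "x < dim_row ?B"
      then show "?B $$ (x, y) = 0" using True carrier_matD[OF B] div_le_mono[of y x m] by (auto simp: idx)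
    qed
    from det_upper_triangular[OF this B] diag show ?thesis by simp
  next
    case False
    have "?B $$ (x, y) = 0" if "x < y" "y < a * m" for x y
      using that False assms(3) div_le_mono[of x y m] by (auto simp: idx)
    from det_lower_triangular[OF this B] diag show ?thesis by simp
  qed
qed

end

subsection \<open>Transitivity of determinants\<close>

lemma map_poly_pCons_fix0: "f 0 = 0 \<Longrightarrow> map_poly f (pCons c p) = pCons (f c) (map_poly f p)"
  by (rule poly_eqI) (simp add: coeff_map_poly coeff_pCons split: nat.split)

lemma det_zero_column:
  fixes A :: "'a::idom mat"
  assumes A: "A \<in> carrier_mat n n" and j: "j < n" and "\<And>i. i < n \<Longrightarrow> A $$ (i, j) = 0"
  shows "det A = 0"
proof -
  have "A *\<^sub>v unit_vec n j = 0\<^sub>v n"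
    using assms by (intro eq_vecI) auto
  moreover have "unit_vec n j \<noteq> (0\<^sub>v n :: 'a vec)" using j by auto
  ultimately show ?thesis unfolding det_0_iff_vec_prod_zero[OF A] by (intro exI[of _ "unit_vec n j"]) auto
qed

text \<open>Elimination over a domain cannot divide by a pivot. Nonvanishing of
  \<open>det (g x)\<close> lets the extra factors of fraction-free elimination be cancelled at the
  end. The case in view is a polynomial ring acting by matrices of polynomials.\<close>

locale mat_rep_idom = mat_rep g m
  for g :: "'c::idom \<Rightarrow> 'r::idom mat" and m +
  assumes det_nonzero: "x \<noteq> 0 \<Longrightarrow> det (g x) \<noteq> 0"
    and pos: "0 < m"
begin

lemma det_block_map_smult_one: "det (block_map m g (c \<cdot>\<^sub>m 1\<^sub>m a)) = det (g c) ^ a"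
proof (induction a)
  case (Suc a)
  have "c \<cdot>\<^sub>m 1\<^sub>m (Suc a) = four_block_mat (c \<cdot>\<^sub>m 1\<^sub>m 1) (0\<^sub>m 1 a) (0\<^sub>m a 1) (c \<cdot>\<^sub>m 1\<^sub>m a)"
    by (rule eq_matI) auto
  then have "det (block_map m g (c \<cdot>\<^sub>m 1\<^sub>m (Suc a))) = det (four_block_mat (block_map m g (c \<cdot>\<^sub>m 1\<^sub>m 1))
      (0\<^sub>m (1 * m) (a * m)) (0\<^sub>m (a * m) (1 * m)) (block_map m g (c \<cdot>\<^sub>m 1\<^sub>m a)))"
    by (simp add: block_map_four_block[of _ 1 _ a] block_map_zero)
  also have "\<dots> = det (block_map m g (c \<cdot>\<^sub>m 1\<^sub>m 1)) * det (block_map m g (c \<cdot>\<^sub>m 1\<^sub>m a))"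
    by (rule det_four_block_mat_lower_left_zero) (auto intro: block_map_carrierI)
  also have "block_map m g (c \<cdot>\<^sub>m 1\<^sub>m 1) = g c"
    by (subst block_map_single) auto
  finally show ?case using Suc by simp
qed (simp add: block_map_def)

text \<open>One step of fraction-free elimination, which reduces the claim to the smaller matrix
  \<open>M'\<close>.\<close>

lemma det_block_map_pivot:
  assumes IH: "\<And>M. M \<in> carrier_mat a a \<Longrightarrow> det (block_map m g M) = det (g (det M))"
    and M: "M \<in> carrier_mat (Suc a) (Suc a)" and nz: "M $$ (0, 0) \<noteq> 0"
  shows "det (block_map m g M) = det (g (det M))"
proof -
  define c where "c = M $$ (0, 0)"
  define A B C E where "A = mat 1 1 (\<lambda>_. c)" and "B = mat 1 a (\<lambda>(i, j). M $$ (0, Suc j))"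
    and "C = mat a 1 (\<lambda>(i, j). M $$ (Suc i, 0))" and "E = mat a a (\<lambda>(i, j). M $$ (Suc i, Suc j))"
  \<comment> \<open>The lower rows are multiplied by the pivot \<open>c\<close> before multiples of
    the first row are subtracted. This costs a factor \<open>c ^ a\<close> in the determinant, which
    becomes \<open>det (g c) ^ a\<close> after applying \<open>g\<close>.\<close>
  define P where "P = four_block_mat (1\<^sub>m 1) (0\<^sub>m 1 a) (- C) (c \<cdot>\<^sub>m 1\<^sub>m a)"
  define M' where "M' = - C * B + c \<cdot>\<^sub>m E"
  have A: "A \<in> carrier_mat 1 1" and B: "B \<in> carrier_mat 1 a" and C: "C \<in> carrier_mat a 1"
    and E: "E \<in> carrier_mat a a" and M': "M' \<in> carrier_mat a a"
    by (auto simp: A_def B_def C_def E_def M'_def)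
  note [simp] = A B C E M'
  have M_eq: "M = four_block_mat A B C E"
    using M by (intro eq_matI) (auto simp: A_def B_def C_def E_def c_def)
  have P: "P \<in> carrier_mat (Suc a) (Suc a)"
    by (auto simp: P_def intro!: carrier_matI)
  have "c \<cdot>\<^sub>m 1\<^sub>m a * C = c \<cdot>\<^sub>m C"
    by (simp only: mult_smult_assoc_mat[OF one_carrier_mat C] left_mult_one_mat[OF C])
  then have "- C * A + c \<cdot>\<^sub>m 1\<^sub>m a * C = 0\<^sub>m a 1"
    by (auto intro!: eq_matI simp: A_def C_def scalar_prod_def)
  moreover have "c \<cdot>\<^sub>m 1\<^sub>m a * E = c \<cdot>\<^sub>m E"
    by (simp only: mult_smult_assoc_mat[OF one_carrier_mat E]
        left_mult_one_mat[OF E])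
  ultimately have PM: "P * M = four_block_mat A B (0\<^sub>m a 1) M'"
    unfolding P_def M_eq M'_def
    by (subst mult_four_block_mat[of _ 1 1 _ a _ a _ _ 1 _ a])
      (simp_all del: One_nat_def add: left_mult_one_mat[OF A] left_mult_one_mat[OF B] A B C E
        left_mult_zero_mat[OF C] left_mult_zero_mat[OF E] right_add_zero_mat[OF A] right_add_zero_mat[OF B])
  have detA: "det A = c" by (subst det_single) (auto simp: A_def)
  have detP: "det P = c ^ a"
    unfolding P_def using C by (subst det_four_block_mat_upper_right_zero[of _ 1 _ a]) auto
  have "det (P * M) = c * det M'"
    unfolding PM using detA A B M' by (subst det_four_block_mat_lower_left_zero[of _ 1 _ a]) auto
  then have eq: "c ^ a * det M = c * det M'"
    using det_mult[OF P M] detP by simp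
  have "block_map m g P = four_block_mat (block_map m g (1\<^sub>m 1)) (0\<^sub>m (1 * m) (a * m))
      (block_map m g (- C)) (block_map m g (c \<cdot>\<^sub>m 1\<^sub>m a))"
    unfolding P_def using C
    by (subst block_map_four_block[of _ 1 _ a]) (simp_all del: One_nat_def add: block_map_zero)
  also have "det \<dots> = det (block_map m g (1\<^sub>m 1)) * det (block_map m g (c \<cdot>\<^sub>m 1\<^sub>m a))"
    by (rule det_four_block_mat_upper_right_zero[OF block_map_carrier refl block_map_carrier block_map_carrier])
      (use C in \<open>simp_all del: One_nat_def\<close>)
  finally have DP: "det (block_map m g P) = det (g c) ^ a"
    by (simp add: det_block_map_smult_one block_map_one)
  have "block_map m g (P * M) = four_block_mat (block_map m g A) (block_map m g B)
      (0\<^sub>m (a * m) (1 * m)) (block_map m g M')"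
    unfolding PM using A B M'
    by (subst block_map_four_block[of _ 1 _ a]) (simp_all del: One_nat_def add: block_map_zero)
  also have "det \<dots> = det (block_map m g A) * det (block_map m g M')"
    by (rule det_four_block_mat_lower_left_zero[OF block_map_carrier block_map_carrier refl block_map_carrier])
      (use A B M' in \<open>simp_all del: One_nat_def\<close>)
  finally have "det (block_map m g (P * M)) = det (g c) * det (g (det M'))"
    by (simp add: IH[OF M'] block_map_single[OF A]) (simp add: A_def)
  moreover have "det (g (x ^ k)) = det (g x) ^ k" for x k
    by (induction k) (auto simp: one det_mult_rep)
  ultimately have "det (g c) ^ a * det (block_map m g M) = det (g c) ^ a * det (g (det M))"
    using det_block_map_mult[OF P M] DP eq by (metis det_mult_rep)
  then show ?thesis using det_nonzero[of c] nz by (simp add: c_def)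
qed

text \<open>Transitivity of norms in matrix form: the blocks are images of a commutative ring and
  commute pairwise, so their formal determinant \<open>g (det M)\<close> carries the determinant of
  the whole matrix.\<close>

theorem det_block_map:
  "M \<in> carrier_mat a a \<Longrightarrow> det (block_map m g M) = det (g (det M))"
proof (induction a arbitrary: M)
  case 0
  then show ?case by (simp add: block_map_def one)
next
  case (Suc a)
  note M = Suc.prems
  show ?case
  proof (cases "\<exists>k<Suc a. M $$ (k, 0) \<noteq> 0")
    case False
    then have "det M = 0" using det_zero_column[OF M, of 0] by auto
    \<comment> \<open>The first \<open>m\<close> columns of the block matrix vanish; column 0 is one
      of them because \<open>m\<close> is positive.\<close>
    moreover have "det (block_map m g M) = 0"
      by (rule det_zero_column[of _ "Suc a * m" 0])
        (use M False pos in \<open>auto intro!: block_map_carrierI simp: block_map_index[OF M] zero_index less_mult_imp_div_less\<close>)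
    ultimately show ?thesis using pos by (simp add: zero)
  next
    case True
    then obtain k where k: "k < Suc a" "M $$ (k, 0) \<noteq> 0" by blast
    show ?thesis
    proof (cases "M $$ (0, 0) = 0")
      case False
      then show ?thesis using det_block_map_pivot[OF Suc.IH M] by blast
    next
      case True
      with k have "k \<noteq> 0" by (cases k) auto
      \<comment> \<open>Adding row \<open>k\<close> to row 0 creates a nonzero pivot. A transvection
        has determinant 1 both before and after passing to blocks.\<close>
      let ?E = "addrow_mat (Suc a) 1 0 k"
      have E: "?E \<in> carrier_mat (Suc a) (Suc a)" by simp
      have "(?E * M) $$ (0, 0) \<noteq> 0"
        using M k True \<open>k \<noteq> 0\<close> by (simp flip: addrow_mat[OF M k(1)])
      from det_block_map_pivot[OF Suc.IH mult_carrier_mat[OF E M] this]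
      show ?thesis
        using det_block_map_mult[OF E M] det_mult[OF E M] \<open>k \<noteq> 0\<close> k
        by (simp add: det_block_map_addrow_mat det_addrow_mat)
    qed
  qed
qed

end

section \<open>Coefficientwise extension to polynomials, and determinants of pencils\<close>

definition poly_rep :: "nat \<Rightarrow> ('c::zero \<Rightarrow> 'r::zero mat) \<Rightarrow> 'c poly \<Rightarrow> 'r poly mat" where
  "poly_rep m g p = mat m m (\<lambda>(k, l). map_poly (\<lambda>c. g c $$ (k, l)) p)"

text \<open>The pencil \<open>1 + T (Z - 1)\<close>; it takes the values \<open>1\<close> and \<open>Z\<close> at \<open>T = 0\<close> and \<open>T = 1\<close>.\<close>

definition pencil :: "'a::comm_ring_1 mat \<Rightarrow> 'a poly mat" where
  "pencil Z = mat (dim_row Z) (dim_col Z)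
     (\<lambda>(i, j). [:if i = j then 1 else 0, Z $$ (i, j) - (if i = j then 1 else 0):])"

lemma pencil_carrier [simp]: "Z \<in> carrier_mat a b \<Longrightarrow> pencil Z \<in> carrier_mat a b"
  by (auto simp: pencil_def)

lemma pencil_index:
  "Z \<in> carrier_mat a b \<Longrightarrow> i < a \<Longrightarrow> j < b \<Longrightarrow>
   pencil Z $$ (i, j) = [:if i = j then 1 else 0, Z $$ (i, j) - (if i = j then 1 else 0):]"
  by (auto simp: pencil_def)

lemma comm_ring_hom_poly: "comm_ring_hom (\<lambda>p. poly p (c::'a::comm_ring_1))"
  by unfold_locales auto

lemma poly_det: "poly (det M) c = det (map_mat (\<lambda>p. poly p c) M)" for c :: "'a::comm_ring_1"
  by (simp add: comm_ring_hom.hom_det[OF comm_ring_hom_poly])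

lemma poly_det_pencil_0: "Z \<in> carrier_mat a a \<Longrightarrow> poly (det (pencil Z)) 0 = 1"
proof -
  assume Z: "Z \<in> carrier_mat a a"
  have "map_mat (\<lambda>p. poly p 0) (pencil Z) = 1\<^sub>m a"
    using Z by (intro eq_matI) (auto simp: pencil_def)
  then show ?thesis by (simp add: poly_det)
qed

lemma poly_det_pencil_1: "Z \<in> carrier_mat a a \<Longrightarrow> poly (det (pencil Z)) 1 = det Z"
proof -
  assume Z: "Z \<in> carrier_mat a a"
  have "map_mat (\<lambda>p. poly p 1) (pencil Z) = Z"
    using Z by (intro eq_matI) (auto simp: pencil_def)
  then show ?thesis by (simp add: poly_det)
qed

lemma comm_ring_hom_map_poly:
  assumes "comm_ring_hom h" shows "comm_ring_hom (map_poly h)"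
proof -
  interpret map_poly_comm_ring_hom h using assms by (rule map_poly_comm_ring_hom.intro)
  show ?thesis by unfold_locales
qed

lemma det_pencil_hom:
  assumes "comm_ring_hom h" "Z \<in> carrier_mat a a"
  shows "det (pencil (map_mat h Z)) = map_poly h (det (pencil Z))"
proof -
  interpret comm_ring_hom h by fact
  have "pencil (map_mat h Z) = map_mat (map_poly h) (pencil Z)"
    using assms(2) by (intro eq_matI) (auto simp: pencil_def map_poly_pCons_fix0 hom_minus)
  then show ?thesis by (simp add: comm_ring_hom.hom_det[OF comm_ring_hom_map_poly[OF assms(1)]])
qed

text \<open>A constant matrix that intertwines \<open>Z\<close> and \<open>Y\<close> also
  intertwines \<open>1 + T (Z - 1)\<close> and \<open>1 + T (Y - 1)\<close>. Cancelling its
  determinant takes the place of inverting it.\<close>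

lemma det_pencil_intertwine:
  fixes Z Y S :: "'a::idom mat"
  assumes Z: "Z \<in> carrier_mat a a" and Y: "Y \<in> carrier_mat a a" and S: "S \<in> carrier_mat a a"
    and eq: "Y * S = S * Z" and nz: "det S \<noteq> 0"
  shows "det (pencil Y) = det (pencil Z)"
proof -
  define S' where "S' = map_mat (\<lambda>c. [:c:]) S"
  have S': "S' \<in> carrier_mat a a" using S by (simp add: S'_def)
  have "pencil Y * S' = S' * pencil Z"
  proof (rule eq_matI)
    fix i j assume "i < dim_row (S' * pencil Z)" "j < dim_col (S' * pencil Z)"
    with S' pencil_carrier[OF Z] have i: "i < a" and j: "j < a" by auto
    let ?d = "\<lambda>i j. if i = j then 1 else 0 :: 'a"
    have "(pencil Y * S') $$ (i, j) =
        (\<Sum>k<a. [:?d i k * S $$ (k, j), Y $$ (i, k) * S $$ (k, j) - ?d i k * S $$ (k, j):])"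
      using Z Y S i j S' pencil_carrier[OF Y]
      by (subst index_mult_mat_sum[of _ a a _ a]) (auto simp: pencil_def S'_def algebra_simps)
    also have "\<dots> = [:S $$ (i, j), (Y * S) $$ (i, j) - S $$ (i, j):]"
      using i j Y S
      by (simp add: index_mult_mat_sum[of Y a a S a] poly_eq_iff coeff_sum coeff_pCons
          sum_subtractf if_distrib[of "\<lambda>x. x * _"] cong: if_cong split: nat.splits del: index_mult_mat)
    also have "\<dots> = (\<Sum>k<a. [:S $$ (i, k) * ?d k j, S $$ (i, k) * Z $$ (k, j) - S $$ (i, k) * ?d k j:])"
      using i j Z S
      by (simp add: eq index_mult_mat_sum[of S a a Z a] poly_eq_iff coeff_sum coeff_pCons
          sum_subtractf if_distrib[of "\<lambda>x. _ * x"] cong: if_cong split: nat.splits del: index_mult_mat)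
    also have "\<dots> = (S' * pencil Z) $$ (i, j)"
      using Z Y S i j S' pencil_carrier[OF Z]
      by (subst index_mult_mat_sum[of _ a a _ a]) (auto simp: pencil_def S'_def algebra_simps)
    finally show "(pencil Y * S') $$ (i, j) = (S' * pencil Z) $$ (i, j)" .
  qed (use Z Y S in \<open>auto simp: S'_def pencil_def\<close>)
  then have "det (pencil Y) * det S' = det S' * det (pencil Z)"
    using det_mult[OF pencil_carrier[OF Y] S'] det_mult[OF S' pencil_carrier[OF Z]] by metis
  moreover have "det S' = [:det S:]"
  proof -
    interpret comm_ring_hom "\<lambda>c::'a. [:c:]" by unfold_locales (auto simp: one_pCons)
    show ?thesis by (simp add: S'_def)
  qed
  ultimately show ?thesis using nz by (metis mult.commute mult_cancel_left pCons_eq_0_iff)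
qed

locale mat_rep_field = mat_rep g m
  for g :: "'c::field \<Rightarrow> 'r::idom mat" and m +
  assumes pos: "0 < m"
begin

lemma det_rep_nonzero: "c \<noteq> 0 \<Longrightarrow> det (g c) \<noteq> 0"
  using det_mult_rep[of c "inverse c"] by (auto simp: one)

lemma coeff_poly_rep:
  "k < m \<Longrightarrow> l < m \<Longrightarrow> coeff (poly_rep m g p $$ (k, l)) i = g (coeff p i) $$ (k, l)"
  by (simp add: poly_rep_def coeff_map_poly zero_index)

lemma mat_rep_poly_rep: "mat_rep (poly_rep m g) m"
proof
  show c: "poly_rep m g p \<in> carrier_mat m m" for p by (simp add: poly_rep_def)
  show "poly_rep m g 1 = 1\<^sub>m m"
    by (rule eq_matI) (auto simp: poly_rep_def one zero_index map_poly_pCons_fix0 one_pCons)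
  show "poly_rep m g (p + q) = poly_rep m g p + poly_rep m g q" for p q
    using c[of p] c[of q] c[of "p + q"]
    by (intro eq_matI poly_eqI) (auto simp: coeff_poly_rep add_index)
  show "poly_rep m g (p * q) = poly_rep m g p * poly_rep m g q" for p q
  proof (intro eq_matI poly_eqI)
    fix k l i assume "k < dim_row (poly_rep m g p * poly_rep m g q)" "l < dim_col (poly_rep m g p * poly_rep m g q)"
    with c[of p] c[of q] have k: "k < m" and l: "l < m" by auto
    have "coeff ((poly_rep m g p * poly_rep m g q) $$ (k, l)) i =
      (\<Sum>t<m. \<Sum>j\<le>i. g (coeff p j) $$ (k, t) * g (coeff q (i - j)) $$ (t, l))"
      using k l by (subst index_mult_mat_sum[OF c c]) (auto simp: coeff_sum coeff_mult coeff_poly_rep)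
    also have "\<dots> = (\<Sum>j\<le>i. g (coeff p j * coeff q (i - j)) $$ (k, l))"
      using k l by (subst sum.swap) (simp add: mult_index)
    also have "\<dots> = coeff (poly_rep m g (p * q) $$ (k, l)) i"
      using k l by (simp add: coeff_poly_rep coeff_mult sum_index)
    finally show "coeff (poly_rep m g (p * q) $$ (k, l)) i = coeff ((poly_rep m g p * poly_rep m g q) $$ (k, l)) i" ..
  qed (use c[of p] c[of q] c[of "p * q"] in auto)
qed

sublocale poly_rep: mat_rep "poly_rep m g" m by (rule mat_rep_poly_rep)

lemma poly_det_poly_rep_0: "poly (det (poly_rep m g p)) 0 = det (g (poly p 0))"
proof -
  have "map_mat (\<lambda>p. poly p 0) (poly_rep m g p) = g (poly p 0)"
    using poly_rep.carrier[of p]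
    by (intro eq_matI) (auto simp: poly_0_coeff_0 coeff_poly_rep)
  then show ?thesis by (simp add: poly_det)
qed

text \<open>Evaluation at \<open>T = 1\<close> adds up coefficients and so commutes with the merely
  additive \<open>g\<close>; a general point would call for linearity of \<open>g\<close>. The
  points 0 and 1 suffice for pencils.\<close>

lemma poly_det_poly_rep_1: "poly (det (poly_rep m g p)) 1 = det (g (poly p 1))"
proof -
  have "poly (map_poly (\<lambda>c. g c $$ (k, l)) p) 1 = g (poly p 1) $$ (k, l)" if "k < m" "l < m" for k l
    using that by (induction p) (auto simp: map_poly_pCons_fix0 zero_index add_index)
  then have "map_mat (\<lambda>p. poly p 1) (poly_rep m g p) = g (poly p 1)"
    by (intro eq_matI) (auto simp: poly_rep_def)
  then show ?thesis by (simp add: poly_det)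
qed

sublocale poly_rep: mat_rep_idom "poly_rep m g" m
proof
  show "0 < m" by (rule pos)
  fix p :: "'c poly" assume "p \<noteq> 0"
  \<comment> \<open>The largest power of \<open>T\<close> is split off. The image of
    \<open>T\<close> has determinant \<open>T ^ m\<close>, and the remaining factor has a nonzero
    constant term, at which \<open>g\<close> is invertible.\<close>
  then obtain q where q: "p = [:0, 1:] ^ order 0 p * q" "\<not> [:0, 1:] dvd q"
    using order_decomp[of p 0] by auto
  have "poly_rep m g [:0, 1:] = [:0, 1:] \<cdot>\<^sub>m 1\<^sub>m m"
    by (rule eq_matI) (auto simp: poly_rep_def map_poly_pCons_fix0 zero_index one)
  then have "det (poly_rep m g [:0, 1:]) \<noteq> 0" by simp
  moreover have "det (poly_rep m g (x ^ k)) = det (poly_rep m g x) ^ k" for x k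
    by (induction k) (auto simp: poly_rep.one poly_rep.det_mult_rep)
  moreover have "det (poly_rep m g q) \<noteq> 0"
    using q(2) poly_det_poly_rep_0[of q] det_rep_nonzero[of "poly q 0"] poly_eq_0_iff_dvd[of q 0] by auto
  ultimately show "det (poly_rep m g p) \<noteq> 0"
    by (subst q(1)) (simp add: poly_rep.det_mult_rep)
qed

text \<open>\<open>g\<close> sends 1 to the identity and 0 to the zero block, so the Kronecker
  deltas of the small and the large pencil agree.\<close>

lemma pencil_block_map:
  assumes Z: "Z \<in> carrier_mat a a"
  shows "pencil (block_map m g Z) = block_map m (poly_rep m g) (pencil Z)"
proof (rule eq_matI)
  fix x y
  assume "x < dim_row (block_map m (poly_rep m g) (pencil Z))" "y < dim_col (block_map m (poly_rep m g) (pencil Z))"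
  with Z have x: "x < a * m" and y: "y < a * m" by (auto simp: block_map_def pencil_def)
  note dx = div_mod_block[OF x] and dy = div_mod_block[OF y]
  have diff: "g (u - v) $$ (k, l) = g u $$ (k, l) - g v $$ (k, l)" if "k < m" "l < m" for u v k l
    using add_index[OF that, of "u - v" v] by simp
  define e :: 'c where "e = (if x div m = y div m then 1 else 0)"
  have delta: "g e $$ (x mod m, y mod m) = (if x = y then 1 else 0)"
    using dx dy by (auto simp: e_def one zero_index dest: div_mod_eqI)
  have "pencil Z $$ (x div m, y div m) = [:e, Z $$ (x div m, y div m) - e:]"
    unfolding e_def by (rule pencil_index[OF Z dx(1) dy(1)])
  then have "block_map m (poly_rep m g) (pencil Z) $$ (x, y) =
      [:g e $$ (x mod m, y mod m), g (Z $$ (x div m, y div m)) $$ (x mod m, y mod m) - g e $$ (x mod m, y mod m):]"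
    using x y dx dy
    by (simp add: block_map_index[OF pencil_carrier[OF Z]] poly_rep_def map_poly_pCons_fix0 zero_index diff)
  also have "\<dots> = pencil (block_map m g Z) $$ (x, y)"
    using x y by (simp add: delta pencil_index[OF block_map_carrier[OF Z]] block_map_index[OF Z])
  finally show "pencil (block_map m g Z) $$ (x, y) = block_map m (poly_rep m g) (pencil Z) $$ (x, y)" ..
qed (use Z in \<open>auto simp: block_map_def pencil_def\<close>)

lemma det_pencil_block_map:
  "Z \<in> carrier_mat a a \<Longrightarrow> det (pencil (block_map m g Z)) = det (poly_rep m g (det (pencil Z)))"
  by (simp add: pencil_block_map poly_rep.det_block_map[of _ a])

end

lemma mat_rep_field_scalar: "0 < m \<Longrightarrow> mat_rep_field (\<lambda>c::'a::field. c \<cdot>\<^sub>m 1\<^sub>m m) m"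
  by unfold_locales (auto intro!: eq_matI simp: distrib_right index_mult_mat_sum[of _ m m _ m])

text \<open>The block matrix is the Kronecker product of \<open>Z\<close> with an identity matrix,
  that is, \<open>m\<close> interleaved copies of \<open>Z\<close>.\<close>

lemma det_pencil_block_scalar:
  fixes Z :: "'a::field mat"
  assumes "Z \<in> carrier_mat a a" "0 < m"
  shows "det (pencil (block_map m (\<lambda>c. c \<cdot>\<^sub>m 1\<^sub>m m) Z)) = det (pencil Z) ^ m"
proof -
  interpret mat_rep_field "\<lambda>c::'a. c \<cdot>\<^sub>m 1\<^sub>m m" m using assms(2) by (rule mat_rep_field_scalar)
  have "poly_rep m (\<lambda>c. c \<cdot>\<^sub>m 1\<^sub>m m) p = p \<cdot>\<^sub>m 1\<^sub>m m" for p :: "'a poly"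
    by (intro eq_matI) (auto simp: poly_rep_def coeff_map_poly intro!: poly_eqI)
  then show ?thesis using det_pencil_block_map[OF assms(1)] by simp
qed

subsection \<open>Bases and matrices of left multiplications\<close>

text \<open>Scalars act on the right and may be noncommutative, because left multiplications are
  linear for this structure even over the division ring A. Working with coordinates lets one locale
  cover A and K over F as well as the tensor product over A and over K.\<close>

locale right_basis =
  fixes j :: "'a::ring_1 \<Rightarrow> 'b::ring_1" and n :: nat and w :: "nat \<Rightarrow> 'b"
  assumes hom: "Ring_Hom.ring_hom j"
    and gen: "\<exists>c. x = (\<Sum>k<n. w k * j (c k))"
    and indep: "(\<Sum>k<n. w k * j (c k)) = 0 \<Longrightarrow> k < n \<Longrightarrow> c k = 0"
begin

sublocale j: Ring_Hom.ring_hom j by (rule hom)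

definition coord :: "'b \<Rightarrow> nat \<Rightarrow> 'a" where
  "coord x = (SOME c. x = (\<Sum>k<n. w k * j (c k)))"

lemma expand: "x = (\<Sum>k<n. w k * j (coord x k))"
  unfolding coord_def by (rule someI_ex[OF gen])

lemma coord_eqI:
  assumes "x = (\<Sum>k<n. w k * j (c k))" "k < n"
  shows "coord x k = c k"
proof -
  have "(\<Sum>k<n. w k * j (coord x k - c k)) = 0"
    using assms(1) expand[of x] by (simp add: j.hom_minus right_diff_distrib sum_subtractf)
  from indep[OF this assms(2)] show ?thesis by simp
qed

lemma coord_add: "k < n \<Longrightarrow> coord (x + y) k = coord x k + coord y k"
  by (rule coord_eqI) (subst (1) expand[of x], subst (1) expand[of y],
      simp_all add: j.hom_add distrib_left sum.distrib)

lemma coord_zero: "k < n \<Longrightarrow> coord 0 k = 0"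
  by (rule coord_eqI) simp_all

lemma coord_sum: "k < n \<Longrightarrow> coord (\<Sum>i\<in>I. f i) k = (\<Sum>i\<in>I. coord (f i) k)"
  by (induction I rule: infinite_finite_induct) (auto simp: coord_zero coord_add)

lemma coord_mult_right: "k < n \<Longrightarrow> coord (x * j a) k = coord x k * a"
  by (rule coord_eqI) (subst (1) expand[of x], simp_all add: sum_distrib_right j.hom_mult mult.assoc)

lemma coord_basis: "l < n \<Longrightarrow> k < n \<Longrightarrow> coord (w l) k = (if k = l then 1 else 0)"
  by (rule coord_eqI) (simp_all add: if_distrib[of j] if_distrib[of "\<lambda>x. _ * x"] cong: if_cong)

lemma coord_inj:
  assumes "\<And>k. k < n \<Longrightarrow> coord x k = coord y k"
  shows "x = y"
proof -
  have "(\<Sum>k<n. w k * j (coord x k)) = (\<Sum>k<n. w k * j (coord y k))"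
    by (intro sum.cong) (auto simp: assms)
  then show ?thesis using expand[of x] expand[of y] by simp
qed

abbreviation "lmat \<equiv> left_mult_matrix j n w"

lemma lmat_unique:
  assumes "M \<in> carrier_mat n n" "\<And>l. l < n \<Longrightarrow> x * w l = (\<Sum>k<n. w k * j (M $$ (k, l)))"
  shows "lmat x = M"
  unfolding left_mult_matrix_def
proof (rule the_equality)
  fix N assume N: "N \<in> carrier_mat n n \<and> (\<forall>l<n. x * w l = (\<Sum>k<n. w k * j (N $$ (k, l))))"
  show "N = M"
  proof (rule eq_matI)
    fix k l assume "k < dim_row M" "l < dim_col M"
    with assms(1) have kl: "k < n" "l < n" by auto
    then show "N $$ (k, l) = M $$ (k, l)"
      using coord_eqI[OF assms(2)[OF kl(2)] kl(1)] coord_eqI[of "x * w l" "\<lambda>k. N $$ (k, l)" k] N by simp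
  qed (use N assms(1) in auto)
qed (use assms in auto)

lemma lmat_eq: "lmat x = mat n n (\<lambda>(k, l). coord (x * w l) k)"
proof (rule lmat_unique)
  fix l assume l: "l < n"
  show "x * w l = (\<Sum>k<n. w k * j (mat n n (\<lambda>(k, l). coord (x * w l) k) $$ (k, l)))"
    using l by (subst expand) simp
qed simp

lemma lmat_index: "k < n \<Longrightarrow> l < n \<Longrightarrow> lmat x $$ (k, l) = coord (x * w l) k"
  by (simp add: lmat_eq)

lemma lmat_carrier [simp]: "lmat x \<in> carrier_mat n n"
  by (simp add: lmat_eq)

lemma coord_mult: "k < n \<Longrightarrow> coord (x * y) k = (\<Sum>l<n. lmat x $$ (k, l) * coord y l)"
  by (subst expand[of y])
    (simp add: sum_distrib_left coord_sum mult.assoc[symmetric] coord_mult_right lmat_index)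

lemma lmat_mult: "lmat (x * y) = lmat x * lmat y"
  using carrier_matD[OF lmat_carrier]
  by (intro eq_matI)
    (auto simp: lmat_index coord_mult index_mult_mat_sum[of _ n n _ n] mult.assoc simp del: index_mult_mat(1))

lemma lmat_one: "lmat 1 = 1\<^sub>m n"
  by (rule eq_matI) (auto simp: lmat_eq coord_basis)

lemma lmat_add: "lmat (x + y) = lmat x + lmat y"
  by (rule eq_matI) (auto simp: lmat_eq coord_add distrib_right)

end

locale right_basis_comm = right_basis j n w
  for j :: "'a::comm_ring_1 \<Rightarrow> 'b::ring_1" and n w
begin

sublocale lmat: mat_rep lmat n
  by unfold_locales (auto simp: lmat_mult lmat_one lmat_add)

end

lemma algebra_map_hom: "algebra_map s \<Longrightarrow> Ring_Hom.ring_hom s"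
  by (simp add: algebra_map_def)

lemma algebra_map_commute: "algebra_map s \<Longrightarrow> x * s c = s c * x"
  by (simp add: algebra_map_def)

lemma module_algebra_map: "algebra_map s \<Longrightarrow> Modules.module (\<lambda>c x. s c * x)"
proof -
  assume "algebra_map s"
  then interpret Ring_Hom.ring_hom s by (rule algebra_map_hom)
  show ?thesis by unfold_locales (auto simp: hom_add hom_mult algebra_simps)
qed

text \<open>Since the scalars are central, left spans and right coordinates express the same thing.
  What remains is the passage between coefficients indexed by basis vectors and coefficients indexed
  by positions.\<close>

lemma algebra_basis_iff_right_basis:
  assumes s: "algebra_map s"
  shows "algebra_basis s n w \<longleftrightarrow> right_basis s n w"
proof
  interpret V: Modules.module "\<lambda>c x. s c * x" using s by (rule module_algebra_map)
  note comm = algebra_map_commute[OF s]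
  {
    assume "algebra_basis s n w"
    then have inj: "inj_on w {..<n}" and ind: "\<not> V.dependent (w ` {..<n})"
      and span: "V.span (w ` {..<n}) = UNIV" by (auto simp: algebra_basis_def)
    have re: "(\<Sum>v\<in>w ` {..<n}. s (u v) * v) = (\<Sum>k<n. w k * s (u (w k)))" for u
      using inj by (simp add: sum.reindex comm)
    show "right_basis s n w"
    proof (intro right_basis.intro algebra_map_hom[OF s])
      fix x
      have "x \<in> range (\<lambda>u. \<Sum>v\<in>w ` {..<n}. s (u v) * v)"
        using span V.span_finite[of "w ` {..<n}"] by auto
      then show "\<exists>c. x = (\<Sum>k<n. w k * s (c k))" by (auto simp: re)
    next
      fix c k assume c: "(\<Sum>k<n. w k * s (c k)) = 0" and k: "k < n"
      define u where "u = c \<circ> the_inv_into {..<n} w"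
      have uw: "u (w k) = c k" if "k < n" for k
        using inj that by (simp add: u_def the_inv_into_f_f)
      have "(\<Sum>v\<in>w ` {..<n}. s (u v) * v) = 0" using c by (simp add: re uw)
      then have "u (w k) = 0" using ind k V.dependent_finite[of "w ` {..<n}"] by auto
      then show "c k = 0" using k uw by simp
    qed
  }
  {
    assume "right_basis s n w"
    then interpret right_basis s n w .
    have inj: "inj_on w {..<n}"
    proof (rule inj_onI)
      fix i k assume "i \<in> {..<n}" "k \<in> {..<n}" "w i = w k"
      then show "i = k" using coord_basis[of i i] coord_basis[of k i] by (auto split: if_splits)
    qed
    have re: "(\<Sum>v\<in>w ` {..<n}. s (u v) * v) = (\<Sum>k<n. w k * s (u (w k)))" for u
      using inj by (simp add: sum.reindex comm)
    have "(\<Sum>k<n. s (coord x k) * w k) \<in> V.span (w ` {..<n})" for x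
      by (intro V.span_sum V.span_scale V.span_base) auto
    then have "x \<in> V.span (w ` {..<n})" for x
      using expand[of x] by (metis (no_types, lifting) comm sum.cong)
    moreover have "\<not> V.dependent (w ` {..<n})"
      using indep by (fastforce simp: V.dependent_finite re)
    ultimately show "algebra_basis s n w" using inj by (auto simp: algebra_basis_def)
  }
qed

text \<open>Otherwise \<open>A\<close>, padded with zero rows to a square matrix, is singular, and a
  kernel vector of the padded matrix is one of \<open>A\<close>.\<close>

lemma injective_matrix_dim_le:
  fixes A :: "'a::field mat"
  assumes A: "A \<in> carrier_mat a b"
    and inj: "\<And>v. v \<in> carrier_vec b \<Longrightarrow> A *\<^sub>v v = 0\<^sub>v a \<Longrightarrow> v = 0\<^sub>v b"
  shows "b \<le> a"
proof (rule ccontr)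
  assume "\<not> b \<le> a"
  then have ab: "a < b" by simp
  define B where "B = mat b b (\<lambda>(i, k). if i < a then A $$ (i, k) else 0)"
  have B: "B \<in> carrier_mat b b" by (simp add: B_def)
  \<comment> \<open>Row \<open>a\<close> of \<open>B\<close> is a zero row, so the transpose kills
    the \<open>a\<close>-th unit vector.\<close>
  have "B\<^sup>T *\<^sub>v unit_vec b a = 0\<^sub>v b"
    using ab by (intro eq_vecI) (auto simp: B_def)
  moreover have "unit_vec b a \<noteq> (0\<^sub>v b :: 'a vec)" using ab by auto
  ultimately have "det (B\<^sup>T) = 0"
    using B by (subst det_0_iff_vec_prod_zero[of _ b]) (auto intro!: exI[of _ "unit_vec b a"])
  then have "det B = 0" using det_transpose[OF B] by simp
  then obtain v where v: "v \<in> carrier_vec b" "v \<noteq> 0\<^sub>v b" "B *\<^sub>v v = 0\<^sub>v b"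
    unfolding det_0_iff_vec_prod_zero[OF B] by blast
  have "(A *\<^sub>v v) $ i = 0" if "i < a" for i
  proof -
    have "(B *\<^sub>v v) $ i = 0" using v(3) that ab by simp
    moreover have "row B i = row A i" using that ab A by (intro eq_vecI) (auto simp: B_def)
    ultimately show ?thesis using that ab A B by simp
  qed
  then have "A *\<^sub>v v = 0\<^sub>v a" using A by (intro eq_vecI) auto
  with inj[OF v(1)] v(2) show False by blast
qed

lemma mult_mat_vec_zero:
  "A \<in> carrier_mat a b \<Longrightarrow> A *\<^sub>v 0\<^sub>v b = (0\<^sub>v a :: 'a::semiring_0 vec)"
  by (intro eq_vecI) auto

lemma two_sided_inverse_square:
  fixes A :: "'a::field mat"
  assumes A: "A \<in> carrier_mat a b" and B: "B \<in> carrier_mat b a"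
    and AB: "A * B = 1\<^sub>m a" and BA: "B * A = 1\<^sub>m b"
  shows "a = b"
proof (rule antisym)
  have "v = 0\<^sub>v b" if "v \<in> carrier_vec b" "A *\<^sub>v v = 0\<^sub>v a" for v
    using that A B BA mult_mat_vec_zero[OF B] assoc_mult_mat_vec[OF B A that(1)] by simp
  with A show "b \<le> a" by (rule injective_matrix_dim_le)
  have "v = 0\<^sub>v a" if "v \<in> carrier_vec a" "B *\<^sub>v v = 0\<^sub>v b" for v
    using that A B AB mult_mat_vec_zero[OF A] assoc_mult_mat_vec[OF A B that(1)] by simp
  with B show "a \<le> b" by (rule injective_matrix_dim_le)
qed

text \<open>The sizes \<open>n\<close> and \<open>m\<close> are kept apart because their equality is
  itself derived from these matrices.\<close>

definition base_change :: "('a::ring_1 \<Rightarrow> 'b::ring_1) \<Rightarrow> nat \<Rightarrow> (nat \<Rightarrow> 'b) \<Rightarrow> nat \<Rightarrow> (nat \<Rightarrow> 'b) \<Rightarrow> 'a mat" where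
  "base_change j n w m v = mat n m (\<lambda>(k, l). right_basis.coord j n w (v l) k)"

lemma base_change_inverse:
  assumes "right_basis j n w" "right_basis j m v"
  shows "base_change j n w m v * base_change j m v n w = 1\<^sub>m n"
proof (rule eq_matI)
  interpret W: right_basis j n w by fact
  interpret V: right_basis j m v by fact
  fix k l assume "k < dim_row (1\<^sub>m n)" "l < dim_col (1\<^sub>m n)"
  then have kl: "k < n" "l < n" by auto
  have "(base_change j n w m v * base_change j m v n w) $$ (k, l) = (\<Sum>i<m. W.coord (v i) k * V.coord (w l) i)"
    using kl by (subst index_mult_mat_sum[of _ n m _ n]) (auto simp: base_change_def)
  also have "\<dots> = W.coord (w l) k"
    using kl by (subst (2) V.expand) (simp add: W.coord_sum W.coord_mult_right)
  finally show "(base_change j n w m v * base_change j m v n w) $$ (k, l) = 1\<^sub>m n $$ (k, l)"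
    using kl by (simp add: W.coord_basis)
qed (auto simp: base_change_def)

lemma right_basis_card_unique:
  fixes j :: "'a::field \<Rightarrow> 'b::ring_1"
  assumes "right_basis j n w" "right_basis j m v"
  shows "n = m"
  by (rule two_sided_inverse_square[of "base_change j n w m v" _ _ "base_change j m v n w"])
    (use base_change_inverse[OF assms] base_change_inverse[OF assms(2,1)] in \<open>auto simp: base_change_def\<close>)

lemma det_base_change_nonzero:
  fixes j :: "'a::field \<Rightarrow> 'b::ring_1"
  assumes "right_basis j n w" "right_basis j n v"
  shows "det (base_change j n w n v) \<noteq> 0"
proof -
  have "det (base_change j n w n v) * det (base_change j n v n w) = 1"
    using base_change_inverse[OF assms] by (subst det_mult[symmetric, of _ n]) (auto simp: base_change_def)
  then show ?thesis by auto
qed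

text \<open>The base change matrix intertwines the two left multiplication matrices and has nonzero
  determinant.\<close>

lemma det_left_mult_matrix_unique:
  fixes j :: "'a::field \<Rightarrow> 'b::ring_1"
  assumes "right_basis j n w" "right_basis j n v"
  shows "det (left_mult_matrix j n w x) = det (left_mult_matrix j n v x)"
proof -
  interpret W: right_basis j n w by fact
  interpret V: right_basis j n v by fact
  let ?P = "base_change j n w n v"
  have P: "?P \<in> carrier_mat n n" by (simp add: base_change_def)
  have "W.lmat x * ?P = ?P * V.lmat x"
  proof (rule eq_matI)
    fix k l assume "k < dim_row (?P * V.lmat x)" "l < dim_col (?P * V.lmat x)"
    with P have kl: "k < n" "l < n" using carrier_matD[OF V.lmat_carrier[of x]] by auto
    have "(W.lmat x * ?P) $$ (k, l) = W.coord (x * v l) k"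
      using kl P by (subst index_mult_mat_sum[of _ n n _ n]) (auto simp: base_change_def W.coord_mult)
    also have "\<dots> = (\<Sum>i<n. W.coord (v i) k * V.coord (x * v l) i)"
      using kl by (subst V.expand[of "x * v l"]) (simp add: W.coord_sum W.coord_mult_right)
    also have "\<dots> = (?P * V.lmat x) $$ (k, l)"
      using kl P by (subst index_mult_mat_sum[of _ n n _ n]) (auto simp: base_change_def V.lmat_index)
    finally show "(W.lmat x * ?P) $$ (k, l) = (?P * V.lmat x) $$ (k, l)" .
  qed (use P carrier_matD[OF V.lmat_carrier[of x]] carrier_matD[OF W.lmat_carrier[of x]] in auto)
  then have "det (W.lmat x) * det ?P = det ?P * det (V.lmat x)"
    using det_mult[OF W.lmat_carrier P] det_mult[OF P V.lmat_carrier] by metis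
  then show ?thesis using det_base_change_nonzero[OF assms] by simp
qed

lemma field_norm_eq:
  fixes s :: "'f::field \<Rightarrow> 'k::field"
  assumes "algebra_map s" "right_basis s n w"
  shows "field_norm s x = det (left_mult_matrix s n w x)"
  unfolding field_norm_def
proof (rule the_equality)
  show "\<exists>n' w'. algebra_basis s n' w' \<and> det (left_mult_matrix s n w x) = det (left_mult_matrix s n' w' x)"
    using assms algebra_basis_iff_right_basis by blast
  show "c = det (left_mult_matrix s n w x)"
    if "\<exists>n w. algebra_basis s n w \<and> c = det (left_mult_matrix s n w x)" for c
    using that assms det_left_mult_matrix_unique right_basis_card_unique
    by (metis algebra_basis_iff_right_basis)
qed

subsection \<open>Reduced norms through splittings\<close>

lemma block_map_block_map:
  assumes M: "M \<in> carrier_mat a b" and g: "\<And>x. g x \<in> carrier_mat e e"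
  shows "block_map d f (block_map e g M) = block_map (e * d) (\<lambda>x. block_map d f (g x)) M"
proof (rule eq_matI)
  fix x y
  assume "x < dim_row (block_map (e * d) (\<lambda>x. block_map d f (g x)) M)"
    "y < dim_col (block_map (e * d) (\<lambda>x. block_map d f (g x)) M)"
  with M have x: "x < a * (e * d)" and y: "y < b * (e * d)" by (auto simp: block_map_def)
  then have x': "x < (a * e) * d" and y': "y < (b * e) * d" by (simp_all add: mult.assoc)
  note dx = div_mod_block[OF x] and dy = div_mod_block[OF y]
    and dx' = div_mod_block[OF x'] and dy' = div_mod_block[OF y']
  have split: "z div d div e = z div (e * d)" "z div d mod e = z mod (e * d) div d" "z mod (e * d) mod d = z mod d" for z
    using dx'(3) by (simp_all add: div_mult2_eq mod_mult2_eq mult.commute[of e d])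
  show "block_map d f (block_map e g M) $$ (x, y) = block_map (e * d) (\<lambda>x. block_map d f (g x)) M $$ (x, y)"
    using M x y x' y' dx dy dx' dy'
    by (simp add: block_map_index[OF block_map_carrier[OF M]] block_map_index[OF M] block_map_index[OF g] split)
qed (use M in \<open>auto simp: block_map_def\<close>)

definition diag_blocks :: "nat \<Rightarrow> 'a::zero mat \<Rightarrow> 'a mat" where
  "diag_blocks a S = mat (a * dim_row S) (a * dim_row S) (\<lambda>(x, y). if x div dim_row S = y div dim_row S
     then S $$ (x mod dim_row S, y mod dim_row S) else 0)"

lemma det_diag_blocks:
  fixes S :: "'a::idom mat"
  assumes S: "S \<in> carrier_mat m m"
  shows "det (diag_blocks a S) = det S ^ a"
proof (induction a)
  case (Suc a)
  have "diag_blocks (Suc a) S = four_block_mat S (0\<^sub>m m (a * m)) (0\<^sub>m (a * m) m) (diag_blocks a S)"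
  proof (rule eq_matI)
    fix x y assume "x < dim_row (four_block_mat S (0\<^sub>m m (a * m)) (0\<^sub>m (a * m) m) (diag_blocks a S))"
      "y < dim_col (four_block_mat S (0\<^sub>m m (a * m)) (0\<^sub>m (a * m) m) (diag_blocks a S))"
    with S have xy: "x < m + a * m" "y < m + a * m" by (auto simp: diag_blocks_def)
    then have m: "0 < m" by (intro gr0I) auto
    have low: "z div m = 0 \<longleftrightarrow> z < m" for z using m by (simp add: div_eq_0_iff)
    have high: "z div m = Suc ((z - m) div m)" "(z - m) mod m = z mod m" if "\<not> z < m" for z
      using that m by (simp_all add: le_div_geq le_mod_geq)
    show "diag_blocks (Suc a) S $$ (x, y) = four_block_mat S (0\<^sub>m m (a * m)) (0\<^sub>m (a * m) m) (diag_blocks a S) $$ (x, y)"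
      using xy S low[of x] low[of y] high[of x] high[of y]
      by (auto simp: diag_blocks_def)
  qed (use S in \<open>auto simp: diag_blocks_def\<close>)
  then show ?case
    using S Suc by (simp add: det_four_block_mat_lower_left_zero[of S m _ "a * m"] diag_blocks_def)
qed (simp add: diag_blocks_def)

text \<open>A matrix \<open>S\<close> that intertwines \<open>g1 x\<close> and \<open>g2 x\<close>
  for every \<open>x\<close> simultaneously yields an intertwiner of the block matrices, namely the
  block diagonal matrix with \<open>a\<close> copies of \<open>S\<close>.\<close>

lemma det_pencil_block_map_conj:
  fixes g1 g2 :: "'c \<Rightarrow> 'l::idom mat"
  assumes g1: "\<And>x. g1 x \<in> carrier_mat m m" and g2: "\<And>x. g2 x \<in> carrier_mat m m"
    and S: "S \<in> carrier_mat m m" and eq: "\<And>x. g2 x * S = S * g1 x" and nz: "det S \<noteq> 0"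
    and M: "M \<in> carrier_mat a a"
  shows "det (pencil (block_map m g2 M)) = det (pencil (block_map m g1 M))"
proof (rule det_pencil_intertwine)
  show D: "diag_blocks a S \<in> carrier_mat (a * m) (a * m)" using S by (auto simp: diag_blocks_def)
  show B: "block_map m g2 M \<in> carrier_mat (a * m) (a * m)" "block_map m g1 M \<in> carrier_mat (a * m) (a * m)"
    using M by auto
  show "det (diag_blocks a S) \<noteq> 0" using nz by (simp add: det_diag_blocks[OF S])
  show "block_map m g2 M * diag_blocks a S = diag_blocks a S * block_map m g1 M"
  proof (rule eq_matI)
    fix x y
    assume "x < dim_row (diag_blocks a S * block_map m g1 M)" "y < dim_col (diag_blocks a S * block_map m g1 M)"
    with D B have x: "x < a * m" and y: "y < a * m" by auto
    note dx = div_mod_block[OF x] and dy = div_mod_block[OF y]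
    let ?N = "M $$ (x div m, y div m)"
    have "(block_map m g2 M * diag_blocks a S) $$ (x, y) =
        (\<Sum>j<a. \<Sum>k<m. g2 (M $$ (x div m, j)) $$ (x mod m, k) *
           (if j = y div m then S $$ (k, y mod m) else 0))"
      using x y S dx
      by (subst index_mult_mat_sum[OF B(1) D])
        (auto simp: sum_lessThan_times block_map_index[OF M] diag_blocks_def block_index_less intro!: sum.cong)
    also have "\<dots> = (\<Sum>j<a. if j = y div m then \<Sum>k<m. g2 (M $$ (x div m, j)) $$ (x mod m, k) * S $$ (k, y mod m) else 0)"
      by (intro sum.cong) auto
    also have "\<dots> = (g2 ?N * S) $$ (x mod m, y mod m)"
      using dx dy by (simp add: index_mult_mat_sum[OF g2 S] del: index_mult_mat(1))
    also have "\<dots> = (\<Sum>j<a. if x div m = j then \<Sum>k<m. S $$ (x mod m, k) * g1 (M $$ (j, y div m)) $$ (k, y mod m) else 0)"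
      using dx dy by (simp add: eq index_mult_mat_sum[OF S g1] del: index_mult_mat(1))
    also have "\<dots> = (\<Sum>j<a. \<Sum>k<m. (if x div m = j then S $$ (x mod m, k) else 0) *
           g1 (M $$ (j, y div m)) $$ (k, y mod m))"
      by (intro sum.cong) auto
    also have "\<dots> = (diag_blocks a S * block_map m g1 M) $$ (x, y)"
      using x y S dx
      by (subst index_mult_mat_sum[OF D B(2)])
        (auto simp: sum_lessThan_times block_map_index[OF M] diag_blocks_def block_index_less intro!: sum.cong)
    finally show "(block_map m g2 M * diag_blocks a S) $$ (x, y) = (diag_blocks a S * block_map m g1 M) $$ (x, y)" .
  qed (use B D in auto)
qed

section \<open>Uniqueness and descent of d-th roots of polynomials with constant term 1\<close>

lemma poly_power_eq_imp_eq:
  fixes p q :: "'a::idom poly"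
  assumes "p ^ d = q ^ d" "poly p 0 = 1" "poly q 0 = 1" "of_nat d \<noteq> (0::'a)"
  shows "p = q"
proof -
  let ?s = "\<Sum>i<d. q ^ (d - Suc i) * p ^ i"
  have "(p - q) * ?s = 0"
    using power_diff_sumr2[of p d q] assms(1) by simp
  \<comment> \<open>At 0 each of the \<open>d\<close> summands of the cofactor equals 1, so the
    cofactor is not the zero polynomial.\<close>
  moreover have "poly ?s 0 = of_nat d"
    using assms by (simp add: poly_sum)
  then have "?s \<noteq> 0" using assms(4) by (metis poly_0)
  ultimately show ?thesis by simp
qed

text \<open>The coefficient of \<open>T^k\<close> in \<open>P^d\<close> is \<open>d\<close> times
  that of \<open>P\<close> plus an expression in lower coefficients. As \<open>d\<close> is
  invertible, the coefficients of \<open>P\<close> descend one after another.\<close>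

lemma poly_power_descent:
  fixes h :: "'f::field \<Rightarrow> 'l::field"
  assumes "comm_ring_hom h" and d: "of_nat d \<noteq> (0::'f)"
    and P: "P ^ d = map_poly h Q" "coeff P 0 = 1"
  shows "\<exists>P0. P = map_poly h P0"
proof -
  interpret comm_ring_hom h by fact
  interpret field_hom h ..
  have range_add: "x + y \<in> range h" if "x \<in> range h" "y \<in> range h" for x y
    using that by (auto simp: hom_add[symmetric] simp del: hom_add)
  have range_mult: "x * y \<in> range h" if "x \<in> range h" "y \<in> range h" for x y
    using that by (auto simp: hom_mult[symmetric] simp del: hom_mult)
  have range_zero: "0 \<in> range h" and range_one: "1 \<in> range h"
    using hom_zero hom_one by (metis rangeI)+
  have range_sum: "(\<Sum>i\<in>I. f i) \<in> range h" if "\<And>i. i \<in> I \<Longrightarrow> f i \<in> range h" for f and I :: "nat set"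
    using that by (induction I rule: infinite_finite_induct) (auto intro: range_add range_zero simp del: hom_zero)
  have "coeff P k \<in> range h" for k
  proof (induction k rule: less_induct)
    case (less k)
    show ?case
    proof (cases "k = 0")
      case False
      \<comment> \<open>Induction on the exponent \<open>e\<close>. The coefficient at
        \<open>k\<close> is tracked modulo the range of \<open>h\<close>; the lower coefficients and
        the constant term have to be carried along for the next multiplication by
        \<open>P\<close>.\<close>
      have *: "(\<exists>r \<in> range h. coeff (P ^ e) k = r + of_nat e * coeff P k) \<and>
        (\<forall>i<k. coeff (P ^ e) i \<in> range h) \<and> coeff (P ^ e) 0 = 1" for e
      proof (induction e)
        case 0
        show ?case using False range_zero range_one
          by (auto simp: coeff_1 intro!: bexI[of _ 0])
      next
        case (Suc e)
        then obtain r where r: "r \<in> range h" "coeff (P ^ e) k = r + of_nat e * coeff P k"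
          and low: "\<And>i. i < k \<Longrightarrow> coeff (P ^ e) i \<in> range h" and c0: "coeff (P ^ e) 0 = 1" by blast
        \<comment> \<open>In the convolution only the extreme indices 0 and \<open>k\<close> involve
          the unknown coefficient of \<open>P\<close>: the first contributes it \<open>e\<close>
          times, the second once more.\<close>
        have set: "{..k} = insert 0 (insert k {0<..<k})" using False by auto
        let ?t = "\<Sum>i\<in>{0<..<k}. coeff P i * coeff (P ^ e) (k - i)"
        have "?t \<in> range h" using less low by (intro range_sum range_mult) auto
        moreover have "coeff (P ^ Suc e) k = (r + ?t) + of_nat (Suc e) * coeff P k"
          using False by (simp add: coeff_mult set r(2) c0 P(2) algebra_simps)
        moreover have "coeff (P ^ Suc e) i \<in> range h" if "i < k" for i
          using that less low by (auto simp: coeff_mult intro!: range_sum range_mult)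
        moreover have "coeff (P ^ Suc e) 0 = 1" by (simp add: coeff_mult P(2) c0)
        ultimately show ?case using range_add r(1) by blast
      qed
      from *[of d] obtain r' where r': "coeff (P ^ d) k = h r' + of_nat d * coeff P k" by blast
      then have "of_nat d * coeff P k = h (coeff Q k - r')" by (simp add: P(1) coeff_map_poly hom_minus)
      moreover have "of_nat d = h (of_nat d)" by (simp add: hom_of_nat)
      moreover have "h (of_nat d) \<noteq> 0" using d by simp
      ultimately have "coeff P k = h ((coeff Q k - r') / of_nat d)"
        by (simp add: hom_div field_simps)
      then show ?thesis by blast
    qed (use P(2) range_one in simp)
  qed
  then have h: "h (inv_into UNIV h (coeff P k)) = coeff P k" for k by (simp add: f_inv_into_f)
  \<comment> \<open>A field homomorphism is injective, so beyond the degree the chosen preimage is 0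
    and the preimages are the coefficients of a polynomial.\<close>
  have "inv_into UNIV h (coeff P k) = 0" if "degree P < k" for k
    using h[of k] coeff_eq_0[OF that] by simp
  then have "{k. inv_into UNIV h (coeff P k) \<noteq> 0} \<subseteq> {..degree P}" by (auto simp: not_less[symmetric])
  then have "finite {k. inv_into UNIV h (coeff P k) \<noteq> 0}" by (rule finite_subset) simp
  then have "coeff (Abs_poly (\<lambda>k. inv_into UNIV h (coeff P k))) = (\<lambda>k. inv_into UNIV h (coeff P k))"
    by (simp add: Abs_poly_inverse MOST_iff_cofinite)
  then have "P = map_poly h (Abs_poly (\<lambda>k. inv_into UNIV h (coeff P k)))"
    by (intro poly_eqI) (simp add: coeff_map_poly h)
  then show ?thesis by blast
qed

text \<open>Column \<open>i\<close> is \<open>\<phi> (b i)\<close> read row by row: the matrix of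
  the L-linear extension of \<phi> from B \<otimes> L to the d by d matrices. Its invertibility
  encodes the splitting condition.\<close>

definition rep_matrix :: "nat \<Rightarrow> ('b \<Rightarrow> 'l mat) \<Rightarrow> nat \<Rightarrow> (nat \<Rightarrow> 'b) \<Rightarrow> 'l mat" where
  "rep_matrix d \<phi> m b = mat (d * d) m (\<lambda>(x, i). \<phi> (b i) $$ (x div d, x mod d))"

text \<open>Existence of coefficients makes the matrix surjective, uniqueness makes it injective,
  and each yields one inequality between \<open>m\<close> and \<open>d * d\<close>.\<close>

lemma rep_matrix_square_if_basis:
  fixes \<phi> :: "'b \<Rightarrow> 'l::field mat"
  assumes ex1: "\<forall>M\<in>carrier_mat d d. \<exists>!v. v \<in> carrier_vec m \<and>
       (\<forall>p<d. \<forall>q<d. M $$ (p, q) = (\<Sum>i<m. vec_index v i * \<phi> (b i) $$ (p, q)))"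
  shows "m = d * d" "det (rep_matrix d \<phi> m b) \<noteq> 0"
proof -
  let ?S = "rep_matrix d \<phi> m b"
  have S: "?S \<in> carrier_mat (d * d) m" by (simp add: rep_matrix_def)
  have Sv: "vec_index (?S *\<^sub>v v) x = (\<Sum>i<m. vec_index v i * \<phi> (b i) $$ (x div d, x mod d))"
    if "v \<in> carrier_vec m" "x < d * d" for v x
    using that by (auto simp: rep_matrix_def scalar_prod_def atLeast0LessThan mult.commute)
  have ex: "\<exists>v. v \<in> carrier_vec m \<and> ?S *\<^sub>v v = u" if "u \<in> carrier_vec (d * d)" for u
  proof -
    have "mat d d (\<lambda>(p, q). vec_index u (p * d + q)) \<in> carrier_mat d d" by simp
    from bspec[OF ex1 this] obtain v where v: "v \<in> carrier_vec m"
      "\<And>p q. p < d \<Longrightarrow> q < d \<Longrightarrow> vec_index u (p * d + q) = (\<Sum>i<m. vec_index v i * \<phi> (b i) $$ (p, q))"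
      by auto
    have "?S *\<^sub>v v = u"
      using S that v div_mod_block(1,2)[of _ d d]
      by (intro eq_vecI) (auto simp: Sv v(2)[symmetric] simp del: index_mult_mat_vec)
    with v(1) show ?thesis by blast
  qed
  have inj: "v = 0\<^sub>v m" if v: "v \<in> carrier_vec m" "?S *\<^sub>v v = 0\<^sub>v (d * d)" for v
  proof -
    have "(\<Sum>i<m. vec_index v i * \<phi> (b i) $$ (p, q)) = 0" if "p < d" "q < d" for p q
      using Sv[OF v(1) block_index_less[OF that]] v(2) that block_index_less[OF that] by simp
    then have "v \<in> carrier_vec m \<and> (\<forall>p<d. \<forall>q<d. 0\<^sub>m d d $$ (p, q) = (\<Sum>i<m. vec_index v i * \<phi> (b i) $$ (p, q)))"
      using v(1) by simp
    moreover have "0\<^sub>v m \<in> carrier_vec m \<and>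
        (\<forall>p<d. \<forall>q<d. 0\<^sub>m d d $$ (p, q) = (\<Sum>i<m. vec_index (0\<^sub>v m) i * \<phi> (b i) $$ (p, q)))"
      by simp
    ultimately show ?thesis using bspec[OF ex1 zero_carrier_mat[of d d]] by blast
  qed
  \<comment> \<open>The columns of \<open>T\<close> solve the system for the unit vectors, so
    \<open>T\<close> is a right inverse and in particular injective.\<close>
  define T where "T = mat_of_cols m (map (\<lambda>x. SOME v. v \<in> carrier_vec m \<and> ?S *\<^sub>v v = unit_vec (d * d) x) [0..<d * d])"
  have T: "T \<in> carrier_mat m (d * d)" by (simp add: T_def carrier_matI)
  have colT: "col T x \<in> carrier_vec m \<and> ?S *\<^sub>v col T x = unit_vec (d * d) x" if "x < d * d" for x
  proof -
    have "(SOME v. v \<in> carrier_vec m \<and> ?S *\<^sub>v v = unit_vec (d * d) x) \<in> carrier_vec m \<and>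
       ?S *\<^sub>v (SOME v. v \<in> carrier_vec m \<and> ?S *\<^sub>v v = unit_vec (d * d) x) = unit_vec (d * d) x"
      using someI_ex[OF ex[OF unit_vec_carrier[of "d * d" x]]] .
    then show ?thesis using that by (simp add: T_def)
  qed
  have ST: "?S * T = 1\<^sub>m (d * d)"
  proof (rule eq_matI)
    fix x y assume "x < dim_row (1\<^sub>m (d * d))" "y < dim_col (1\<^sub>m (d * d))"
    then have xy: "x < d * d" "y < d * d" by auto
    have "(?S * T) $$ (x, y) = vec_index (?S *\<^sub>v col T y) x"
      using S T xy by simp
    then show "(?S * T) $$ (x, y) = 1\<^sub>m (d * d) $$ (x, y)" using colT[OF xy(2)] xy by simp
  qed (use S T in auto)
  have "v = 0\<^sub>v (d * d)" if "v \<in> carrier_vec (d * d)" "T *\<^sub>v v = 0\<^sub>v m" for v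
    using that ST assoc_mult_mat_vec[OF S T that(1)] mult_mat_vec_zero[OF S] by simp
  with T have "d * d \<le> m" by (rule injective_matrix_dim_le)
  moreover from S inj have "m \<le> d * d" by (rule injective_matrix_dim_le)
  ultimately show m: "m = d * d" by simp
  have "det ?S * det T = 1" using det_mult[of ?S m T] S T ST m by simp
  then show "det ?S \<noteq> 0" by auto
qed

text \<open>A splitting relative to a prescribed basis and over any field \<open>'l\<close> with a
  map \<open>h\<close> from the ground field. This freedom is needed to split A over the closure of
  K, where \<open>h\<close> is a composite of two maps.\<close>

locale split_algebra = right_basis_comm s m b + mat_rep \<phi> d
  for s :: "'f::field \<Rightarrow> 'b::ring_1" and m b and \<phi> :: "'b \<Rightarrow> 'l::field mat" and d +
  fixes h :: "'f \<Rightarrow> 'l"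
  assumes central: "algebra_map s"
    and ground_hom: "comm_ring_hom h"
    and ground: "\<phi> (s c) = h c \<cdot>\<^sub>m 1\<^sub>m d"
    and dim_eq: "m = d * d"
    and det_rep_matrix: "det (rep_matrix d \<phi> m b) \<noteq> 0"
begin

sublocale ground: comm_ring_hom h by (rule ground_hom)

lemma rep_index:
  "p < d \<Longrightarrow> q < d \<Longrightarrow> \<phi> x $$ (p, q) = (\<Sum>i<m. \<phi> (b i) $$ (p, q) * h (coord x i))"
  by (subst expand[of x])
    (simp add: sum_index mult_index ground if_distrib[of "\<lambda>x. _ * x"] cong: if_cong)

lemma degree_pos: "0 < d"
proof (rule gr0I)
  assume "d = 0"
  then have "m = 0" using dim_eq by simp
  then have "(1::'b) = 0" using expand[of 1] by simp
  then show False by simp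
qed

text \<open>On matrices read row by row, left multiplication by \<open>\<phi> x\<close> is the
  Kronecker product of \<open>\<phi> x\<close> with the identity, which is the block matrix on the
  left. The splitting carries left multiplication by \<open>x\<close> to it.\<close>

lemma rep_intertwine:
  "block_map d (\<lambda>c. c \<cdot>\<^sub>m 1\<^sub>m d) (\<phi> x) * rep_matrix d \<phi> m b = rep_matrix d \<phi> m b * map_mat h (lmat x)"
proof (rule eq_matI)
  have S: "rep_matrix d \<phi> m b \<in> carrier_mat (d * d) m" by (simp add: rep_matrix_def)
  have L: "map_mat h (lmat x) \<in> carrier_mat m m" by simp
  have B: "block_map d (\<lambda>c. c \<cdot>\<^sub>m 1\<^sub>m d) (\<phi> x) \<in> carrier_mat (d * d) (d * d)"
    by (rule block_map_carrier[OF carrier])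
  fix y i assume "y < dim_row (rep_matrix d \<phi> m b * map_mat h (lmat x))"
    "i < dim_col (rep_matrix d \<phi> m b * map_mat h (lmat x))"
  with S L have y: "y < d * d" and i: "i < m" by auto
  note dy = div_mod_block[OF y]
  have "(block_map d (\<lambda>c. c \<cdot>\<^sub>m 1\<^sub>m d) (\<phi> x) * rep_matrix d \<phi> m b) $$ (y, i) =
     (\<Sum>q<d. \<Sum>r<d. (if y mod d = r then \<phi> x $$ (y div d, q) else 0) * \<phi> (b i) $$ (q, r))"
    using y i dy
    by (subst index_mult_mat_sum[OF B S])
      (auto simp: sum_lessThan_times block_map_index[OF carrier] rep_matrix_def block_index_less intro!: sum.cong)
  also have "\<dots> = (\<Sum>q<d. \<phi> x $$ (y div d, q) * \<phi> (b i) $$ (q, y mod d))"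
    using dy by (simp add: if_distrib[of "\<lambda>x. x * _"] cong: if_cong)
  also have "\<dots> = \<phi> (x * b i) $$ (y div d, y mod d)"
    using dy by (simp add: mult_index)
  also have "\<dots> = (\<Sum>k<m. \<phi> (b k) $$ (y div d, y mod d) * h (lmat x $$ (k, i)))"
    using dy i by (simp add: rep_index[of _ _ "x * b i"] lmat_index)
  also have "\<dots> = (rep_matrix d \<phi> m b * map_mat h (lmat x)) $$ (y, i)"
    using y i carrier_matD[OF lmat_carrier] by (subst index_mult_mat_sum[OF S L]) (auto simp: rep_matrix_def)
  finally show "(block_map d (\<lambda>c. c \<cdot>\<^sub>m 1\<^sub>m d) (\<phi> x) * rep_matrix d \<phi> m b) $$ (y, i) =
     (rep_matrix d \<phi> m b * map_mat h (lmat x)) $$ (y, i)" .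
qed (auto simp: rep_matrix_def block_map_def carrier_matD[OF lmat_carrier] simp flip: dim_eq)

theorem det_pencil_split:
  assumes M: "M \<in> carrier_mat a a"
  shows "map_poly h (det (pencil (block_map m lmat M))) = det (pencil (block_map d \<phi> M)) ^ d"
proof -
  have S: "rep_matrix d \<phi> m b \<in> carrier_mat m m" by (simp add: rep_matrix_def dim_eq)
  have "map_poly h (det (pencil (block_map m lmat M))) = det (pencil (map_mat h (block_map m lmat M)))"
    using M by (subst det_pencil_hom[OF ground_hom, of _ "a * m"]) auto
  also have "map_mat h (block_map m lmat M) = block_map m (\<lambda>x. map_mat h (lmat x)) M"
  proof (rule eq_matI)
    fix x y assume "x < dim_row (block_map m (\<lambda>x. map_mat h (lmat x)) M)"
      "y < dim_col (block_map m (\<lambda>x. map_mat h (lmat x)) M)"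
    then have "x < dim_row M * m" "y < dim_col M * m" by (auto simp: block_map_def)
    then show "map_mat h (block_map m lmat M) $$ (x, y) = block_map m (\<lambda>x. map_mat h (lmat x)) M $$ (x, y)"
      using div_mod_block[of x _ m] div_mod_block[of y _ m] carrier_matD[OF lmat_carrier]
      by (simp add: block_map_def)
  qed (auto simp: block_map_def)
  also have "det (pencil \<dots>) = det (pencil (block_map m (\<lambda>x. block_map d (\<lambda>c. c \<cdot>\<^sub>m 1\<^sub>m d) (\<phi> x)) M))"
    by (rule det_pencil_block_map_conj[symmetric, OF _ _ S rep_intertwine det_rep_matrix M])
      (use block_map_carrier[OF carrier, of d] in \<open>auto simp flip: dim_eq\<close>)
  also have "block_map m (\<lambda>x. block_map d (\<lambda>c. c \<cdot>\<^sub>m 1\<^sub>m d) (\<phi> x)) M =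
      block_map d (\<lambda>c. c \<cdot>\<^sub>m 1\<^sub>m d) (block_map d \<phi> M)"
    using block_map_block_map[OF M carrier, of d "\<lambda>c. c \<cdot>\<^sub>m 1\<^sub>m d"] by (simp add: dim_eq)
  also have "det (pencil \<dots>) = det (pencil (block_map d \<phi> M)) ^ d"
    using M degree_pos by (intro det_pencil_block_scalar[of _ "a * d"]) auto
  finally show ?thesis .
qed

lemma det_pencil_split_element: "map_poly h (det (pencil (lmat x))) = det (pencil (\<phi> x)) ^ d"
  using det_pencil_split[of "mat 1 1 (\<lambda>_. x)" 1] by (simp add: block_map_single lmat.block_map_single)

end

text \<open>\<open>splitting\<close> provides some basis of its own; a base change carries the
  nonvanishing determinant over to the prescribed basis.\<close>

lemma split_algebra_of_splitting:
  assumes s: "algebra_map s" and sp: "splitting s d \<phi>" and b: "right_basis s m b"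
  shows "split_algebra s m b \<phi> d to_ac"
proof -
  from sp have "\<exists>m' b'. algebra_basis s m' b' \<and> (\<forall>M\<in>carrier_mat d d. \<exists>!v. v \<in> carrier_vec m' \<and>
       (\<forall>p<d. \<forall>q<d. M $$ (p, q) = (\<Sum>i<m'. vec_index v i * \<phi> (b' i) $$ (p, q))))"
    unfolding splitting_def by (elim conjE)
  then obtain m' b' where b': "algebra_basis s m' b'"
    and ball: "\<forall>M\<in>carrier_mat d d. \<exists>!v. v \<in> carrier_vec m' \<and>
       (\<forall>p<d. \<forall>q<d. M $$ (p, q) = (\<Sum>i<m'. vec_index v i * \<phi> (b' i) $$ (p, q)))"
    by (elim exE conjE)
  have rb': "right_basis s m' b'" using b' s algebra_basis_iff_right_basis by blast
  have mm: "m' = m" using right_basis_card_unique[OF rb' b] .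
  note rb' = rb'[unfolded mm] and sq = rep_matrix_square_if_basis[of d m' \<phi> b', OF ball, unfolded mm]
  interpret right_basis s m b by fact
  interpret B': right_basis s m b' by fact
  interpret mat_rep \<phi> d using sp by unfold_locales (auto simp: splitting_def)
  have ground: "\<phi> (s c) = to_ac c \<cdot>\<^sub>m 1\<^sub>m d" for c using sp by (auto simp: splitting_def)
  have to_ac: "comm_ring_hom (to_ac :: 'a \<Rightarrow> 'a alg_closure)" by unfold_locales auto
  have S: "rep_matrix d \<phi> m b \<in> carrier_mat m m" "rep_matrix d \<phi> m b' \<in> carrier_mat m m"
    by (simp_all add: rep_matrix_def sq(1)[symmetric])
  let ?P = "map_mat to_ac (base_change s m b m b')"
  have P: "?P \<in> carrier_mat m m" by (simp add: base_change_def)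
  have "rep_matrix d \<phi> m b' = rep_matrix d \<phi> m b * ?P"
  proof (rule eq_matI)
    fix x i assume "x < dim_row (rep_matrix d \<phi> m b * ?P)" "i < dim_col (rep_matrix d \<phi> m b * ?P)"
    with S P have x: "x < m" and i: "i < m" by auto
    note dx = div_mod_block[OF x[unfolded sq(1)]]
    have "rep_matrix d \<phi> m b' $$ (x, i) = \<phi> (b' i) $$ (x div d, x mod d)"
      using x i by (simp add: rep_matrix_def sq(1)[symmetric])
    also have "\<dots> = (\<Sum>k<m. \<phi> (b k) $$ (x div d, x mod d) * to_ac (coord (b' i) k))"
      using dx by (subst expand[of "b' i"])
        (simp add: sum_index mult_index ground if_distrib[of "\<lambda>x. _ * x"] cong: if_cong)
    also have "\<dots> = (rep_matrix d \<phi> m b * ?P) $$ (x, i)"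
      using x i by (subst index_mult_mat_sum[OF S(1) P]) (auto simp: rep_matrix_def base_change_def sq(1)[symmetric])
    finally show "rep_matrix d \<phi> m b' $$ (x, i) = (rep_matrix d \<phi> m b * ?P) $$ (x, i)" .
  qed (use S P in auto)
  then have "det (rep_matrix d \<phi> m b) \<noteq> 0"
    using sq(2) det_mult[OF S(1) P] by auto
  then show ?thesis
    using s ground to_ac sq(1) by unfold_locales auto
qed

text \<open>\<open>P\<close> is the reduced norm of the pencil \<open>1 + T (x - 1)\<close>. It
  exists over the ground field by descent of d-th roots, which also puts its value at 1
  there.\<close>

theorem reduced_norm_splitting:
  fixes s :: "'f::field \<Rightarrow> 'b::ring_1"
  assumes s: "algebra_map s" and b: "right_basis s m b" and sp: "splitting s d \<phi>" and d: "of_nat d \<noteq> (0::'f)"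
  shows "to_ac (reduced_norm s x) = det (\<phi> x)"
    and "\<exists>P. map_poly to_ac P = det (pencil (\<phi> x)) \<and> poly P 0 = 1 \<and> poly P 1 = reduced_norm s x \<and>
      P ^ d = det (pencil (left_mult_matrix s m b x))"
proof -
  interpret split_algebra s m b \<phi> d to_ac using s sp b by (rule split_algebra_of_splitting)
  interpret ac: inj_idom_hom "to_ac :: 'f \<Rightarrow> 'f alg_closure" by unfold_locales auto
  interpret mp: comm_ring_hom "map_poly (to_ac :: 'f \<Rightarrow> 'f alg_closure)" by (rule comm_ring_hom_map_poly[OF ground_hom])
  let ?Q = "det (pencil (lmat x))"
  have "det (pencil (\<phi> x)) ^ d = map_poly to_ac ?Q" using det_pencil_split_element ..
  moreover have "coeff (det (pencil (\<phi> x))) 0 = 1"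
    using poly_det_pencil_0[OF carrier] by (simp add: poly_0_coeff_0)
  ultimately obtain P where P: "det (pencil (\<phi> x)) = map_poly to_ac P"
    using poly_power_descent[OF ground_hom d] by blast
  have ev: "poly (map_poly to_ac p) (to_ac c) = to_ac (poly p c)" for p c
    by (induction p) (auto simp: map_poly_pCons_fix0)
  have P1: "det (\<phi> x) = to_ac (poly P 1)"
    using poly_det_pencil_1[OF carrier, of x] ev[of P 1] by (simp add: P)
  have P0: "poly P 0 = 1"
    using poly_det_pencil_0[OF carrier, of x] ev[of P 0] by (simp add: P)
  have "map_poly to_ac (P ^ d) = map_poly to_ac ?Q"
    using det_pencil_split_element[of x] P
    by (simp add: mp.hom_power)
  then have Pd: "P ^ d = ?Q" by (simp add: poly_eq_iff coeff_map_poly)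
  have rn: "reduced_norm s x = poly P 1"
    unfolding reduced_norm_def
  proof (rule the_equality)
    show "\<exists>d \<phi>. splitting s d \<phi> \<and> det (\<phi> x) = to_ac (poly P 1)" using sp P1 by blast
    fix c assume "\<exists>d \<phi>. splitting s d \<phi> \<and> det (\<phi> x) = to_ac c"
    then obtain d' \<phi>' where sp': "splitting s d' \<phi>'" and c: "det (\<phi>' x) = to_ac c" by blast
    \<comment> \<open>Any other splitting has the same size, because its square is the dimension
      \<open>m\<close>. Its pencil determinant has the same d-th power and constant term 1, so both
      splittings give the same value.\<close>
    interpret S': split_algebra s m b \<phi>' d' to_ac using s sp' b by (rule split_algebra_of_splitting)
    have "d'\<^sup>2 = d\<^sup>2" using dim_eq S'.dim_eq by (simp add: power2_eq_square)
    then have dd: "d' = d" by simp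
    have "det (pencil (\<phi>' x)) ^ d = det (pencil (\<phi> x)) ^ d"
      using S'.det_pencil_split_element[of x] det_pencil_split_element[of x] by (simp add: dd)
    moreover have "of_nat d \<noteq> (0 :: 'f alg_closure)" using d by (metis to_ac_of_nat to_ac_eq_0_iff)
    ultimately have "det (pencil (\<phi>' x)) = det (pencil (\<phi> x))"
      using poly_power_eq_imp_eq poly_det_pencil_0[OF carrier] poly_det_pencil_0[OF S'.carrier] by blast
    then have "det (\<phi>' x) = det (\<phi> x)"
      using poly_det_pencil_1[OF carrier] poly_det_pencil_1[OF S'.carrier] by metis
    then show "c = poly P 1" using c P1 by simp
  qed
  show "to_ac (reduced_norm s x) = det (\<phi> x)" by (simp add: rn P1)
  show "\<exists>P. map_poly to_ac P = det (pencil (\<phi> x)) \<and> poly P 0 = 1 \<and> poly P 1 = reduced_norm s x \<and>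
      P ^ d = det (pencil (left_mult_matrix s m b x))"
    using P P0 Pd rn by metis
qed

subsection \<open>Existence of splittings\<close>

definition indep_over :: "('f::field \<Rightarrow> 'l::field) \<Rightarrow> (nat \<Rightarrow> 'l) \<Rightarrow> nat \<Rightarrow> bool" where
  "indep_over h l k \<longleftrightarrow> (\<forall>f. (\<Sum>j<k. h (f j) * l j) = 0 \<longrightarrow> (\<forall>j<k. f j = 0))"

text \<open>This turns relations with coefficients in L into relations over F. The independent
  family is enlarged by \<open>c m\<close> only when \<open>c m\<close> is not yet in its
  span.\<close>

lemma indep_over_expansion:
  fixes h :: "'f::field \<Rightarrow> 'l::field" and c :: "nat \<Rightarrow> 'l"
  assumes "comm_ring_hom h"
  shows "\<exists>k l f. indep_over h l k \<and> (\<forall>i<m. c i = (\<Sum>j<k. h (f i j) * l j))"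
proof (induction m)
  case 0
  show ?case by (rule exI[of _ 0]) (simp add: indep_over_def)
next
  case (Suc m)
  interpret comm_ring_hom h by fact
  interpret field_hom h ..
  from Suc obtain k l f where l: "indep_over h l k" and f: "\<And>i. i < m \<Longrightarrow> c i = (\<Sum>j<k. h (f i j) * l j)" by blast
  show ?case
  proof (cases "\<exists>u. c m = (\<Sum>j<k. h (u j) * l j)")
    case True
    then obtain u where u: "c m = (\<Sum>j<k. h (u j) * l j)" by blast
    have "\<forall>i<Suc m. c i = (\<Sum>j<k. h ((f(m := u)) i j) * l j)" using f u by (auto simp: less_Suc_eq)
    with l show ?thesis by blast
  next
    case False
    let ?l = "l(k := c m)" and ?f = "\<lambda>i j. if i = m then if j = k then 1 else 0 else if j = k then 0 else f i j"
    have "indep_over h ?l (Suc k)"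
      unfolding indep_over_def
    proof (intro allI impI)
      fix u j assume sum: "(\<Sum>j<Suc k. h (u j) * ?l j) = 0" and j: "j < Suc k"
      then have eq: "(\<Sum>j<k. h (u j) * l j) = - (h (u k) * c m)" by (simp add: eq_neg_iff_add_eq_0)
      have "u k = 0"
      proof (rule ccontr)
        assume "u k \<noteq> 0"
        then have "c m = - (\<Sum>j<k. h (u j) * l j) / h (u k)" by (simp add: eq)
        also have "\<dots> = (\<Sum>j<k. h (- u j / u k) * l j)"
          by (simp add: sum_divide_distrib sum_negf hom_div hom_uminus)
        finally have "\<exists>u. c m = (\<Sum>j<k. h (u j) * l j)" by (rule exI[of _ "\<lambda>j. - u j / u k"])
        with False show False ..
      qed
      with eq have "(\<Sum>j<k. h (u j) * l j) = 0" by simp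
      with l j \<open>u k = 0\<close> show "u j = 0" unfolding indep_over_def less_Suc_eq by blast
    qed
    moreover have "\<forall>i<Suc m. c i = (\<Sum>j<Suc k. h (?f i j) * ?l j)"
      using f by (auto simp: less_Suc_eq)
    ultimately show ?thesis by (intro exI[of _ "Suc k"] exI[of _ ?l] exI[of _ ?f] conjI)
  qed
qed

text \<open>The shortest-relation argument, run as an induction on the length. If the last
  coefficient is nonzero, it is divided out; commutators with any \<open>x\<close> then form a
  shorter relation, so all coefficients are central and lie in F, against the independence of
  \<open>l\<close>.\<close>

lemma division_rep_indep:
  fixes s :: "'f::field \<Rightarrow> 'a::division_ring" and \<phi> :: "'a \<Rightarrow> 'l::field mat"
  assumes "algebra_map s" and center: "{z. \<forall>x. z * x = x * z} = range s"
    and "comm_ring_hom h" and "mat_rep \<phi> d" and d: "0 < d"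
    and ground: "\<And>c. \<phi> (s c) = h c \<cdot>\<^sub>m 1\<^sub>m d"
  shows "indep_over h l k \<Longrightarrow> (\<And>p q. p < d \<Longrightarrow> q < d \<Longrightarrow> (\<Sum>j<k. \<phi> (a j) $$ (p, q) * l j) = 0) \<Longrightarrow>
    j < k \<Longrightarrow> a j = 0"
proof (induction k arbitrary: a j)
  case (Suc k)
  interpret mat_rep \<phi> d by fact
  interpret h: comm_ring_hom h by fact
  interpret s: Ring_Hom.ring_hom s using assms(1) by (rule algebra_map_hom)
  have ind: "indep_over h l k"
    unfolding indep_over_def
  proof (intro allI impI)
    fix f j assume "(\<Sum>j<k. h (f j) * l j) = 0" and j: "j < k"
    then have "(\<Sum>j<Suc k. h ((f(k := 0)) j) * l j) = 0" by (simp add: h.hom_zero)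
    with Suc.prems(1) have "\<forall>j<Suc k. (f(k := 0)) j = 0" unfolding indep_over_def by blast
    then show "f j = 0" using j by (metis fun_upd_other less_Suc_eq less_irrefl)
  qed
  have ak: "a k = 0"
  proof (rule ccontr)
    assume nz: "a k \<noteq> 0"
    define c where "c j = inverse (a k) * a j" for j
    have left: "(\<Sum>j<n. \<phi> (x * u j) $$ (p, q) * l j) = 0"
      if "p < d" "q < d" "\<And>p q. p < d \<Longrightarrow> q < d \<Longrightarrow> (\<Sum>j<n. \<phi> (u j) $$ (p, q) * l j) = 0" for x u n p q
    proof -
      have "(\<Sum>j<n. \<phi> (x * u j) $$ (p, q) * l j) = (\<Sum>r<d. \<phi> x $$ (p, r) * (\<Sum>j<n. \<phi> (u j) $$ (r, q) * l j))"
        using that(1,2) by (simp add: mult_index sum_distrib_right sum_distrib_left mult.assoc) (rule sum.swap)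
      then show ?thesis using that by simp
    qed
    have right: "(\<Sum>j<n. \<phi> (u j * x) $$ (p, q) * l j) = 0"
      if "p < d" "q < d" "\<And>p q. p < d \<Longrightarrow> q < d \<Longrightarrow> (\<Sum>j<n. \<phi> (u j) $$ (p, q) * l j) = 0" for x u n p q
    proof -
      have "(\<Sum>j<n. \<phi> (u j * x) $$ (p, q) * l j) = (\<Sum>r<d. (\<Sum>j<n. \<phi> (u j) $$ (p, r) * l j) * \<phi> x $$ (r, q))"
        using that(1,2) by (simp add: mult_index sum_distrib_right sum_distrib_left mult_ac) (rule sum.swap)
      then show ?thesis using that by simp
    qed
    have rel: "(\<Sum>j<Suc k. \<phi> (c j) $$ (p, q) * l j) = 0" if "p < d" "q < d" for p q
      unfolding c_def using that Suc.prems(2) by (intro left) auto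
    have ck: "c k = 1" using nz by (simp add: c_def)
    have "c j \<in> range s" if "j < Suc k" for j
    proof (cases "j = k")
      case True
      then show ?thesis using ck s.hom_one by (metis rangeI)
    next
      case False
      \<comment> \<open>As \<open>c k = 1\<close>, the commutator at position \<open>k\<close> is
        zero and the relation has only \<open>k\<close> terms, so the induction hypothesis
        applies.\<close>
      have "x * c j - c j * x = 0" for x
      proof (rule Suc.IH[OF ind])
        fix p q assume pq: "p < d" "q < d"
        have "(\<Sum>j<Suc k. \<phi> (x * c j - c j * x) $$ (p, q) * l j) = 0"
        proof -
          have "\<phi> (u - v) $$ (p, q) = \<phi> u $$ (p, q) - \<phi> v $$ (p, q)" for u v
            using add_index[OF pq, of "u - v" v] by simp
          then show ?thesis
            using left[OF pq rel, of x] right[OF pq rel, of x] by (simp add: left_diff_distrib sum_subtractf del: sum.lessThan_Suc)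
        qed
        then show "(\<Sum>j<k. \<phi> (x * c j - c j * x) $$ (p, q) * l j) = 0"
          using pq by (simp add: ck zero_index)
      qed (use False that in simp)
      then show ?thesis using center by auto
    qed
    then have "\<forall>j\<in>{..<Suc k}. \<exists>e. c j = s e" by blast
    from bchoice[OF this] obtain f where f: "\<And>j. j < Suc k \<Longrightarrow> c j = s (f j)" by blast
    \<comment> \<open>Images of scalars are scalar matrices, so the entry at (0, 0), which exists as
      \<open>d\<close> is positive, is already an F-linear relation among the
      \<open>l j\<close>.\<close>
    have "(\<Sum>j<Suc k. h (f j) * l j) = (\<Sum>j<Suc k. \<phi> (c j) $$ (0, 0) * l j)"
      using d f by (intro sum.cong) (auto simp: ground)
    also have "\<dots> = 0" using rel d by blast
    finally have "f k = 0" using Suc.prems(1) unfolding indep_over_def by blast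
    then show False using f[of k] ck by simp
  qed
  show ?case
  proof (cases "j = k")
    case False
    have "(\<Sum>j<k. \<phi> (a j) $$ (p, q) * l j) = 0" if "p < d" "q < d" for p q
      using Suc.prems(2)[OF that] that by (simp add: ak zero_index)
    from Suc.IH[OF ind this] show ?thesis using False Suc.prems(3) by simp
  qed (simp add: ak)
qed simp

text \<open>The module is a subspace \<open>W\<close> of an ambient type. \<open>act_plus\<close>
  and \<open>act_expand\<close> are demanded on \<open>W\<close> alone because the action used later
  is precomposition with a multiplication, which is additive in the ring element only on additive
  functions.\<close>

locale irreducible_rep = Vector_Spaces.vector_space scale
  for scale :: "'l::alg_closed_field \<Rightarrow> 'v::ab_group_add \<Rightarrow> 'v" (infixr \<open>*\<^sub>v\<^sub>s\<close> 75) +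
  fixes act :: "'a::ring_1 \<Rightarrow> 'v \<Rightarrow> 'v" and W :: "'v set" and v :: "nat \<Rightarrow> 'v" and r m :: nat and b :: "nat \<Rightarrow> 'a"
  assumes subspace_W: "subspace W"
    and act_add: "act a (x + y) = act a x + act a y"
    and act_scale: "act a (e *\<^sub>v\<^sub>s x) = e *\<^sub>v\<^sub>s act a x"
    and act_plus: "x \<in> W \<Longrightarrow> act (a + a') x = act a x + act a' x"
    and act_one: "act 1 x = x"
    and act_mult: "act (a * a') x = act a (act a' x)"
    and act_closed: "x \<in> W \<Longrightarrow> act a x \<in> W"
    and act_expand: "\<exists>c. \<forall>x\<in>W. act a x = (\<Sum>i<m. c i *\<^sub>v\<^sub>s act (b i) x)"
    and irreducible: "subspace U \<Longrightarrow> U \<subseteq> W \<Longrightarrow> (\<And>a x. x \<in> U \<Longrightarrow> act a x \<in> U) \<Longrightarrow> U \<noteq> {0} \<Longrightarrow> U = W"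
    and basis_mem: "q < r \<Longrightarrow> v q \<in> W"
    and basis_span: "x \<in> W \<Longrightarrow> \<exists>c. x = (\<Sum>q<r. c q *\<^sub>v\<^sub>s v q)"
    and basis_indep: "(\<Sum>q<r. c q *\<^sub>v\<^sub>s v q) = 0 \<Longrightarrow> q < r \<Longrightarrow> c q = 0"
    and rank_pos: "0 < r"
begin

definition vcoord :: "'v \<Rightarrow> nat \<Rightarrow> 'l" where
  "vcoord x = (SOME c. x = (\<Sum>q<r. c q *\<^sub>v\<^sub>s v q))"

lemma vexpand: "x \<in> W \<Longrightarrow> x = (\<Sum>q<r. vcoord x q *\<^sub>v\<^sub>s v q)"
  unfolding vcoord_def by (rule someI_ex[OF basis_span])

lemma vcoord_eqI:
  assumes "x = (\<Sum>q<r. c q *\<^sub>v\<^sub>s v q)" "q < r"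
  shows "vcoord x q = c q"
proof -
  have "x \<in> W" unfolding assms(1) by (intro subspace_sum subspace_W subspace_scale basis_mem) auto
  then have "(\<Sum>q<r. (vcoord x q - c q) *\<^sub>v\<^sub>s v q) = 0"
    using assms(1) vexpand[of x] by (simp add: scale_left_diff_distrib sum_subtractf)
  from basis_indep[OF this assms(2)] show ?thesis by simp
qed

lemma vcoord_add: "x \<in> W \<Longrightarrow> y \<in> W \<Longrightarrow> q < r \<Longrightarrow> vcoord (x + y) q = vcoord x q + vcoord y q"
  by (rule vcoord_eqI) (subst (1) vexpand[of x], assumption, subst (1) vexpand[of y], assumption,
      simp_all add: scale_left_distrib sum.distrib)

lemma vcoord_scale: "x \<in> W \<Longrightarrow> q < r \<Longrightarrow> vcoord (c *\<^sub>v\<^sub>s x) q = c * vcoord x q"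
  by (rule vcoord_eqI) (subst (1) vexpand[of x], assumption, simp_all add: scale_sum_right)

lemma vcoord_zero: "q < r \<Longrightarrow> vcoord 0 q = 0"
  by (rule vcoord_eqI) simp_all

lemma vcoord_sum: "(\<And>i. i \<in> I \<Longrightarrow> f i \<in> W) \<Longrightarrow> q < r \<Longrightarrow> vcoord (\<Sum>i\<in>I. f i) q = (\<Sum>i\<in>I. vcoord (f i) q)"
  by (induction I rule: infinite_finite_induct) (auto simp: vcoord_zero vcoord_add subspace_sum subspace_W)

lemma vcoord_basis: "p < r \<Longrightarrow> q < r \<Longrightarrow> vcoord (v q) p = (if p = q then 1 else 0)"
  by (rule vcoord_eqI) (auto simp: if_distrib[of "\<lambda>c. c *\<^sub>v\<^sub>s _"] cong: if_cong)

lemma act_zero: "act a 0 = 0"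
  using act_add[of a 0 0] by simp

lemma act_sum: "act a (\<Sum>i\<in>I. f i) = (\<Sum>i\<in>I. act a (f i))"
  by (induction I rule: infinite_finite_induct) (auto simp: act_zero act_add)

text \<open>A commuting endomorphism has an eigenvector, and its eigenspace is a submodule.\<close>

lemma schur:
  assumes fW: "\<And>x. x \<in> W \<Longrightarrow> f x \<in> W"
    and f_add: "\<And>x y. x \<in> W \<Longrightarrow> y \<in> W \<Longrightarrow> f (x + y) = f x + f y"
    and f_scale: "\<And>c x. x \<in> W \<Longrightarrow> f (c *\<^sub>v\<^sub>s x) = c *\<^sub>v\<^sub>s f x"
    and f_act: "\<And>a x. x \<in> W \<Longrightarrow> f (act a x) = act a (f x)"
  shows "\<exists>c. \<forall>x\<in>W. f x = c *\<^sub>v\<^sub>s x"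
proof -
  have f_zero: "f 0 = 0" using f_scale[OF subspace_0[OF subspace_W], of 0] by simp
  have f_sum: "f (\<Sum>i\<in>I. g i) = (\<Sum>i\<in>I. f (g i))" if "\<And>i. i \<in> I \<Longrightarrow> g i \<in> W" for g and I :: "nat set"
    using that by (induction I rule: infinite_finite_induct) (auto simp: f_zero f_add subspace_sum subspace_W)
  define N where "N = mat r r (\<lambda>(p, q). vcoord (f (v q)) p)"
  have N: "N \<in> carrier_mat r r" by (simp add: N_def)
  \<comment> \<open>\<open>N\<close> is the matrix of \<open>f\<close> in the basis
    \<open>v\<close>. Its characteristic polynomial is not constant because \<open>r\<close> is
    positive, and so has a root.\<close>
  obtain e where "poly (char_poly N) e = 0"
    using alg_closed_imp_poly_has_root[of "char_poly N"] degree_monic_char_poly[OF N] rank_pos by auto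
  then have "eigenvalue N e" using eigenvalue_root_char_poly[OF N] by simp
  then obtain u where u: "u \<in> carrier_vec r" "u \<noteq> 0\<^sub>v r" "N *\<^sub>v u = e \<cdot>\<^sub>v u"
    using N by (auto simp: eigenvalue_def eigenvector_def)
  define y where "y = (\<Sum>q<r. vec_index u q *\<^sub>v\<^sub>s v q)"
  have yW: "y \<in> W" unfolding y_def by (intro subspace_sum subspace_W subspace_scale basis_mem) auto
  have "y \<noteq> 0"
  proof
    assume "y = 0"
    then have "vec_index u q = 0" if "q < r" for q using basis_indep that unfolding y_def by blast
    then show False using u by auto
  qed
  have "f y = (\<Sum>q<r. vec_index u q *\<^sub>v\<^sub>s f (v q))"
    unfolding y_def by (subst f_sum) (auto intro!: subspace_scale subspace_W basis_mem simp: f_scale basis_mem)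
  also have "\<dots> = (\<Sum>q<r. vec_index u q *\<^sub>v\<^sub>s (\<Sum>p<r. N $$ (p, q) *\<^sub>v\<^sub>s v p))"
    by (intro sum.cong refl arg_cong2[of _ _ _ _ "(*\<^sub>v\<^sub>s)"])
      (subst vexpand, auto simp: N_def fW basis_mem)
  also have "\<dots> = (\<Sum>p<r. (\<Sum>q<r. N $$ (p, q) * vec_index u q) *\<^sub>v\<^sub>s v p)"
    unfolding scale_sum_right scale_sum_left by (subst sum.swap) (simp add: mult.commute)
  also have "\<dots> = (\<Sum>p<r. (e * vec_index u p) *\<^sub>v\<^sub>s v p)"
  proof (intro sum.cong refl)
    fix p assume "p \<in> {..<r}"
    then have "vec_index (N *\<^sub>v u) p = (\<Sum>q<r. N $$ (p, q) * vec_index u q)"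
      using N u(1) by (auto simp: scalar_prod_def atLeast0LessThan)
    then show "(\<Sum>q<r. N $$ (p, q) * vec_index u q) *\<^sub>v\<^sub>s v p = (e * vec_index u p) *\<^sub>v\<^sub>s v p"
      using u \<open>p \<in> {..<r}\<close> by simp
  qed
  also have "\<dots> = e *\<^sub>v\<^sub>s y" by (simp add: y_def scale_sum_right)
  finally have fy: "f y = e *\<^sub>v\<^sub>s y" .
  have "{x \<in> W. f x = e *\<^sub>v\<^sub>s x} = W"
  proof (rule irreducible)
    show "subspace {x \<in> W. f x = e *\<^sub>v\<^sub>s x}"
      using subspace_W by (auto simp: subspace_def f_zero f_add f_scale scale_right_distrib mult.commute)
    show "act a x \<in> {x \<in> W. f x = e *\<^sub>v\<^sub>s x}" if "x \<in> {x \<in> W. f x = e *\<^sub>v\<^sub>s x}" for a x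
      using that by (auto simp: f_act act_closed act_scale)
    show "{x \<in> W. f x = e *\<^sub>v\<^sub>s x} \<noteq> {0}" using yW fy \<open>y \<noteq> 0\<close> by blast
  qed auto
  then show ?thesis by blast
qed

text \<open>Models the image of A \<otimes> L in the endomorphisms of \<open>W\<close> without
  forming that tensor product.\<close>

definition ops :: "('v \<Rightarrow> 'v) set" where
  "ops = {T. (\<forall>x y. T (x + y) = T x + T y) \<and> (\<forall>c x. T (c *\<^sub>v\<^sub>s x) = c *\<^sub>v\<^sub>s T x) \<and> (\<forall>x\<in>W. T x \<in> W) \<and>
     (\<exists>c. \<forall>x\<in>W. T x = (\<Sum>i<m. c i *\<^sub>v\<^sub>s act (b i) x))}"

lemma
  assumes "T \<in> ops"
  shows ops_linear: "T (x + y) = T x + T y" "T (c *\<^sub>v\<^sub>s x) = c *\<^sub>v\<^sub>s T x" "x \<in> W \<Longrightarrow> T x \<in> W"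
    and ops_expand: "\<exists>c. \<forall>x\<in>W. T x = (\<Sum>i<m. c i *\<^sub>v\<^sub>s act (b i) x)"
  using assms unfolding ops_def by blast+

lemma ops_id: "(\<lambda>x. x) \<in> ops"
  using act_expand[of 1] by (simp add: ops_def act_one)

lemma ops_add: "T \<in> ops \<Longrightarrow> T' \<in> ops \<Longrightarrow> (\<lambda>x. T x + T' x) \<in> ops"
proof -
  assume T: "T \<in> ops" and T': "T' \<in> ops"
  obtain c where c: "\<forall>x\<in>W. T x = (\<Sum>i<m. c i *\<^sub>v\<^sub>s act (b i) x)" using ops_expand[OF T] by blast
  obtain c' where c': "\<forall>x\<in>W. T' x = (\<Sum>i<m. c' i *\<^sub>v\<^sub>s act (b i) x)" using ops_expand[OF T'] by blast
  have "\<forall>x\<in>W. T x + T' x = (\<Sum>i<m. (c i + c' i) *\<^sub>v\<^sub>s act (b i) x)"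
    using c c' by (simp add: scale_left_distrib sum.distrib)
  then have "\<exists>e. \<forall>x\<in>W. T x + T' x = (\<Sum>i<m. e i *\<^sub>v\<^sub>s act (b i) x)" by (rule exI[of _ "\<lambda>i. c i + c' i"])
  then show ?thesis
    by (simp add: ops_def ops_linear[OF T] ops_linear[OF T'] scale_right_distrib subspace_add[OF subspace_W] ac_simps)
qed

lemma ops_scale: "T \<in> ops \<Longrightarrow> (\<lambda>x. e *\<^sub>v\<^sub>s T x) \<in> ops"
proof -
  assume T: "T \<in> ops"
  obtain c where c: "\<forall>x\<in>W. T x = (\<Sum>i<m. c i *\<^sub>v\<^sub>s act (b i) x)" using ops_expand[OF T] by blast
  have "\<forall>x\<in>W. e *\<^sub>v\<^sub>s T x = (\<Sum>i<m. (e * c i) *\<^sub>v\<^sub>s act (b i) x)"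
    using c by (simp add: scale_sum_right)
  then have "\<exists>c. \<forall>x\<in>W. e *\<^sub>v\<^sub>s T x = (\<Sum>i<m. c i *\<^sub>v\<^sub>s act (b i) x)" by (rule exI[of _ "\<lambda>i. e * c i"])
  then show ?thesis
    by (simp add: ops_def ops_linear[OF T] scale_right_distrib mult.commute subspace_scale[OF subspace_W])
qed

lemma ops_act: "T \<in> ops \<Longrightarrow> (\<lambda>x. act a (T x)) \<in> ops"
proof -
  assume T: "T \<in> ops"
  obtain c where c: "\<forall>x\<in>W. T x = (\<Sum>i<m. c i *\<^sub>v\<^sub>s act (b i) x)" using ops_expand[OF T] by blast
  have "\<forall>i. \<exists>e. \<forall>x\<in>W. act (a * b i) x = (\<Sum>k<m. e k *\<^sub>v\<^sub>s act (b k) x)" using act_expand by blast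
  then obtain e where e: "\<And>i x. x \<in> W \<Longrightarrow> act (a * b i) x = (\<Sum>k<m. e i k *\<^sub>v\<^sub>s act (b k) x)" by metis
  have "act a (T x) = (\<Sum>k<m. (\<Sum>i<m. c i * e i k) *\<^sub>v\<^sub>s act (b k) x)" if x: "x \<in> W" for x
  proof -
    have "act a (T x) = (\<Sum>i<m. c i *\<^sub>v\<^sub>s act (a * b i) x)"
      using c x by (simp add: act_sum act_scale act_mult)
    also have "\<dots> = (\<Sum>i<m. \<Sum>k<m. (c i * e i k) *\<^sub>v\<^sub>s act (b k) x)"
      using e[OF x] by (simp add: scale_sum_right)
    also have "\<dots> = (\<Sum>k<m. (\<Sum>i<m. c i * e i k) *\<^sub>v\<^sub>s act (b k) x)"
      unfolding scale_sum_left by (rule sum.swap)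
    finally show ?thesis .
  qed
  then have "\<exists>c. \<forall>x\<in>W. act a (T x) = (\<Sum>k<m. c k *\<^sub>v\<^sub>s act (b k) x)"
    by (intro exI[of _ "\<lambda>k. \<Sum>i<m. c i * e i k"]) blast
  then show ?thesis by (simp add: ops_def ops_linear[OF T] act_add act_scale act_closed)
qed

lemma ops_zero: "(\<lambda>x. 0) \<in> ops"
  using ops_scale[OF ops_id, of 0] by simp

lemma ops_sum: "(\<And>i. i \<in> I \<Longrightarrow> T i \<in> ops) \<Longrightarrow> (\<lambda>x. \<Sum>i\<in>I. T i x) \<in> ops"
  by (induction I rule: infinite_finite_induct) (auto simp: ops_zero ops_add)

text \<open>The values at \<open>x\<close> of the operators killing \<open>S\<close> form a nonzero
  submodule, which by irreducibility is all of \<open>W\<close>.\<close>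

lemma annihilator_orbit:
  assumes "T \<in> ops" "\<And>y. y \<in> S \<Longrightarrow> T y = 0" "x \<in> W" "T x \<noteq> 0" "z \<in> W"
  shows "\<exists>T\<in>ops. (\<forall>y\<in>S. T y = 0) \<and> T x = z"
proof -
  let ?U = "{T x | T. T \<in> ops \<and> (\<forall>y\<in>S. T y = 0)}"
  have "?U = W"
  proof (rule irreducible)
    show "subspace ?U"
    proof (rule subspaceI)
      show "0 \<in> ?U" using ops_zero by force
      show "y + y' \<in> ?U" if yy: "y \<in> ?U" "y' \<in> ?U" for y y'
      proof -
        from yy obtain T T' where "T \<in> ops" "\<forall>y\<in>S. T y = 0" "y = T x" "T' \<in> ops" "\<forall>y\<in>S. T' y = 0" "y' = T' x"
          by blast
        then show ?thesis by (intro CollectI exI[of _ "\<lambda>x. T x + T' x"]) (simp add: ops_add)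
      qed
      show "c *\<^sub>v\<^sub>s y \<in> ?U" if yU: "y \<in> ?U" for c y
      proof -
        from yU obtain T where "T \<in> ops" "\<forall>y\<in>S. T y = 0" "y = T x" by blast
        then show ?thesis by (intro CollectI exI[of _ "\<lambda>x. c *\<^sub>v\<^sub>s T x"]) (simp add: ops_scale)
      qed
    qed
    show "?U \<subseteq> W" using assms(3) ops_linear(3) by blast
    show "act a y \<in> ?U" if yU: "y \<in> ?U" for a y
    proof -
      from yU obtain T where "T \<in> ops" "\<forall>y\<in>S. T y = 0" "y = T x" by blast
      then show ?thesis by (intro CollectI exI[of _ "\<lambda>x. act a (T x)"]) (simp add: ops_act act_zero)
    qed
    show "?U \<noteq> {0}" using assms(1,2,4) by auto
  qed
  then have "z \<in> ?U" using assms(5) by simp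
  then show ?thesis by blast
qed

text \<open>Jacobson density, phrased through annihilators so that induction on the finite set
  \<open>S\<close> applies.\<close>

lemma density:
  assumes "finite S" "S \<subseteq> W" "u \<in> W" "\<And>T. T \<in> ops \<Longrightarrow> (\<And>x. x \<in> S \<Longrightarrow> T x = 0) \<Longrightarrow> T u = 0"
  shows "u \<in> span S"
  using assms
proof (induction S arbitrary: u rule: finite_induct)
  case empty
  then show ?case using ops_id by auto
next
  case (insert x S)
  have xW: "x \<in> W" using insert.prems(1) by simp
  show ?case
  proof (cases "\<exists>T\<in>ops. (\<forall>y\<in>S. T y = 0) \<and> T x \<noteq> 0")
    case False
    have "u \<in> span S"
    proof (rule insert.IH)
      show "T u = 0" if T: "T \<in> ops" "\<And>y. y \<in> S \<Longrightarrow> T y = 0" for T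
      proof (rule insert.prems(3)[OF T(1)])
        show "T y = 0" if "y \<in> insert x S" for y using that T False by auto
      qed
    qed (use insert.prems in auto)
    then show ?thesis using span_mono[of S "insert x S"] by blast
  next
    case True
    then obtain T0 where T0: "T0 \<in> ops" "\<And>y. y \<in> S \<Longrightarrow> T0 y = 0" "T0 x \<noteq> 0" by blast
    have "\<forall>z\<in>W. \<exists>T. T \<in> ops \<and> (\<forall>y\<in>S. T y = 0) \<and> T x = z"
      using annihilator_orbit[OF T0(1,2) xW T0(3)] by blast
    from bchoice[OF this] obtain J
      where J: "\<And>z. z \<in> W \<Longrightarrow> J z \<in> ops \<and> (\<forall>y\<in>S. J z y = 0) \<and> J z x = z" by blast
    \<comment> \<open>\<open>f\<close> sends \<open>T x\<close> to \<open>T u\<close> for operators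
      \<open>T\<close> killing \<open>S\<close>. It is well defined because an operator killing
      \<open>S\<close> and \<open>x\<close> kills \<open>u\<close>, and it commutes with the action,
      so by Schur's lemma it is a scalar.\<close>
    define f where "f z = J z u" for z
    have f_eq: "f z = T u" if T: "T \<in> ops" "\<forall>y\<in>S. T y = 0" "T x = z" for T z
    proof -
      have "z \<in> W" using T(3) ops_linear(3)[OF T(1) xW] by simp
      note Jz = J[OF this]
      have "(\<lambda>x. T x + (- 1) *\<^sub>v\<^sub>s J z x) \<in> ops" using T Jz by (intro ops_add ops_scale) auto
      moreover have "T y + (- 1) *\<^sub>v\<^sub>s J z y = 0" if "y \<in> insert x S" for y
        using that T Jz by auto
      ultimately have "T u + (- 1) *\<^sub>v\<^sub>s J z u = 0" using insert.prems(3) by blast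
      then show ?thesis by (simp add: f_def)
    qed
    have "\<exists>c. \<forall>x\<in>W. f x = c *\<^sub>v\<^sub>s x"
    proof (rule schur)
      show "f z \<in> W" if "z \<in> W" for z using J[OF that] ops_linear(3) insert.prems(2) by (simp add: f_def)
      show "f (z + z') = f z + f z'" if "z \<in> W" "z' \<in> W" for z z'
        using f_eq[OF ops_add, of "J z" "J z'" "z + z'"] J[OF that(1)] J[OF that(2)] by (simp add: f_def)
      show "f (c *\<^sub>v\<^sub>s z) = c *\<^sub>v\<^sub>s f z" if "z \<in> W" for c z
        using f_eq[OF ops_scale, of "J z" c "c *\<^sub>v\<^sub>s z"] J[OF that] by (simp add: f_def)
      show "f (act a z) = act a (f z)" if "z \<in> W" for a z
        using f_eq[OF ops_act, of "J z" a "act a z"] J[OF that] by (simp add: f_def act_zero)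
    qed
    \<comment> \<open>Every operator killing \<open>S\<close> now kills \<open>u - c x\<close>, so
      the induction hypothesis puts this vector into the span of \<open>S\<close>.\<close>
    then obtain c where c: "\<And>z. z \<in> W \<Longrightarrow> f z = c *\<^sub>v\<^sub>s z" by blast
    have "u - c *\<^sub>v\<^sub>s x \<in> span S"
    proof (rule insert.IH)
      show "S \<subseteq> W" using insert.prems(1) by simp
      show "u - c *\<^sub>v\<^sub>s x \<in> W" using insert.prems(2) xW subspace_W by (intro subspace_diff subspace_scale)
      fix T assume T: "T \<in> ops" "\<And>y. y \<in> S \<Longrightarrow> T y = 0"
      then have "T u = c *\<^sub>v\<^sub>s T x" using f_eq[of T "T x"] c[OF ops_linear(3)[OF T(1) xW]] by simp
      then show "T (u - c *\<^sub>v\<^sub>s x) = 0"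
        using ops_linear(1)[OF T(1), of "u - c *\<^sub>v\<^sub>s x" "c *\<^sub>v\<^sub>s x"] ops_linear(2)[OF T(1), of c x] by simp
    qed
    then show ?thesis by (auto simp: span_insert)
  qed
qed

text \<open>\<open>v q\<close> lies outside the span of the other basis vectors, so by density some
  operator kills these but not \<open>v q\<close>; its value there can be moved to any
  \<open>z\<close>.\<close>

lemma ops_matrix_unit:
  assumes "q < r" "z \<in> W"
  shows "\<exists>T\<in>ops. \<forall>i<r. T (v i) = (if i = q then z else 0)"
proof -
  let ?S = "v ` ({..<r} - {q})"
  have "v q \<notin> span ?S"
  proof
    assume "v q \<in> span ?S"
    moreover have "span ?S \<subseteq> {x \<in> W. vcoord x q = 0}"
      using assms(1) subspace_W
      by (intro span_minimal)
        (auto simp: basis_mem vcoord_basis subspace_def vcoord_zero vcoord_add vcoord_scale)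
    ultimately show False using assms(1) vcoord_basis[of q q] by auto
  qed
  then obtain T where "T \<in> ops" "\<And>x. x \<in> ?S \<Longrightarrow> T x = 0" "T (v q) \<noteq> 0"
    using density[of ?S "v q"] basis_mem assms(1) by fastforce
  from annihilator_orbit[OF this(1,2) basis_mem[OF assms(1)] this(3) assms(2)]
  show ?thesis by fastforce
qed

definition rep :: "'a \<Rightarrow> 'l mat" where
  "rep a = mat r r (\<lambda>(p, q). vcoord (act a (v q)) p)"

lemma act_basis: "q < r \<Longrightarrow> act a (v q) = (\<Sum>p<r. rep a $$ (p, q) *\<^sub>v\<^sub>s v p)"
  by (subst vexpand) (auto simp: rep_def act_closed basis_mem)

lemma mat_rep_rep: "mat_rep rep r"
proof
  show "rep a \<in> carrier_mat r r" for a by (simp add: rep_def)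
  show "rep 1 = 1\<^sub>m r" by (rule eq_matI) (auto simp: rep_def act_one vcoord_basis)
  show "rep (a + a') = rep a + rep a'" for a a'
    by (rule eq_matI) (auto simp: rep_def act_plus basis_mem act_closed vcoord_add)
  show "rep (a * a') = rep a * rep a'" for a a'
  proof (rule eq_matI)
    fix p q assume "p < dim_row (rep a * rep a')" "q < dim_col (rep a * rep a')"
    then have p: "p < r" and q: "q < r" by (auto simp: rep_def)
    have "rep (a * a') $$ (p, q) = vcoord (act a (act a' (v q))) p" using p q by (simp add: rep_def act_mult)
    also have "\<dots> = (\<Sum>k<r. rep a' $$ (k, q) * vcoord (act a (v k)) p)"
      using p unfolding act_basis[OF q] act_sum act_scale
      by (subst vcoord_sum) (auto simp: vcoord_scale subspace_scale[OF subspace_W] act_closed basis_mem)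
    also have "\<dots> = (\<Sum>k<r. rep a $$ (p, k) * rep a' $$ (k, q))"
      using p by (intro sum.cong) (auto simp: rep_def mult.commute)
    also have "\<dots> = (rep a * rep a') $$ (p, q)"
      using p q by (subst index_mult_mat_sum[of _ r r _ r]) (auto simp: rep_def)
    finally show "rep (a * a') $$ (p, q) = (rep a * rep a') $$ (p, q)" .
  qed (auto simp: rep_def)
qed

text \<open>\<open>M\<close> is assembled from one operator for each column, and the operators are
  combinations of the action of the \<open>b i\<close>.\<close>

theorem burnside:
  assumes "M \<in> carrier_mat r r"
  shows "\<exists>c. \<forall>p<r. \<forall>q<r. M $$ (p, q) = (\<Sum>i<m. c i * rep (b i) $$ (p, q))"
proof -
  define z where "z q = (\<Sum>p<r. M $$ (p, q) *\<^sub>v\<^sub>s v p)" for q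
  have z: "z q \<in> W" for q unfolding z_def by (intro subspace_sum subspace_W subspace_scale basis_mem) auto
  have "\<forall>q\<in>{..<r}. \<exists>T. T \<in> ops \<and> (\<forall>i<r. T (v i) = (if i = q then z q else 0))"
    using ops_matrix_unit[OF _ z] by blast
  from bchoice[OF this] obtain T where T: "\<And>q. q < r \<Longrightarrow> T q \<in> ops"
      "\<And>q i. q < r \<Longrightarrow> i < r \<Longrightarrow> T q (v i) = (if i = q then z q else 0)"
    by blast
  have "(\<lambda>x. \<Sum>q<r. T q x) \<in> ops" using T(1) by (intro ops_sum) auto
  then obtain c where c: "\<And>x. x \<in> W \<Longrightarrow> (\<Sum>q<r. T q x) = (\<Sum>i<m. c i *\<^sub>v\<^sub>s act (b i) x)"
    using ops_expand by blast
  have "M $$ (p, q) = (\<Sum>i<m. c i * rep (b i) $$ (p, q))" if p: "p < r" and q: "q < r" for p q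
  proof -
    have "(\<Sum>i<m. c i *\<^sub>v\<^sub>s act (b i) (v q)) = z q"
      using c[OF basis_mem[OF q]] T(2)[OF _ q] q by simp
    moreover have "vcoord (z q) p = M $$ (p, q)" using p by (intro vcoord_eqI) (auto simp: z_def)
    moreover have "vcoord (\<Sum>i<m. c i *\<^sub>v\<^sub>s act (b i) (v q)) p = (\<Sum>i<m. c i * rep (b i) $$ (p, q))"
      using p q by (simp add: vcoord_sum vcoord_scale subspace_scale[OF subspace_W] act_closed basis_mem rep_def)
    ultimately show ?thesis by simp
  qed
  then show ?thesis by blast
qed

end

section \<open>A splitting from a minimal submodule of the F-linear maps\<close>

lemma sum_fun_eval: "(\<Sum>i\<in>I. g i) x = (\<Sum>i\<in>I. g i x)" for g :: "'i \<Rightarrow> 'a \<Rightarrow> 'l::ab_group_add"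
  by (induction I rule: infinite_finite_induct) auto

text \<open>A relation among the \<open>\<phi> (b i)\<close> over L is rewritten over an
  F-independent family \<open>l\<close>; collecting the terms at each \<open>l t\<close> gives
  elements \<open>a t\<close> of A, which must vanish.\<close>

lemma division_rep_coeff_indep:
  fixes s :: "'f::field \<Rightarrow> 'a::division_ring" and \<phi> :: "'a \<Rightarrow> 'l::field mat"
  assumes s: "algebra_map s" and center: "{z. \<forall>x. z * x = x * z} = range s"
    and h: "comm_ring_hom h" and rep: "mat_rep \<phi> d" and d: "0 < d"
    and ground: "\<And>c. \<phi> (s c) = h c \<cdot>\<^sub>m 1\<^sub>m d"
    and b: "right_basis s m b"
    and vanish: "\<And>p q. p < d \<Longrightarrow> q < d \<Longrightarrow> (\<Sum>i<m. c i * \<phi> (b i) $$ (p, q)) = 0"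
    and i: "i < m"
  shows "c i = 0"
proof -
  interpret right_basis s m b by fact
  interpret mat_rep \<phi> d by fact
  interpret h: comm_ring_hom h by fact
  obtain k l f where l: "indep_over h l k" and f: "\<And>i. i < m \<Longrightarrow> c i = (\<Sum>j<k. h (f i j) * l j)"
    using indep_over_expansion[OF h, of m c] by blast
  define a where "a t = (\<Sum>i<m. b i * s (f i t))" for t
  have "(\<Sum>t<k. \<phi> (a t) $$ (p, q) * l t) = 0" if pq: "p < d" "q < d" for p q
  proof -
    have "\<phi> (a t) $$ (p, q) = (\<Sum>i<m. \<phi> (b i) $$ (p, q) * h (f i t))" for t
      using pq unfolding a_def
      by (simp add: sum_index mult_index ground if_distrib[of "\<lambda>x. _ * x"] cong: if_cong)
    then have "(\<Sum>t<k. \<phi> (a t) $$ (p, q) * l t) = (\<Sum>t<k. \<Sum>i<m. \<phi> (b i) $$ (p, q) * h (f i t) * l t)"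
      by (simp add: sum_distrib_right)
    also have "\<dots> = (\<Sum>i<m. c i * \<phi> (b i) $$ (p, q))"
      by (subst sum.swap) (simp add: f sum_distrib_left sum_distrib_right mult_ac)
    finally show ?thesis using vanish pq by simp
  qed
  from division_rep_indep[OF s center h rep d ground l this]
  have "a t = 0" if "t < k" for t using that by blast
  then have "f i t = 0" if "t < k" for t
    using that indep[of "\<lambda>i. f i t"] i unfolding a_def by blast
  then show ?thesis using f[OF i] by simp
qed

text \<open>Burnside's theorem supplies the coefficients of a given matrix, and
  \<open>division_rep_coeff_indep\<close> makes them unique.\<close>

theorem exists_split_algebra:
  fixes s :: "'f::field \<Rightarrow> 'a::division_ring" and h :: "'f \<Rightarrow> 'l::alg_closed_field"
  assumes s: "algebra_map s" and center: "{z. \<forall>x. z * x = x * z} = range s"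
    and h: "comm_ring_hom h" and b: "right_basis s m b"
  shows "\<exists>d \<phi>. split_algebra s m b \<phi> d h"
proof -
  interpret B: right_basis s m b by fact
  interpret h: comm_ring_hom h by fact
  let ?sc = "\<lambda>c (f :: 'a \<Rightarrow> 'l) x. c * f x"
  interpret V: Vector_Spaces.vector_space ?sc
    by unfold_locales (auto simp: fun_eq_iff algebra_simps)
  \<comment> \<open>\<open>V0\<close> is the space of F-linear maps from A to L, made a left
    A-module by \<open>(a f)(x) = f (x a)\<close>. The dual basis shows that it has finite
    dimension.\<close>
  define V0 where "V0 = {f :: 'a \<Rightarrow> 'l. (\<forall>x y. f (x + y) = f x + f y) \<and> (\<forall>x c. f (x * s c) = f x * h c)}"
  define act where "act a f = (\<lambda>x. f (x * a))" for a :: 'a and f :: "'a \<Rightarrow> 'l"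
  define dual where "dual i x = h (B.coord x i)" for i x
  note comm = algebra_map_commute[OF s]
  have V0_sum: "f (\<Sum>i\<in>I. g i) = (\<Sum>i\<in>I. f (g i))" if "f \<in> V0" for f g and I :: "nat set"
  proof -
    have "f (0 + 0) = f 0 + f 0" using that unfolding V0_def by blast
    then have "f 0 = 0" by (metis add_cancel_right_right add_0)
    then show ?thesis using that by (induction I rule: infinite_finite_induct) (auto simp: V0_def)
  qed
  have V0_mult: "f (x * s c) = f x * h c" if "f \<in> V0" for f x c using that by (simp add: V0_def)
  have V0_expand: "f x = (\<Sum>i<m. f (b i) * dual i x)" if "f \<in> V0" for f x
    by (subst B.expand[of x]) (simp add: V0_sum[OF that] V0_mult[OF that] dual_def)
  have V0_sub: "V.subspace V0"
    by (rule V.subspaceI) (auto simp: V0_def algebra_simps)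
  have V0_act: "act a f \<in> V0" if "f \<in> V0" for a f
    using that unfolding V0_def act_def
    by (simp add: distrib_right) (metis comm mult.assoc)
  have dual_mem: "dual i \<in> V0" if "i < m" for i
    using that by (auto simp: V0_def dual_def B.coord_add B.coord_mult_right h.hom_add h.hom_mult)
  have m: "0 < m"
  proof (rule gr0I)
    assume "m = 0"
    then show False using B.expand[of 1] by simp
  qed
  have "dual 0 (b 0) = 1" using m by (simp add: dual_def B.coord_basis)
  then have dual0: "dual 0 \<noteq> 0" by (metis zero_fun_apply zero_neq_one)
  have V0_span: "V0 \<subseteq> V.span (dual ` {..<m})"
  proof
    fix f assume f: "f \<in> V0"
    have "f = (\<Sum>i<m. ?sc (f (b i)) (dual i))"
      by (rule ext) (subst V0_expand[OF f], simp add: sum_fun_eval)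
    moreover have "(\<Sum>i<m. ?sc (f (b i)) (dual i)) \<in> V.span (dual ` {..<m})"
      by (intro V.span_sum V.span_scale V.span_base) auto
    ultimately show "f \<in> V.span (dual ` {..<m})" by metis
  qed
  \<comment> \<open>A nonzero invariant subspace of least dimension is irreducible: a basis of a
    nonzero invariant subspace inside it is already a basis of the whole.\<close>
  define good where "good W \<longleftrightarrow> V.subspace W \<and> W \<subseteq> V0 \<and> W \<noteq> {0} \<and> (\<forall>a. \<forall>x\<in>W. act a x \<in> W)" for W
  have "good V0" using V0_sub V0_act dual_mem[OF m] dual0 by (auto simp: good_def)
  then obtain W where W: "good W" and least: "\<And>U. good U \<Longrightarrow> V.dim W \<le> V.dim U"
    using ex_has_least_nat[of good V0 V.dim] by blast
  have W0: "W \<subseteq> V0" and W_sub: "V.subspace W" using W by (auto simp: good_def)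
  have fin: "finite S" if "V.independent S" "S \<subseteq> W" for S
    using V.independent_span_bound[of "dual ` {..<m}" S] that W0 V0_span by blast
  have irred: "U = W" if U: "good U" and sub: "U \<subseteq> W" for U
  proof -
    obtain B where B: "B \<subseteq> U" "V.independent B" "U \<subseteq> V.span B" "card B = V.dim U"
      using V.basis_exists by blast
    obtain B' where B': "B \<subseteq> B'" "B' \<subseteq> W" "V.independent B'" "W \<subseteq> V.span B'"
      using V.maximal_independent_subset_extend[of B W] B sub by blast
    have "card B' = V.dim W" using B' V.basis_card_eq_dim by blast
    then have "B = B'" using card_seteq[OF fin[OF B'(3,2)] B'(1)] B(4) least[OF U] by simp
    moreover have "V.span B \<subseteq> U" using B(1) U by (intro V.span_minimal) (auto simp: good_def)
    ultimately show ?thesis using B'(4) sub by blast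
  qed
  obtain B where Bs: "B \<subseteq> W" "V.independent B" "W \<subseteq> V.span B" and "card B = V.dim W"
    by (rule V.basis_exists[of W])
  have finB: "finite B" using fin Bs by blast
  obtain v where v: "bij_betw v {0..<card B} B" using ex_bij_betw_nat_finite[OF finB] by blast
  define r where "r = card B"
  have v': "bij_betw v {..<r} B" using v by (simp add: r_def atLeast0LessThan)
  have re: "(\<Sum>x\<in>B. ?sc (u x) x) = (\<Sum>q<r. ?sc (u (v q)) (v q))" for u
    by (rule sum.reindex_bij_betw[OF v', symmetric])
  have r: "0 < r"
  proof (rule gr0I)
    assume "r = 0"
    then have "B = {}" using finB by (simp add: r_def)
    then show False using Bs(3) W V.subspace_0[OF W_sub] by (auto simp: good_def)
  qed
  interpret I: irreducible_rep ?sc act W v r m b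
  proof
    show "V.subspace W" by fact
    show "act a (x + y) = act a x + act a y" for a x y by (auto simp: act_def)
    show "act a (?sc c x) = ?sc c (act a x)" for a c x by (simp add: act_def)
    show "act (a + a') x = act a x + act a' x" if "x \<in> W" for a a' x
      using that W0 by (auto simp: act_def V0_def fun_eq_iff distrib_left)
    show "act 1 x = x" for x by (simp add: act_def)
    show "act (a * a') x = act a (act a' x)" for a a' x by (simp add: act_def mult.assoc)
    show "act a x \<in> W" if "x \<in> W" for a x using that W by (simp add: good_def)
    show "\<exists>c. \<forall>x\<in>W. act a x = (\<Sum>i<m. ?sc (c i) (act (b i) x))" for a
    proof (intro exI ballI ext)
      fix f y assume "f \<in> W"
      then have f: "f \<in> V0" using W0 by blast
      have "y * a = (\<Sum>i<m. (y * b i) * s (B.coord a i))"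
        by (subst B.expand[of a]) (simp add: sum_distrib_left mult.assoc)
      then have "f (y * a) = (\<Sum>i<m. f (y * b i) * h (B.coord a i))"
        by (simp add: V0_sum[OF f] V0_mult[OF f])
      then show "act a f y = (\<Sum>i<m. ?sc (h (B.coord a i)) (act (b i) f)) y"
        by (simp add: act_def sum_fun_eval mult.commute)
    qed
    show "U = W" if "V.subspace U" "U \<subseteq> W" "\<And>a x. x \<in> U \<Longrightarrow> act a x \<in> U" "U \<noteq> {0}" for U
      using that W0 by (intro irred) (auto simp: good_def)
    show "v q \<in> W" if "q < r" for q using that v' Bs(1) by (auto simp: bij_betw_def)
    show "\<exists>c. x = (\<Sum>q<r. ?sc (c q) (v q))" if "x \<in> W" for x
    proof -
      have "x \<in> range (\<lambda>u. \<Sum>x\<in>B. ?sc (u x) x)" using that Bs(3) V.span_finite[OF finB] by blast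
      then obtain u where "x = (\<Sum>q<r. ?sc (u (v q)) (v q))" unfolding re by blast
      then show ?thesis by (rule exI[of _ "\<lambda>q. u (v q)"])
    qed
    show "c q = 0" if "(\<Sum>q<r. ?sc (c q) (v q)) = 0" "q < r" for c q
    proof -
      define u where "u = c \<circ> the_inv_into {..<r} v"
      have uv: "u (v q) = c q" if "q < r" for q
        using v' that by (simp add: u_def bij_betw_def the_inv_into_f_f)
      have "(\<Sum>x\<in>B. ?sc (u x) x) = 0" using that(1) uv by (simp add: re)
      then have "\<forall>x\<in>B. u x = 0" using Bs(2) V.dependent_finite[OF finB] by blast
      then show ?thesis using uv[OF that(2)] v' that(2) by (auto simp: bij_betw_def)
    qed
    show "0 < r" by fact
  qed
  interpret R: mat_rep I.rep r by (rule I.mat_rep_rep)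
  have ground: "I.rep (s c) = h c \<cdot>\<^sub>m 1\<^sub>m r" for c
  proof (rule eq_matI)
    fix p q assume "p < dim_row (h c \<cdot>\<^sub>m 1\<^sub>m r)" "q < dim_col (h c \<cdot>\<^sub>m 1\<^sub>m r)"
    then have pq: "p < r" "q < r" by auto
    have "act (s c) (v q) = ?sc (h c) (v q)"
      using I.basis_mem[OF pq(2)] W0 by (auto simp: act_def V0_def mult.commute)
    then have "I.rep (s c) $$ (p, q) = I.vcoord (?sc (h c) (v q)) p" using pq by (simp add: I.rep_def)
    also have "\<dots> = h c * (if p = q then 1 else 0)"
      using pq by (simp only: I.vcoord_scale[OF I.basis_mem] I.vcoord_basis)
    finally show "I.rep (s c) $$ (p, q) = (h c \<cdot>\<^sub>m 1\<^sub>m r) $$ (p, q)" using pq by simp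
  qed (auto simp: I.rep_def)
  have bij: "\<exists>!u. u \<in> carrier_vec m \<and>
       (\<forall>p<r. \<forall>q<r. M $$ (p, q) = (\<Sum>i<m. vec_index u i * I.rep (b i) $$ (p, q)))"
    if M: "M \<in> carrier_mat r r" for M
  proof -
    obtain c where c: "\<forall>p<r. \<forall>q<r. M $$ (p, q) = (\<Sum>i<m. c i * I.rep (b i) $$ (p, q))"
      using I.burnside[OF M] by blast
    show ?thesis
    proof (rule ex1I[of _ "vec m c"])
      show "vec m c \<in> carrier_vec m \<and>
        (\<forall>p<r. \<forall>q<r. M $$ (p, q) = (\<Sum>i<m. vec_index (vec m c) i * I.rep (b i) $$ (p, q)))"
        using c by simp
      fix u assume u: "u \<in> carrier_vec m \<and>
        (\<forall>p<r. \<forall>q<r. M $$ (p, q) = (\<Sum>i<m. vec_index u i * I.rep (b i) $$ (p, q)))"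
      have "vec_index u i - c i = 0" if "i < m" for i
        by (rule division_rep_coeff_indep[OF s center h I.mat_rep_rep r ground b _ that])
          (use c u in \<open>simp add: left_diff_distrib sum_subtractf\<close>)
      then show "u = vec m c" using u by (intro eq_vecI) auto
    qed
  qed
  note sq = rep_matrix_square_if_basis[of r m I.rep b]
  have "split_algebra s m b I.rep r h"
    using s h ground sq bij by unfold_locales auto
  then show ?thesis by blast
qed

subsection \<open>Tensor products\<close>

context split_algebra
begin

text \<open>Converse to \<open>rep_matrix_square_if_basis\<close>: an invertible
  \<open>rep_matrix\<close> makes the linear system uniquely solvable.\<close>

lemma rep_basis:
  assumes M: "M \<in> carrier_mat d d"
  shows "\<exists>!v. v \<in> carrier_vec m \<and>
       (\<forall>p<d. \<forall>q<d. M $$ (p, q) = (\<Sum>i<m. vec_index v i * \<phi> (b i) $$ (p, q)))"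
proof -
  let ?S = "rep_matrix d \<phi> m b"
  have S: "?S \<in> carrier_mat m m" by (simp add: rep_matrix_def dim_eq)
  obtain T where T: "T \<in> carrier_mat m m" "T * ?S = 1\<^sub>m m" "?S * T = 1\<^sub>m m"
    using det_non_zero_imp_unit[OF S det_rep_matrix, of "()"] by (auto simp: Units_def ring_mat_def)
  define u where "u = vec m (\<lambda>x. M $$ (x div d, x mod d))"
  have u: "u \<in> carrier_vec m" by (simp add: u_def)
  have iff: "(\<forall>p<d. \<forall>q<d. M $$ (p, q) = (\<Sum>i<m. vec_index v i * \<phi> (b i) $$ (p, q))) \<longleftrightarrow> ?S *\<^sub>v v = u"
    if v: "v \<in> carrier_vec m" for v
  proof -
    have Sv: "vec_index (?S *\<^sub>v v) x = (\<Sum>i<m. vec_index v i * \<phi> (b i) $$ (x div d, x mod d))"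
      if "x < m" for x
      using that v by (auto simp: rep_matrix_def scalar_prod_def atLeast0LessThan mult.commute simp flip: dim_eq)
    show ?thesis
    proof
      assume *: "\<forall>p<d. \<forall>q<d. M $$ (p, q) = (\<Sum>i<m. vec_index v i * \<phi> (b i) $$ (p, q))"
      have "vec_index (?S *\<^sub>v v) x = vec_index u x" if "x < m" for x
        using * div_mod_block(1,2)[of x d d] that Sv[OF that] by (simp add: u_def flip: dim_eq)
      then show "?S *\<^sub>v v = u" using S by (intro eq_vecI) (auto simp: u_def)
    next
      assume *: "?S *\<^sub>v v = u"
      show "\<forall>p<d. \<forall>q<d. M $$ (p, q) = (\<Sum>i<m. vec_index v i * \<phi> (b i) $$ (p, q))"
      proof (intro allI impI)
        fix p q assume pq: "p < d" "q < d"
        then have x: "p * d + q < m" using block_index_less[OF pq] by (simp add: dim_eq)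
        show "M $$ (p, q) = (\<Sum>i<m. vec_index v i * \<phi> (b i) $$ (p, q))"
          using Sv[OF x] x pq by (simp add: * u_def)
      qed
    qed
  qed
  show ?thesis
  proof (rule ex1I[of _ "T *\<^sub>v u"])
    have "?S *\<^sub>v (T *\<^sub>v u) = u" using T S u assoc_mult_mat_vec[OF S T(1) u] by simp
    moreover have Tu: "T *\<^sub>v u \<in> carrier_vec m" by (rule mult_mat_vec_carrier[OF T(1) u])
    ultimately show "T *\<^sub>v u \<in> carrier_vec m \<and>
       (\<forall>p<d. \<forall>q<d. M $$ (p, q) = (\<Sum>i<m. vec_index (T *\<^sub>v u) i * \<phi> (b i) $$ (p, q)))"
      using iff[OF Tu] by blast
    fix v assume v: "v \<in> carrier_vec m \<and>
       (\<forall>p<d. \<forall>q<d. M $$ (p, q) = (\<Sum>i<m. vec_index v i * \<phi> (b i) $$ (p, q)))"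
    then have "?S *\<^sub>v v = u" using iff by blast
    then show "v = T *\<^sub>v u" using v T S assoc_mult_mat_vec[OF T(1) S, of v] by simp
  qed
qed

end

lemma splitting_of_split_algebra:
  assumes "split_algebra s m b \<phi> d to_ac"
  shows "splitting s d \<phi>"
proof -
  interpret split_algebra s m b \<phi> d to_ac by fact
  have basis: "algebra_basis s m b"
    using algebra_basis_iff_right_basis[OF central] right_basis_axioms by blast
  have "\<exists>m b. algebra_basis s m b \<and> (\<forall>M \<in> carrier_mat d d. \<exists>!v. v \<in> carrier_vec m \<and>
           (\<forall>p<d. \<forall>q<d. M $$ (p, q) = (\<Sum>i<m. vec_index v i * \<phi> (b i) $$ (p, q))))"
    by (intro exI[of _ m] exI[of _ b] conjI ballI basis rep_basis)
  then show ?thesis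
    unfolding splitting_def
    by (intro conjI allI) (simp_all add: carrier one add mult ground)
qed

section \<open>Maps out of the tensor product and its two bases\<close>

definition frag_eval :: "('p \<Rightarrow> 'r::ring_1) \<Rightarrow> ('p \<Rightarrow>\<^sub>0 int) \<Rightarrow> 'r" where
  "frag_eval g u = (\<Sum>p \<in> Poly_Mapping.keys u. of_int (Poly_Mapping.lookup u p) * g p)"

lemma frag_eval_superset:
  assumes "finite S" "Poly_Mapping.keys u \<subseteq> S"
  shows "frag_eval g u = (\<Sum>p \<in> S. of_int (Poly_Mapping.lookup u p) * g p)"
  unfolding frag_eval_def by (rule sum.mono_neutral_left) (use assms in \<open>auto simp: in_keys_iff\<close>)

lemma frag_eval_diff: "frag_eval g (u - v) = frag_eval g u - frag_eval g v"
proof -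
  let ?S = "Poly_Mapping.keys u \<union> Poly_Mapping.keys v"
  have "finite ?S" "Poly_Mapping.keys (u - v) \<subseteq> ?S" by (auto simp: in_keys_iff lookup_minus)
  then show ?thesis
    by (simp add: frag_eval_superset[of ?S] lookup_minus left_diff_distrib sum_subtractf)
qed

lemma frag_eval_0 [simp]: "frag_eval g 0 = 0"
  by (simp add: frag_eval_def)

lemma frag_eval_add: "frag_eval g (u + v) = frag_eval g u + frag_eval g v"
  using frag_eval_diff[of g "u + v" v] by simp

lemma frag_eval_of [simp]: "frag_eval g (frag_of p) = g p"
  by (simp add: frag_eval_def keys_frag_of)

lemma frag_eval_sum: "frag_eval g (\<Sum>i\<in>I. u i) = (\<Sum>i\<in>I. frag_eval g (u i))"
  by (induction I rule: infinite_finite_induct) (auto simp: frag_eval_add)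

lemma tensor_eval_eq: "tensor_eval jA jK = frag_eval (\<lambda>p. jA (fst p) * jK (snd p))"
  by (simp add: fun_eq_iff tensor_eval_def frag_eval_def)

lemma frag_eval_relators:
  assumes "u \<in> tensor_relators sA sK"
    and "\<And>a b x. g (a + b, x) = g (a, x) + g (b, x)"
    and "\<And>a x y. g (a, x + y) = g (a, x) + g (a, y)"
    and "\<And>a c x. g (a * sA c, x) = g (a, sK c * x)"
  shows "frag_eval g u = 0"
  using assms(1) by induction (auto simp: frag_eval_diff assms(2-4))

locale algebra_tensor_product =
  fixes sA :: "'f::field \<Rightarrow> 'a::ring_1" and sK :: "'f \<Rightarrow> 'k::field"
    and jA :: "'a \<Rightarrow> 'b::ring_1" and jK :: "'k \<Rightarrow> 'b"
    and m :: nat and b :: "nat \<Rightarrow> 'a" and n :: nat and w :: "nat \<Rightarrow> 'k"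
  assumes algA: "algebra_map sA" and algK: "algebra_map sK"
    and tensor: "is_tensor_product sA sK jA jK"
    and basis_A: "right_basis sA m b" and basis_K: "right_basis sK n w"
begin

sublocale A: right_basis_comm sA m b
  using basis_A by (simp add: right_basis_comm_def)
sublocale K: right_basis_comm sK n w
  using basis_K by (simp add: right_basis_comm_def)
sublocale jA: Ring_Hom.ring_hom jA using tensor by (simp add: is_tensor_product_def)
sublocale jK: Ring_Hom.ring_hom jK using tensor by (simp add: is_tensor_product_def)

lemma jA_jK_commute: "jA a * jK x = jK x * jA a"
  using tensor unfolding is_tensor_product_def by blast

lemma relator_eval: "u \<in> tensor_relators sA sK \<longleftrightarrow> tensor_eval jA jK u = 0"
  using tensor unfolding is_tensor_product_def by blast

text \<open>The balancing relation at the pure tensor 1 \<otimes> 1.\<close>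

lemma jA_sA: "jA (sA c) = jK (sK c)"
  using relator_eval[of "frag_of (1 * sA c, 1) - frag_of (1, sK c * 1)"] tensor_relators.balanced[of 1 sA c 1 sK]
  by (simp add: tensor_eval_eq frag_eval_diff)

text \<open>The universal property in the form needed: a sum that vanishes in the tensor product is
  a relator, and a balanced biadditive \<open>g\<close> kills relators.\<close>

lemma tensor_relation:
  fixes g :: "'a \<times> 'k \<Rightarrow> 'r::ring_1"
  assumes "\<And>a b x. g (a + b, x) = g (a, x) + g (b, x)"
    and "\<And>a x y. g (a, x + y) = g (a, x) + g (a, y)"
    and "\<And>a c x. g (a * sA c, x) = g (a, sK c * x)"
    and "(\<Sum>i\<in>I. jA (u i) * jK (v i)) = 0"
  shows "(\<Sum>i\<in>I. g (u i, v i)) = 0"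
proof -
  have "(\<Sum>i\<in>I. frag_of (u i, v i)) \<in> tensor_relators sA sK"
    using assms(4) by (simp add: relator_eval tensor_eval_eq frag_eval_sum)
  from frag_eval_relators[of _ _ _ g, OF this assms(1-3)] show ?thesis by (simp add: frag_eval_sum)
qed

lemma tensor_induct:
  assumes "\<And>a x. Q (jA a * jK x)" "\<And>y z. Q y \<Longrightarrow> Q z \<Longrightarrow> Q (y + z)"
  shows "Q y"
proof -
  obtain u where y: "y = tensor_eval jA jK u"
    using tensor unfolding is_tensor_product_def by (metis surjD)
  have "Q 0" using assms(1)[of 0 0] by simp
  \<comment> \<open>An integer multiple of a pure tensor is again pure, as the integer can be
    absorbed into the left factor.\<close>
  moreover have "Q (of_int k * (jA a * jK x))" for k a x
  proof -
    have "of_int k * (jA a * jK x) = jA (of_int k * a) * jK x"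
      by (simp add: jA.hom_mult jA.hom_of_int mult.assoc)
    then show ?thesis using assms(1) by metis
  qed
  ultimately have "Q (\<Sum>p\<in>S. of_int (Poly_Mapping.lookup u p) * (jA (fst p) * jK (snd p)))" for S
    by (induction S rule: infinite_finite_induct) (auto intro: assms(2))
  then show ?thesis by (simp add: y tensor_eval_def)
qed

lemma right_basis_over_A: "right_basis jA n (\<lambda>i. jK (w i))"
proof (rule right_basis.intro)
  show "Ring_Hom.ring_hom jA" by unfold_locales
next
  fix y show "\<exists>c. y = (\<Sum>k<n. jK (w k) * jA (c k))"
  proof (induction y rule: tensor_induct)
    case (1 a x)
    have "jK x = (\<Sum>k<n. jK (w k) * jA (sA (K.coord x k)))"
      by (subst K.expand[of x]) (simp add: jK.hom_sum jK.hom_mult jA_sA)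
    then have "jA a * jK x = (\<Sum>k<n. jK (w k) * jA (a * sA (K.coord x k)))"
      by (simp add: sum_distrib_left jA.hom_mult mult.assoc[symmetric] jA_jK_commute)
    then show ?case by (rule exI[of _ "\<lambda>k. a * sA (K.coord x k)"])
  next
    case (2 y z)
    then obtain c c' where "y = (\<Sum>k<n. jK (w k) * jA (c k))" "z = (\<Sum>k<n. jK (w k) * jA (c' k))" by blast
    then have "y + z = (\<Sum>k<n. jK (w k) * jA (c k + c' k))"
      by (simp add: jA.hom_add distrib_left sum.distrib)
    then show ?case by (rule exI[of _ "\<lambda>k. c k + c' k"])
  qed
next
  fix c l assume c: "(\<Sum>k<n. jK (w k) * jA (c k)) = 0" and l: "l < n"
  \<comment> \<open>The balanced map that multiplies \<open>a\<close> by the \<open>l\<close>-th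
    coordinate of \<open>x\<close> reads off the coefficient \<open>c l\<close>.\<close>
  have "(\<Sum>k<n. (\<lambda>(a, x). a * sA (K.coord x l)) (c k, w k)) = 0"
  proof (rule tensor_relation)
    show "(\<Sum>k<n. jA (c k) * jK (w k)) = 0" using c by (simp add: jA_jK_commute)
    have "K.coord (sK e * x) l = e * K.coord x l" for e x
      using K.coord_mult_right[OF l, of x e] by (simp add: mult.commute)
    then show "(\<lambda>(a, x). a * sA (K.coord x l)) (a * sA e, x) = (\<lambda>(a, x). a * sA (K.coord x l)) (a, sK e * x)" for a e x
      by (simp add: A.j.hom_mult mult.assoc)
  qed (use l in \<open>simp_all add: distrib_left distrib_right K.coord_add A.j.hom_add\<close>)
  then show "c l = 0"
    using l by (simp add: K.coord_basis if_distrib[of sA] if_distrib[of "\<lambda>x. _ * x"] cong: if_cong)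
qed

lemma algebra_map_jK: "algebra_map jK"
  unfolding algebra_map_def
proof (intro conjI allI)
  show "Ring_Hom.ring_hom jK" by unfold_locales
  fix c y show "jK c * y = y * jK c"
  proof (induction y rule: tensor_induct)
    case (1 a x)
    have "jK c * (jA a * jK x) = jA a * (jK c * jK x)" by (metis jA_jK_commute mult.assoc)
    also have "jK c * jK x = jK x * jK c" by (simp add: jK.hom_mult[symmetric] mult.commute)
    finally show ?case by (simp add: mult.assoc)
  qed (simp add: distrib_left distrib_right)
qed

lemma right_basis_over_K: "right_basis jK m (\<lambda>i. jA (b i))"
proof (rule right_basis.intro)
  show "Ring_Hom.ring_hom jK" by unfold_locales
next
  fix y show "\<exists>c. y = (\<Sum>k<m. jA (b k) * jK (c k))"
  proof (induction y rule: tensor_induct)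
    case (1 a x)
    have "jA a = (\<Sum>k<m. jA (b k) * jK (sK (A.coord a k)))"
      by (subst A.expand[of a]) (simp add: jA.hom_sum jA.hom_mult jA_sA)
    then have "jA a * jK x = (\<Sum>k<m. jA (b k) * jK (sK (A.coord a k) * x))"
      by (simp add: sum_distrib_right jK.hom_mult mult.assoc)
    then show ?case by (rule exI[of _ "\<lambda>k. sK (A.coord a k) * x"])
  next
    case (2 y z)
    then obtain c c' where "y = (\<Sum>k<m. jA (b k) * jK (c k))" "z = (\<Sum>k<m. jA (b k) * jK (c' k))" by blast
    then have "y + z = (\<Sum>k<m. jA (b k) * jK (c k + c' k))"
      by (simp add: jK.hom_add distrib_left sum.distrib)
    then show ?case by (rule exI[of _ "\<lambda>k. c k + c' k"])
  qed
next
  fix c l assume c: "(\<Sum>k<m. jA (b k) * jK (c k)) = 0" and l: "l < m"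
  have "(\<Sum>k<m. (\<lambda>(a, x). sK (A.coord a l) * x) (b k, c k)) = 0"
    by (rule tensor_relation[OF _ _ _ c])
      (use l in \<open>simp_all add: distrib_left distrib_right A.coord_add K.j.hom_add K.j.hom_mult A.coord_mult_right mult.assoc\<close>)
  then show "c l = 0"
    using l by (simp add: A.coord_basis if_distrib[of sK] if_distrib[of "\<lambda>x. x * _"] cong: if_cong)
qed

sublocale BA: right_basis jA n "\<lambda>i. jK (w i)" by (rule right_basis_over_A)
sublocale BK: right_basis_comm jK m "\<lambda>i. jA (b i)"
  using right_basis_over_K by (simp add: right_basis_comm_def)

text \<open>Both sides are the F-coefficient at \<open>b i \<otimes> w k\<close> of \<open>y\<close>
  times \<open>b j \<otimes> w l\<close>, computed once through K and once through A.\<close>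

lemma lmat_swap:
  assumes "i < m" "j < m" "k < n" "l < n"
  shows "K.lmat (BK.lmat y $$ (i, j)) $$ (k, l) = A.lmat (BA.lmat y $$ (k, l)) $$ (i, j)"
proof -
  have "y * jA (b j) = (\<Sum>i<m. jA (b i) * jK (BK.lmat y $$ (i, j)))"
    using assms by (subst BK.expand) (simp add: BK.lmat_index)
  then have "y * jA (b j) * jK (w l) = (\<Sum>i<m. jA (b i) * jK (BK.lmat y $$ (i, j) * w l))"
    by (simp add: sum_distrib_right jK.hom_mult mult.assoc)
  also have "\<dots> = (\<Sum>i<m. jA (b i) * (\<Sum>k<n. jK (w k) * jA (sA (K.lmat (BK.lmat y $$ (i, j)) $$ (k, l)))))"
  proof (intro sum.cong refl arg_cong2[of _ _ _ _ "(*)"])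
    fix i
    show "jK (BK.lmat y $$ (i, j) * w l) = (\<Sum>k<n. jK (w k) * jA (sA (K.lmat (BK.lmat y $$ (i, j)) $$ (k, l))))"
      using assms by (subst K.expand) (simp add: jK.hom_sum jK.hom_mult jA_sA K.lmat_index)
  qed
  also have "\<dots> = (\<Sum>i<m. \<Sum>k<n. jK (w k) * jA (b i * sA (K.lmat (BK.lmat y $$ (i, j)) $$ (k, l))))"
    by (simp add: sum_distrib_left jA.hom_mult mult.assoc[symmetric] jA_jK_commute)
  also have "\<dots> = (\<Sum>k<n. jK (w k) * jA (\<Sum>i<m. b i * sA (K.lmat (BK.lmat y $$ (i, j)) $$ (k, l))))"
    by (subst sum.swap) (simp add: jA.hom_sum sum_distrib_left)
  finally have "BA.coord (y * jA (b j) * jK (w l)) k = (\<Sum>i<m. b i * sA (K.lmat (BK.lmat y $$ (i, j)) $$ (k, l)))"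
    by (rule BA.coord_eqI) (rule assms(3))
  moreover have "y * jA (b j) * jK (w l) = (y * jK (w l)) * jA (b j)"
    by (simp add: mult.assoc jA_jK_commute)
  ultimately have "BA.lmat y $$ (k, l) * b j = (\<Sum>i<m. b i * sA (K.lmat (BK.lmat y $$ (i, j)) $$ (k, l)))"
    using assms by (simp add: BA.coord_mult_right BA.lmat_index)
  from A.coord_eqI[OF this assms(1)] show ?thesis using assms by (simp add: A.lmat_index)
qed

text \<open>\<psi> sends \<open>a \<otimes> x\<close> to \<open>\<phi> a\<close> times
  \<open>h x\<close>. Defining it by K-coordinates makes it well defined at once; multiplicativity
  is checked on pure tensors, and \<open>rep_matrix\<close> does not change.\<close>

lemma split_algebra_extend:
  assumes "split_algebra sA m b \<phi> d (h \<circ> sK)" and h: "comm_ring_hom h"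
  shows "\<exists>\<psi>. split_algebra jK m (\<lambda>i. jA (b i)) \<psi> d h"
proof -
  interpret S: split_algebra sA m b \<phi> d "h \<circ> sK" by fact
  interpret h: comm_ring_hom h by fact
  define \<psi> where "\<psi> y = mat d d (\<lambda>(p, q). \<Sum>i<m. \<phi> (b i) $$ (p, q) * h (BK.coord y i))" for y
  have c: "\<psi> y \<in> carrier_mat d d" for y by (simp add: \<psi>_def)
  have add: "\<psi> (y + z) $$ (p, q) = \<psi> y $$ (p, q) + \<psi> z $$ (p, q)" if "p < d" "q < d" for y z p q
    using that by (simp add: \<psi>_def BK.coord_add h.hom_add distrib_left sum.distrib)
  have pure: "\<psi> (jA a * jK x) $$ (p, q) = \<phi> a $$ (p, q) * h x" if pq: "p < d" "q < d" for a x p q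
  proof -
    have co: "BK.coord (jA a) i = sK (A.coord a i)" if "i < m" for i
      by (rule BK.coord_eqI[OF _ that]) (subst A.expand[of a], simp add: jA.hom_sum jA.hom_mult jA_sA)
    have "\<psi> (jA a * jK x) $$ (p, q) = (\<Sum>i<m. \<phi> (b i) $$ (p, q) * h (sK (A.coord a i)) * h x)"
      using pq by (simp add: \<psi>_def BK.coord_mult_right co h.hom_mult mult.assoc)
    also have "\<dots> = \<phi> a $$ (p, q) * h x"
      using S.rep_index[OF pq, of a] by (simp add: sum_distrib_right)
    finally show ?thesis .
  qed
  have mult: "\<psi> (y * z) $$ (p, q) = (\<Sum>k<d. \<psi> y $$ (p, k) * \<psi> z $$ (k, q))" if pq: "p < d" "q < d" for y z p q
  proof (induction y rule: tensor_induct)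
    case (1 a x)
    show ?case
    proof (induction z rule: tensor_induct)
      case (1 a' x')
      have "jA a * jK x * (jA a' * jK x') = jA a * (jK x * jA a') * jK x'" by (simp add: mult.assoc)
      also have "\<dots> = jA (a * a') * jK (x * x')"
        by (simp only: jA_jK_commute[symmetric] jA.hom_mult jK.hom_mult mult.assoc)
      finally show ?case
        using pq by (simp add: pure S.mult_index h.hom_mult sum_distrib_left sum_distrib_right mult_ac)
    next
      case (2 y z)
      then show ?case using pq by (simp add: distrib_left add sum.distrib)
    qed
  next
    case (2 y' z')
    then show ?case using pq by (simp add: distrib_right add sum.distrib)
  qed
  have \<psi>b: "rep_matrix d \<psi> m (\<lambda>i. jA (b i)) = rep_matrix d \<phi> m b"
  proof (rule eq_matI)
    fix x i assume "x < dim_row (rep_matrix d \<phi> m b)" "i < dim_col (rep_matrix d \<phi> m b)"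
    then have "x < d * d" "i < m" by (auto simp: rep_matrix_def)
    then show "rep_matrix d \<psi> m (\<lambda>i. jA (b i)) $$ (x, i) = rep_matrix d \<phi> m b $$ (x, i)"
      using pure[of "x div d" "x mod d" "b i" 1] div_mod_block[of x d d] by (simp add: rep_matrix_def)
  qed (auto simp: rep_matrix_def)
  interpret R: mat_rep \<psi> d
  proof
    show "\<psi> 1 = 1\<^sub>m d"
      using c[of 1] pure[of _ _ 1 1] by (intro eq_matI) (auto simp: S.one)
    show "\<psi> (y + z) = \<psi> y + \<psi> z" for y z
      using c[of "y + z"] c[of y] c[of z] by (intro eq_matI) (auto simp: add)
    show "\<psi> (y * z) = \<psi> y * \<psi> z" for y z
      using c[of "y * z"] c[of y] c[of z]
      by (intro eq_matI) (auto simp: mult index_mult_mat_sum[OF c c] simp del: index_mult_mat(1))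
  qed (rule c)
  have ground: "\<psi> (jK x) = h x \<cdot>\<^sub>m 1\<^sub>m d" for x
    using c[of "jK x"] pure[of _ _ 1 x] by (intro eq_matI) (auto simp: S.one)
  have "split_algebra jK m (\<lambda>i. jA (b i)) \<psi> d h"
    using algebra_map_jK h ground S.dim_eq S.det_rep_matrix \<psi>b by unfold_locales auto
  then show ?thesis by blast
qed

end

subsection \<open>Row reduction over division rings\<close>

text \<open>The sign of the permutation occurs once for the rows and once for the columns.\<close>

lemma det_reindex:
  fixes B :: "'a::comm_ring_1 mat"
  assumes B: "B \<in> carrier_mat N N" and p: "p permutes {0..<N}"
  shows "det (mat N N (\<lambda>(i, j). B $$ (p i, p j))) = det B"
proof -
  have lt: "p i < N" if "i < N" for i using permutes_in_image[OF p, of i] that by simp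
  define C where "C = mat N N (\<lambda>(i, j). B $$ (i, p j))"
  have C: "C \<in> carrier_mat N N" by (simp add: C_def)
  have "mat N N (\<lambda>(i, j). B $$ (p i, p j)) = mat N N (\<lambda>(i, j). C $$ (p i, j))"
    using lt by (intro eq_matI) (auto simp: C_def)
  then have "det (mat N N (\<lambda>(i, j). B $$ (p i, p j))) = signof p * det C"
    using det_permute_rows[OF C p] by simp
  also have "det C = det (transpose_mat C)" using det_transpose[OF C] by simp
  also have "transpose_mat C = mat N N (\<lambda>(i, j). (transpose_mat B) $$ (p i, j))"
    using lt B by (intro eq_matI) (auto simp: C_def)
  also have "det \<dots> = signof p * det (transpose_mat B)"
    using B by (intro det_permute_rows[OF _ p]) simp
  also have "det (transpose_mat B) = det B" by (rule det_transpose[OF B])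
  finally show ?thesis by (simp add: mult.assoc[symmetric] sign_def)
qed

lemma det_swap_block_indices:
  fixes A B :: "'a::comm_ring_1 mat"
  assumes A: "A \<in> carrier_mat (m * n) (m * n)" and B: "B \<in> carrier_mat (n * m) (n * m)"
    and eq: "\<And>i j k l. i < m \<Longrightarrow> j < m \<Longrightarrow> k < n \<Longrightarrow> l < n \<Longrightarrow>
      A $$ (i * n + k, j * n + l) = B $$ (k * m + i, l * m + j)"
  shows "det A = det B"
proof -
  \<comment> \<open>Position \<open>i * n + k\<close> goes to \<open>k * m + i\<close>; outside the
    range \<open>p\<close> is the identity, as \<open>permutes\<close> demands.\<close>
  define p where "p x = (if x < m * n then (x mod n) * m + x div n else x)" for x
  have p_lt: "p x < m * n" if "x < m * n" for x
    using block_index_less[OF div_mod_block(2,1)[OF that]] that by (simp add: p_def mult.commute[of m])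
  have "inj_on p {0..<m * n}"
  proof (rule inj_onI)
    fix x y assume "x \<in> {0..<m * n}" "y \<in> {0..<m * n}" "p x = p y"
    then have x: "x < m * n" and y: "y < m * n" and
      e: "(x mod n) * m + x div n = (y mod n) * m + y div n" by (auto simp: p_def)
    note dx = div_mod_block[OF x] and dy = div_mod_block[OF y]
    have "x mod n = y mod n" using arg_cong[OF e, of "\<lambda>z. z div m"] dx dy by simp
    moreover have "x div n = y div n" using arg_cong[OF e, of "\<lambda>z. z mod m"] dx dy by simp
    ultimately show "x = y" by (metis div_mod_eqI)
  qed
  moreover have "p ` {0..<m * n} \<subseteq> {0..<m * n}" using p_lt by auto
  ultimately have "bij_betw p {0..<m * n} {0..<m * n}"
    by (simp add: bij_betw_def endo_inj_surj)
  then have "p permutes {0..<m * n}" by (rule bij_imp_permutes) (simp add: p_def)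
  then have p: "p permutes {0..<n * m}" by (simp add: mult.commute)
  have "A = mat (n * m) (n * m) (\<lambda>(x, y). B $$ (p x, p y))"
  proof (rule eq_matI)
    fix x y assume "x < dim_row (mat (n * m) (n * m) (\<lambda>(x, y). B $$ (p x, p y)))"
      "y < dim_col (mat (n * m) (n * m) (\<lambda>(x, y). B $$ (p x, p y)))"
    then have x: "x < m * n" and y: "y < m * n" by (simp_all add: mult.commute)
    note dx = div_mod_block[OF x] and dy = div_mod_block[OF y]
    show "A $$ (x, y) = mat (n * m) (n * m) (\<lambda>(x, y). B $$ (p x, p y)) $$ (x, y)"
      using eq[OF dx(1) dy(1) dx(2) dy(2)] x y by (simp add: p_def mult.commute[of n m])
  qed (use A in \<open>auto simp: mult.commute\<close>)
  then show ?thesis using det_reindex[OF B p] by simp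
qed

lemma elementary_group_carrier: "E \<in> elementary_group n \<Longrightarrow> E \<in> carrier_mat n n"
  by (induction rule: elementary_group.induct) (auto intro: mult_carrier_mat[of _ n n])

lemma det_block_map_elementary:
  fixes g :: "'a::division_ring \<Rightarrow> 'r::comm_ring_1 mat"
  assumes "mat_rep g m" "E \<in> elementary_group a"
  shows "det (block_map m g E) = 1"
proof -
  interpret mat_rep g m by fact
  show ?thesis using assms(2)
  proof induction
    case one
    then show ?case by (simp add: block_map_one)
  next
    case (transvection E k l c)
    then show ?case
      by (simp add: det_block_map_mult[of _ a] det_block_map_addrow_mat elementary_group_carrier)
  qed
qed

lemma det_block_map_multrow_mat:
  fixes g :: "'c::ring_1 \<Rightarrow> 'r::idom mat"
  assumes "mat_rep g m" "0 < a"
  shows "det (block_map m g (multrow_mat a (a - 1) c)) = det (g c)"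
proof -
  interpret mat_rep g m by fact
  obtain e where e: "a = Suc e" using assms(2) by (cases a) auto
  let ?C = "mat 1 1 (\<lambda>_. c)"
  have C: "?C \<in> carrier_mat 1 1" by simp
  have "multrow_mat a (a - 1) c = four_block_mat (1\<^sub>m e) (0\<^sub>m e 1) (0\<^sub>m 1 e) ?C"
    by (rule eq_matI) (auto simp: e)
  then have "block_map m g (multrow_mat a (a - 1) c) = four_block_mat (1\<^sub>m (e * m)) (0\<^sub>m (e * m) (1 * m))
      (0\<^sub>m (1 * m) (e * m)) (block_map m g ?C)"
    using C by (simp del: One_nat_def add: block_map_four_block[of _ e _ 1] block_map_zero block_map_one)
  also have "det \<dots> = det (1\<^sub>m (e * m) :: 'r mat) * det (block_map m g ?C)"
    by (rule det_four_block_mat_lower_left_zero[OF one_carrier_mat zero_carrier_mat refl block_map_carrier[OF C]])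
  finally show ?thesis by (simp add: block_map_single)
qed

text \<open>\<open>x \<noteq> 0\<close> is carried through the induction because the step to
  \<open>inverse x\<close> relies on it.\<close>

lemma det_unit_commutator:
  fixes g :: "'a::division_ring \<Rightarrow> 'r::field mat"
  assumes "mat_rep g m" "x \<in> unit_commutators"
  shows "x \<noteq> 0 \<and> det (g x) = 1"
proof -
  interpret mat_rep g m by fact
  have inv: "det (g y) * det (g (inverse y)) = 1" if "y \<noteq> 0" for y
    using det_mult_rep[of y "inverse y"] that by (simp add: one)
  show ?thesis using assms(2)
  proof induction
    case (commutator a b)
    then have "det (g a) * det (g b) * det (g (inverse a)) * det (g (inverse b)) =
      (det (g a) * det (g (inverse a))) * (det (g b) * det (g (inverse b)))" by (simp add: mult_ac)
    with commutator show ?case by (simp add: det_mult_rep inv)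
  next
    case (inv x)
    then show ?case using det_mult_rep[of x "inverse x"] by (simp add: one)
  qed (auto simp: one det_mult_rep)
qed

lemma elementary_group_mult:
  fixes E :: "'a::division_ring mat"
  assumes "E \<in> elementary_group n" "E' \<in> elementary_group n"
  shows "E * E' \<in> elementary_group n"
proof -
  note car = elementary_group_carrier
  show ?thesis using assms(1)
  proof induction
    case one
    then show ?case using assms(2) car[OF assms(2)] by simp
  next
    case (transvection E k l a)
    have "addrow_mat n a k l * E * E' = addrow_mat n a k l * (E * E')"
      by (rule assoc_mult_mat[OF addrow_mat_carrier car[OF transvection(1)] car[OF assms(2)]])
    then show ?case using transvection elementary_group.transvection by metis
  qed
qed

lemma addrow_mat_elementary: "k < n \<Longrightarrow> l < n \<Longrightarrow> k \<noteq> l \<Longrightarrow> addrow_mat n a k l \<in> elementary_group n"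
  using elementary_group.transvection[OF elementary_group.one, of k n l a] by simp

definition reduces :: "nat \<Rightarrow> 'a::division_ring mat \<Rightarrow> 'a mat \<Rightarrow> bool" where
  "reduces n M N \<longleftrightarrow> N \<in> carrier_mat n n \<and> (\<exists>E\<in>elementary_group n. M = E * N)"

text \<open>The inverse transvection is absorbed into the elementary factor
  \<open>E\<close>.\<close>

lemma reduces_addrow:
  assumes "reduces n M N" "k < n" "l < n" "k \<noteq> l"
  shows "reduces n M (addrow a k l N)"
proof -
  from assms(1) obtain E where E: "E \<in> elementary_group n" "M = E * N" and N: "N \<in> carrier_mat n n"
    by (auto simp: reduces_def)
  note car = elementary_group_carrier
  let ?N = "addrow a k l N" and ?F = "addrow_mat n (- a) k l"
  have N': "?N \<in> carrier_mat n n" using N by simp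
  have "?F * ?N = addrow (- a) k l ?N" using addrow_mat[OF N' assms(3)] by simp
  also have "\<dots> = N" using N assms by (intro eq_matI) auto
  finally have "E * N = (E * ?F) * ?N"
    by (subst assoc_mult_mat[OF car[OF E(1)] _ N']) auto
  moreover have "E * ?F \<in> elementary_group n"
    using E(1) addrow_mat_elementary[OF assms(2-4)] by (rule elementary_group_mult)
  ultimately show ?thesis using E(2) N' by (auto simp: reduces_def)
qed

text \<open>Row \<open>l\<close> vanishes to the left of the pivot, so adding multiples of it
  preserves the columns already treated.\<close>

lemma reduces_column_clear:
  fixes N :: "'a::division_ring mat"
  assumes red: "reduces n M N" and l: "l < n" and piv: "N $$ (l, l) \<noteq> 0"
    and row: "\<And>j. j < l \<Longrightarrow> N $$ (l, j) = 0"
  shows "\<exists>N'. reduces n M N' \<and> (\<forall>i<n. i \<noteq> l \<longrightarrow> N' $$ (i, l) = 0) \<and> N' $$ (l, l) = N $$ (l, l) \<and>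
    (\<forall>i<n. \<forall>j<l. N' $$ (i, j) = N $$ (i, j))"
proof -
  have "\<exists>N'. reduces n M N' \<and> (\<forall>i<t. i \<noteq> l \<longrightarrow> N' $$ (i, l) = 0) \<and>
    (\<forall>j<n. N' $$ (l, j) = N $$ (l, j)) \<and> (\<forall>i<n. \<forall>j<l. N' $$ (i, j) = N $$ (i, j))" if "t \<le> n" for t
    using that
  proof (induction t)
    case 0
    show ?case by (rule exI[of _ N]) (simp add: red)
  next
    case (Suc t)
    then obtain N' where N': "reduces n M N'" "\<And>i. i < t \<Longrightarrow> i \<noteq> l \<Longrightarrow> N' $$ (i, l) = 0"
      "\<And>j. j < n \<Longrightarrow> N' $$ (l, j) = N $$ (l, j)" "\<And>i j. i < n \<Longrightarrow> j < l \<Longrightarrow> N' $$ (i, j) = N $$ (i, j)" by auto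
    have car: "N' \<in> carrier_mat n n" using N'(1) by (simp add: reduces_def)
    show ?case
    proof (cases "t = l")
      case True
      then show ?thesis using N' by (intro exI[of _ N']) (auto simp: less_Suc_eq)
    next
      case False
      \<comment> \<open>Row operations multiply from the left, so the inverse of the pivot stands to
        the right of the entry to be cleared.\<close>
      let ?a = "- (N' $$ (t, l) * inverse (N $$ (l, l)))"
      have "reduces n M (addrow ?a t l N')" using N'(1) False l Suc.prems by (intro reduces_addrow) auto
      moreover have "addrow ?a t l N' $$ (t, l) = 0"
        using car l Suc.prems piv N'(3)[OF l] by (simp add: mult.assoc)
      ultimately show ?thesis
        using car l Suc.prems False N'(2-4) row
        by (intro exI[of _ "addrow ?a t l N'"]) (auto simp: less_Suc_eq)
    qed
  qed
  from this[of n] show ?thesis using l by auto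
qed

lemma elementary_diagonal_decomposition:
  fixes M :: "'a::division_ring mat"
  assumes M: "M \<in> carrier_mat n n" and inv: "invertible_mat M" and n: "0 < n"
  shows "\<exists>E\<in>elementary_group n. \<exists>a. a \<noteq> 0 \<and> M = E * multrow_mat n (n - 1) a"
proof -
  from inv obtain M' where inverts: "inverts_mat M M'" "inverts_mat M' M"
    unfolding invertible_mat_def by blast
  have "dim_col M' = n" using arg_cong[OF inverts(1)[unfolded inverts_mat_def], of dim_col] M by simp
  moreover have "dim_row M' = n" using arg_cong[OF inverts(2)[unfolded inverts_mat_def], of dim_col] M by simp
  ultimately have M': "M' \<in> carrier_mat n n" "M' * M = 1\<^sub>m n"
    using inverts(2) by (auto simp: inverts_mat_def)
  note car = elementary_group_carrier
  \<comment> \<open>Otherwise column \<open>t\<close> is a right combination of the earlier unit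
    columns. The vector \<open>u\<close> below records this relation; it is killed by
    \<open>N\<close>, hence by the invertible \<open>M\<close>, although its entry at
    \<open>t\<close> is 1.\<close>
  have nonzero: "\<exists>i<n. t \<le> i \<and> N $$ (i, t) \<noteq> 0"
    if red: "reduces n M N" and t: "t < n" and cols: "\<And>i j. i < n \<Longrightarrow> j < t \<Longrightarrow> N $$ (i, j) = (if i = j then 1 else 0)"
    for N t
  proof (rule ccontr)
    assume "\<not> ?thesis"
    then have low: "N $$ (i, t) = 0" if "t \<le> i" "i < n" for i using that by blast
    have N: "N \<in> carrier_mat n n" using red by (simp add: reduces_def)
    define u where "u = mat n 1 (\<lambda>(j, _). if j = t then 1 else if j < t then - N $$ (j, t) else 0)"
    have u: "u \<in> carrier_mat n 1" by (simp add: u_def)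
    have "N * u = 0\<^sub>m n 1"
    proof (rule eq_matI)
      fix i q assume "i < dim_row (0\<^sub>m n 1)" "q < dim_col (0\<^sub>m n 1)"
      then have i: "i < n" and q: "q = 0" by auto
      have "(N * u) $$ (i, q) = (\<Sum>j<n. N $$ (i, j) * (if j = t then 1 else if j < t then - N $$ (j, t) else 0))"
        using i q by (subst index_mult_mat_sum[OF N u]) (auto simp: u_def intro!: sum.cong)
      also have "\<dots> = (\<Sum>j<n. (if j = t then N $$ (i, t) else 0) + (if j = i then if j < t then - N $$ (j, t) else 0 else 0))"
        using i cols by (intro sum.cong) auto
      also have "\<dots> = 0"
        using t i low[of i] by (simp add: sum.distrib)
      finally show "(N * u) $$ (i, q) = 0\<^sub>m n 1 $$ (i, q)" using i q by simp
    qed (use N u in auto)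
    moreover obtain E where E: "E \<in> elementary_group n" "M = E * N" using red by (auto simp: reduces_def)
    ultimately have "M * u = 0\<^sub>m n 1"
      using assoc_mult_mat[OF car[OF E(1)] N u] car[OF E(1)] by simp
    then have "u = 0\<^sub>m n 1"
      using assoc_mult_mat[OF M'(1) M u] M' u by simp
    then have "u $$ (t, 0) = 0" using t by simp
    then show False using t by (simp add: u_def)
  qed
  \<comment> \<open>Normalising a pivot to 1 by transvections uses a row below it. The last column
    has none, so the induction stops after \<open>n - 1\<close> columns and the last pivot survives
    as \<open>a\<close>.\<close>
  have "\<exists>N. reduces n M N \<and> (\<forall>i<n. \<forall>j<t. N $$ (i, j) = (if i = j then 1 else 0))" if "t \<le> n - 1" for t
    using that
  proof (induction t)
    case 0
    show ?case using M elementary_group.one[of n] by (intro exI[of _ M]) (auto simp: reduces_def intro!: bexI[of _ "1\<^sub>m n"])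
  next
    case (Suc t)
    then obtain N where N: "reduces n M N" "\<And>i j. i < n \<Longrightarrow> j < t \<Longrightarrow> N $$ (i, j) = (if i = j then 1 else 0)" by auto
    have t: "t < n" "Suc t < n" using Suc.prems n by auto
    have "\<exists>N. reduces n M N \<and> (\<forall>i<n. \<forall>j<t. N $$ (i, j) = (if i = j then 1 else 0)) \<and> (\<exists>i<n. t < i \<and> N $$ (i, t) \<noteq> 0)"
    proof (cases "\<exists>i<n. t < i \<and> N $$ (i, t) \<noteq> 0")
      case True
      then show ?thesis using N by blast
    next
      \<comment> \<open>Only the diagonal entry can be nonzero here; adding row \<open>t\<close> to
        the next row puts a nonzero entry below it.\<close>
      case False
      then have "N $$ (t, t) \<noteq> 0" using nonzero[OF N(1) t(1) N(2)] by (metis le_neq_implies_less)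
      moreover have "N \<in> carrier_mat n n" using N(1) by (simp add: reduces_def)
      ultimately show ?thesis
        using reduces_addrow[OF N(1) t(2,1), of 1] t False N(2)
        by (intro exI[of _ "addrow 1 (Suc t) t N"]) (auto intro!: exI[of _ "Suc t"])
    qed
    then obtain N1 k where N1: "reduces n M N1" "\<And>i j. i < n \<Longrightarrow> j < t \<Longrightarrow> N1 $$ (i, j) = (if i = j then 1 else 0)"
      and k: "k < n" "t < k" "N1 $$ (k, t) \<noteq> 0" by auto
    have N1c: "N1 \<in> carrier_mat n n" using N1(1) by (simp add: reduces_def)
    \<comment> \<open>The multiplier is chosen so that the added term equals
      \<open>1 - N1 $$ (t, t)\<close>, which makes the diagonal entry 1 without scaling a
      row.\<close>
    define N2 where "N2 = addrow ((1 - N1 $$ (t, t)) * inverse (N1 $$ (k, t))) t k N1"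
    have N2: "reduces n M N2" unfolding N2_def using N1(1) t k by (intro reduces_addrow) auto
    have N2t: "N2 $$ (t, t) = 1" using N1c t k by (simp add: N2_def mult.assoc)
    have N2c: "N2 $$ (i, j) = (if i = j then 1 else 0)" if "i < n" "j < t" for i j
      using that N1c t k N1(2) by (simp add: N2_def)
    from reduces_column_clear[OF N2 t(1)] N2t N2c t obtain N3 where
      N3: "reduces n M N3" "\<forall>i<n. i \<noteq> t \<longrightarrow> N3 $$ (i, t) = 0" "N3 $$ (t, t) = 1"
      "\<forall>i<n. \<forall>j<t. N3 $$ (i, j) = N2 $$ (i, j)" by auto
    then show ?case using N2c by (intro exI[of _ N3]) (auto simp: less_Suc_eq)
  qed
  from this[of "n - 1"] obtain N where N: "reduces n M N"
    "\<And>i j. i < n \<Longrightarrow> j < n - 1 \<Longrightarrow> N $$ (i, j) = (if i = j then 1 else 0)" by auto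
  have n1: "n - 1 < n" using n by simp
  from nonzero[OF N(1) n1 N(2)] have "N $$ (n - 1, n - 1) \<noteq> 0"
    by (metis One_nat_def Suc_pred le_antisym less_Suc_eq_le n)
  from reduces_column_clear[OF N(1) n1 this] N(2) n1 obtain N' where N': "reduces n M N'"
    "\<forall>i<n. i \<noteq> n - 1 \<longrightarrow> N' $$ (i, n - 1) = 0" "N' $$ (n - 1, n - 1) = N $$ (n - 1, n - 1)"
    "\<forall>i<n. \<forall>j<n - 1. N' $$ (i, j) = N $$ (i, j)" by auto
  have "N' = multrow_mat n (n - 1) (N $$ (n - 1, n - 1))"
  proof (rule eq_matI)
    fix i j assume "i < dim_row (multrow_mat n (n - 1) (N $$ (n - 1, n - 1)))"
      "j < dim_col (multrow_mat n (n - 1) (N $$ (n - 1, n - 1)))"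
    then have ij: "i < n" "j < n" by auto
    show "N' $$ (i, j) = multrow_mat n (n - 1) (N $$ (n - 1, n - 1)) $$ (i, j)"
    proof (cases "j = n - 1")
      case True
      then show ?thesis using ij N' by auto
    next
      case False
      then have "j < n - 1" using ij by simp
      then show ?thesis using ij N'(4) N(2) by auto
    qed
  qed (use N'(1) in \<open>auto simp: reduces_def\<close>)
  then show ?thesis using N'(1) \<open>N $$ (n - 1, n - 1) \<noteq> 0\<close> by (auto simp: reduces_def)
qed

text \<open>Transvections and commutators contribute determinant 1, so every \<open>a * c\<close> in
  the defining set has the same reduced norm, given by the determinant of \<phi> applied to
  \<open>M\<close>. The image of the set is thus a singleton, as \<open>the_elem\<close>
  expects.\<close>

theorem reduced_norm_dieudonne_det:
  fixes s :: "'f::field \<Rightarrow> 'a::division_ring"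
  assumes rn: "\<And>x. to_ac (reduced_norm s x) = det (\<phi> x)" and rep: "mat_rep \<phi> d"
    and M: "M \<in> carrier_mat n n" and n: "0 < n" and inv: "invertible_mat M"
  shows "to_ac (reduced_norm_coset s (dieudonne_det M)) = det (block_map d \<phi> M)"
proof -
  interpret mat_rep \<phi> d by fact
  have val: "det (\<phi> a) = det (block_map d \<phi> M)"
    if "E \<in> elementary_group n" "M = E * multrow_mat n (n - 1) a" for E a
    using that det_block_map_elementary[OF rep that(1)] det_block_map_multrow_mat[OF rep n]
    by (simp add: det_block_map_mult[of _ n] elementary_group_carrier)
  have rn_val: "reduced_norm s (a * c) = of_ac (det (block_map d \<phi> M))"
    if "E \<in> elementary_group n" "M = E * multrow_mat n (n - 1) a" "c \<in> unit_commutators" for E a c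
  proof -
    have "to_ac (reduced_norm s (a * c)) = det (block_map d \<phi> M)"
      using val[OF that(1,2)] det_unit_commutator[OF rep that(3)] by (simp add: rn det_mult_rep)
    then show ?thesis by (metis of_ac_to_ac)
  qed
  obtain E a where E: "E \<in> elementary_group n" "a \<noteq> 0" "M = E * multrow_mat n (n - 1) a"
    using elementary_diagonal_decomposition[OF M inv n] by blast
  let ?C = "{a * c | a c. a \<noteq> 0 \<and> c \<in> unit_commutators \<and> (\<exists>E \<in> elementary_group n. M = E * multrow_mat n (n - 1) a)}"
  have mem: "a * 1 \<in> ?C" using E unit_commutators.one by blast
  have C_val: "reduced_norm s x = of_ac (det (block_map d \<phi> M))" if "x \<in> ?C" for x
    using that rn_val by blast
  have "reduced_norm s ` ?C = {of_ac (det (block_map d \<phi> M))}"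
  proof (rule subset_antisym)
    show "reduced_norm s ` ?C \<subseteq> {of_ac (det (block_map d \<phi> M))}"
      by (rule image_subsetI) (simp only: C_val singleton_iff)
    show "{of_ac (det (block_map d \<phi> M))} \<subseteq> reduced_norm s ` ?C"
      using imageI[OF mem, of "reduced_norm s"] C_val[OF mem] by simp
  qed
  moreover have "dieudonne_det M = ?C" using inv M by (simp add: dieudonne_det_def)
  ultimately have "reduced_norm_coset s (dieudonne_det M) = of_ac (det (block_map d \<phi> M))"
    by (simp add: reduced_norm_coset_def)
  moreover have "of_ac (det (block_map d \<phi> M)) = reduced_norm s a"
    using rn_val[OF E(1,3) unit_commutators.one] by simp
  ultimately show ?thesis using rn val[OF E(1,3)] by simp
qed

subsection \<open>The norm formula\<close>

text \<open>Solving for the coordinates of 1 gives a right inverse \<open>y\<close>. Then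
  \<open>y\<close> also has nonzero determinant and a right inverse, which must be
  \<open>x\<close>.\<close>

lemma unit_if_det_lmat_nonzero:
  fixes j :: "'a::field \<Rightarrow> 'b::ring_1"
  assumes "right_basis j n w" "det (left_mult_matrix j n w x) \<noteq> 0"
  shows "\<exists>y. x * y = 1 \<and> y * x = 1"
proof -
  interpret right_basis_comm j n w using assms(1) by (simp add: right_basis_comm_def)
  have right_inverse: "\<exists>y. x * y = 1" if det: "det (lmat x) \<noteq> 0" for x
  proof -
    obtain T where T: "T \<in> carrier_mat n n" "lmat x * T = 1\<^sub>m n"
      using det_non_zero_imp_unit[OF lmat_carrier det, of "()"] by (auto simp: Units_def ring_mat_def)
    define e where "e = vec n (coord 1)"
    have e: "e \<in> carrier_vec n" by (simp add: e_def)
    define u where "u = T *\<^sub>v e"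
    have u: "u \<in> carrier_vec n" unfolding u_def by (rule mult_mat_vec_carrier[OF T(1) e])
    have xu: "lmat x *\<^sub>v u = e"
      unfolding u_def using assoc_mult_mat_vec[OF lmat_carrier T(1) e, of x] T(2) e by simp
    define y where "y = (\<Sum>k<n. w k * j (vec_index u k))"
    have "x * y = 1"
    proof (rule coord_inj)
      fix k assume k: "k < n"
      have "coord (x * y) k = (\<Sum>l<n. lmat x $$ (k, l) * vec_index u l)"
        using k coord_eqI[OF y_def] by (simp add: coord_mult)
      also have "\<dots> = vec_index (lmat x *\<^sub>v u) k"
        using k u carrier_matD[OF lmat_carrier[of x]] by (simp add: scalar_prod_def atLeast0LessThan)
      also have "\<dots> = coord 1 k" using k by (simp add: xu e_def)
      finally show "coord (x * y) k = coord 1 k" .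
    qed
    then show ?thesis by blast
  qed
  from right_inverse[OF assms(2)] obtain y where y: "x * y = 1" by blast
  then have "det (lmat x) * det (lmat y) = 1"
    using lmat.det_mult_rep[of x y] by (simp add: lmat_one)
  then have "det (lmat y) \<noteq> 0" by auto
  from right_inverse[OF this] obtain z where z: "y * z = 1" by blast
  have "x = x * y * z" using z by (simp add: mult.assoc)
  then have "x = z" by (simp add: y)
  with y z show ?thesis by blast
qed

lemma invertible_left_mult_matrix:
  assumes "right_basis j n w" "x * y = 1" "y * x = 1"
  shows "invertible_mat (left_mult_matrix j n w x)"
proof -
  interpret right_basis j n w by fact
  have "lmat x * lmat y = 1\<^sub>m n" "lmat y * lmat x = 1\<^sub>m n"
    using assms(2,3) by (simp_all add: lmat_mult[symmetric] lmat_one)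
  then show ?thesis
    using carrier_matD[OF lmat_carrier] unfolding invertible_mat_def inverts_mat_def square_mat.simps by metis
qed

lemma block_index_eq_iff:
  assumes "(p::nat) < m" "q < m"
  shows "i * m + p = j * m + q \<longleftrightarrow> i = j \<and> p = q"
proof
  assume eq: "i * m + p = j * m + q"
  have "(i * m + p) div m = i" "(j * m + q) div m = j" using assms by simp_all
  with eq show "i = j \<and> p = q" by simp
qed simp

context algebra_tensor_product
begin

text \<open>Reordering the basis acts on rows and columns alike and keeps the diagonal, so it
  carries one pencil to the other.\<close>

lemma det_pencil_transfer:
  "det (pencil (block_map n K.lmat (BK.lmat y))) = det (pencil (block_map m A.lmat (BA.lmat y)))"
proof (rule det_swap_block_indices)
  let ?P = "block_map n K.lmat (BK.lmat y)" and ?R = "block_map m A.lmat (BA.lmat y)"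
  have P: "?P \<in> carrier_mat (m * n) (m * n)" and R: "?R \<in> carrier_mat (n * m) (n * m)"
    by (rule block_map_carrier, rule BK.lmat_carrier, rule block_map_carrier, rule BA.lmat_carrier)
  show "pencil ?P \<in> carrier_mat (m * n) (m * n)" "pencil ?R \<in> carrier_mat (n * m) (n * m)"
    using P R by simp_all
  fix i j k l assume ij: "i < m" "j < m" and kl: "k < n" "l < n"
  have "i * n + k = j * n + l \<longleftrightarrow> i = j \<and> k = l" "k * m + i = l * m + j \<longleftrightarrow> i = j \<and> k = l"
    using block_index_eq_iff[OF kl] block_index_eq_iff[OF ij] by auto
  moreover have "?P $$ (i * n + k, j * n + l) = ?R $$ (k * m + i, l * m + j)"
    using ij kl by (simp add: block_map_index[OF BK.lmat_carrier] block_map_index[OF BA.lmat_carrier]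
        block_index_less lmat_swap)
  ultimately show "pencil ?P $$ (i * n + k, j * n + l) = pencil ?R $$ (k * m + i, l * m + j)"
    using ij kl by (simp add: pencil_index[OF P] pencil_index[OF R] block_index_less)
qed

end

theorem theorem5:
  fixes sA :: "'f::field \<Rightarrow> 'a::division_ring"
    and sK :: "'f \<Rightarrow> 'k::field"
    and jA :: "'a \<Rightarrow> 'b::ring_1"
    and jK :: "'k \<Rightarrow> 'b"
    and d n :: nat
    and w :: "nat \<Rightarrow> 'k"
    and \<alpha> :: "nat \<Rightarrow> 'a"
    and \<Delta> :: 'b
  assumes "central_simple_algebra sA d"
    and "CHAR('f) = 0 \<or> d < CHAR('f)"
    and "algebra_map sK"
    and "algebra_basis sK n w"
    and "is_tensor_product sA sK jA jK"
    and "\<Delta> = (\<Sum>i<n. jA (\<alpha> i) * jK (w i))"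
  shows "field_norm sK (reduced_norm jK \<Delta>) =
    reduced_norm_coset sA (dieudonne_det (left_mult_matrix jA n (\<lambda>i. jK (w i)) \<Delta>))"
proof -
  have algA: "algebra_map sA" and center: "{z. \<forall>x. z * x = x * z} = range sA"
    using assms(1) by (auto simp: central_simple_algebra_def)
  obtain b where "algebra_basis sA (d * d) b"
    using assms(1) by (auto simp: central_simple_algebra_def power2_eq_square)
  then have basis_A: "right_basis sA (d * d) b" using algebra_basis_iff_right_basis[OF algA] by blast
  have basis_K: "right_basis sK n w" using algebra_basis_iff_right_basis[OF assms(3)] assms(4) by blast
  interpret algebra_tensor_product sA sK jA jK "d * d" b n w
    using algA assms(3,5) basis_A basis_K by (rule algebra_tensor_product.intro)
  have ac_F: "comm_ring_hom (to_ac :: 'f \<Rightarrow> 'f alg_closure)"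
    and ac_K: "comm_ring_hom (to_ac :: 'k \<Rightarrow> 'k alg_closure)"
    by (unfold_locales; simp)+
  \<comment> \<open>Through \<open>sK\<close> the closure of K is an extension of F, over which A is
    split before the splitting is extended to A \<otimes> K.\<close>
  have ac_sK: "comm_ring_hom ((to_ac :: 'k \<Rightarrow> 'k alg_closure) \<circ> sK)"
    by unfold_locales (auto simp: K.j.hom_add K.j.hom_mult)
  obtain d1 \<phi> where "split_algebra sA (d * d) b \<phi> d1 (to_ac :: 'f \<Rightarrow> 'f alg_closure)"
    using exists_split_algebra[OF algA center ac_F basis_A] by blast
  \<comment> \<open>Both squares are the dimension of A over F.\<close>
  moreover from this have "d1 = d"
    using split_algebra.dim_eq by (metis power2_eq_square power2_eq_iff_nonneg zero_le)
  ultimately interpret \<phi>: split_algebra sA "d * d" b \<phi> d "to_ac :: 'f \<Rightarrow> 'f alg_closure" by simp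
  obtain d2 \<phi>' where "split_algebra sA (d * d) b \<phi>' d2 ((to_ac :: 'k \<Rightarrow> 'k alg_closure) \<circ> sK)"
    using exists_split_algebra[OF algA center ac_sK basis_A] by blast
  moreover from this have "d2 = d"
    using split_algebra.dim_eq by (metis power2_eq_square power2_eq_iff_nonneg zero_le)
  ultimately obtain \<psi> where \<psi>: "split_algebra jK (d * d) (\<lambda>i. jA (b i)) \<psi> d (to_ac :: 'k \<Rightarrow> 'k alg_closure)"
    using split_algebra_extend[OF _ ac_K] by blast
  have d_pos: "0 < d" by (rule \<phi>.degree_pos)
  \<comment> \<open>A positive \<open>d\<close> below the characteristic is not divisible by
    it.\<close>
  have d_F: "of_nat d \<noteq> (0 :: 'f)"
    using assms(2) d_pos by (auto simp: of_nat_eq_0_iff_char_dvd dest: dvd_imp_le)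
  have sK_nz: "sK c \<noteq> 0" if "c \<noteq> 0" for c
    using K.j.hom_mult[of c "inverse c"] that by auto
  have d_K: "of_nat d \<noteq> (0 :: 'k)"
    using sK_nz[OF d_F] by (simp add: K.j.hom_of_nat)
  have n_pos: "0 < n"
  proof (rule gr0I)
    assume "n = 0"
    then show False using K.expand[of 1] by simp
  qed
  note rn_A = reduced_norm_splitting[OF algA basis_A splitting_of_split_algebra[OF \<phi>.split_algebra_axioms] d_F]
  note rn_K = reduced_norm_splitting[OF algebra_map_jK right_basis_over_K splitting_of_split_algebra[OF \<psi>] d_K]
  interpret \<kappa>: mat_rep_field K.lmat n by unfold_locales (rule n_pos)
  let ?N = "reduced_norm jK \<Delta>" and ?R = "BA.lmat \<Delta>"
  have R: "?R \<in> carrier_mat n n" by simp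
  \<comment> \<open>\<open>P\<close> is the polynomial over K that the reduced norm attaches to the
    pencil of \<Delta>.\<close>
  obtain P where P: "poly P 0 = 1" "poly P 1 = ?N" "P ^ d = det (pencil (BK.lmat \<Delta>))"
    using rn_K(2)[of \<Delta>] by blast
  have norm: "field_norm sK x = det (K.lmat x)" for x
    by (rule field_norm_eq[OF assms(3) basis_K])
  show ?thesis
  proof (cases "invertible_mat ?R")
    case True
    \<comment> \<open>\<open>?f\<close> is the norm of \<open>P\<close> from K[T] to F[T], and
      \<open>?g\<close> is the pencil determinant of \<phi> applied to \<rho>(\<Delta>). Their
      values at 1 are the two sides of the claim.\<close>
    let ?f = "det (poly_rep n K.lmat P)" and ?g = "det (pencil (block_map d \<phi> ?R))"
    have block: "block_map d \<phi> ?R \<in> carrier_mat (n * d) (n * d)" by (rule block_map_carrier[OF R])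
    interpret mp: comm_ring_hom "map_poly (to_ac :: 'f \<Rightarrow> 'f alg_closure)"
      by (rule comm_ring_hom_map_poly[OF ac_F])
    have "det (poly_rep n K.lmat (P ^ k)) = ?f ^ k" for k
      by (induction k) (simp_all add: \<kappa>.poly_rep.one \<kappa>.poly_rep.det_mult_rep)
    then have "?f ^ d = det (pencil (block_map n K.lmat (BK.lmat \<Delta>)))"
      using \<kappa>.det_pencil_block_map[OF BK.lmat_carrier, of \<Delta>] P(3) by metis
    also have "\<dots> = det (pencil (block_map (d * d) A.lmat ?R))" by (rule det_pencil_transfer)
    \<comment> \<open>Both d-th powers are the pencil determinant of \<Delta> on A \<otimes> K over
      F, reached through K for \<open>?f\<close> and through A for \<open>?g\<close>.\<close>
    finally have "map_poly to_ac ?f ^ d = ?g ^ d"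
      using \<phi>.det_pencil_split[OF R] by (simp flip: mp.hom_power)
    moreover have ev: "poly (map_poly to_ac p) (to_ac c) = (to_ac (poly p c) :: 'f alg_closure)" for p c
      by (induction p) (auto simp: map_poly_pCons_fix0)
    have "poly (map_poly to_ac ?f) 0 = (1 :: 'f alg_closure)"
      using ev[of ?f 0] \<kappa>.poly_det_poly_rep_0[of P] P(1) by (simp add: K.lmat_one)
    moreover have "poly ?g 0 = 1" by (rule poly_det_pencil_0[OF block])
    moreover have "of_nat d \<noteq> (0 :: 'f alg_closure)" using d_F by (metis to_ac_of_nat to_ac_eq_0_iff)
    ultimately have "map_poly to_ac ?f = ?g" by (rule poly_power_eq_imp_eq)
    then have "to_ac (det (K.lmat ?N)) = det (block_map d \<phi> ?R)"
      using ev[of ?f 1] \<kappa>.poly_det_poly_rep_1[of P] P(2) poly_det_pencil_1[OF block] by simp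
    also have "\<dots> = to_ac (reduced_norm_coset sA (dieudonne_det ?R))"
      by (rule reduced_norm_dieudonne_det[OF rn_A(1) \<phi>.mat_rep_axioms R n_pos True, symmetric])
    finally show ?thesis by (simp add: norm)
  next
    case False
    \<comment> \<open>A nonzero reduced norm would make multiplication by \<Delta> invertible over
      K; then \<Delta> would be a unit and \<rho>(\<Delta>) invertible.\<close>
    have "?N = 0"
    proof (rule ccontr)
      assume "?N \<noteq> 0"
      moreover have "det (BK.lmat \<Delta>) = ?N ^ d"
        using poly_det_pencil_1[OF BK.lmat_carrier, of \<Delta>] by (simp flip: P(2,3))
      ultimately have "det (BK.lmat \<Delta>) \<noteq> 0" by simp
      then show False
        using unit_if_det_lmat_nonzero[OF right_basis_over_K] invertible_left_mult_matrix[OF right_basis_over_A] False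
        by blast
    qed
    \<comment> \<open>Both sides are 0: the matrices representing 0 are zero matrices of the
      positive sizes \<open>n\<close> and \<open>d\<close>, so their determinants vanish.\<close>
    then have "field_norm sK ?N = 0" using n_pos by (simp add: norm K.lmat.zero)
    moreover have "reduced_norm sA 0 = 0"
      using rn_A(1)[of 0] d_pos by (simp add: \<phi>.zero)
    ultimately show ?thesis using False by (simp add: dieudonne_det_def reduced_norm_coset_def)
  qed
qed

end
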